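(* Let $0 \le \alpha < \infty$ and let $\{x_1,\dots,x_n\}\subset\mathbb{R}^2$ be a cluster of $n$ particles satisfying property (P). For $1 \le i \le n$ and large $r$, let $p_i(r)$ be the probability that the gradient ascent flow of $E$, started at a uniformly random point of the circle $\{x\in\mathbb{R}^2 : \|x\| = r\}$, attaches to $x_i$. Then for every $1\le i \le n$ the limit $\lim_{r\to\infty} p_i(r)$ exists, and $$\sum_{i=1}^n \lim_{r\to\infty} p_i(r) = 1.$$
   Context: Energy: for $0<\alpha<\infty$, $E(x)=\sum_{i=1}^n \|x-x_i\|^{-\alpha}$; for $\alpha=0$, $E(x)=\sum_{i=1}^n \log(1/\|x-x_i\|)$. Cluster: particles are disks of radius $1/2$ identified with their centers. A cluster of $n$ particles is a set $\{x_1,\dots,x_n\}\subset\mathbb{R}^2$ with $x_1=0$, with $\|x_i-x_j\|\ge 1$ for $i\neq j$, and such that the graph joining $x_i$ and $x_j$ whenever $\|x_i-x_j\|=1$ is connected (as is always the case for configurations produced by Gradient Flow Aggregation). Property (P): the function $E$ has only finitely many critical points (points $x$ with $\nabla E(x)=0$). Attaching: the gradient ascent flow is $\dot{x}(t)=\nabla E(x(t))$. A flow started outside the unit disks around the particles attaches to $x_i$ if it reaches distance $1$ from $x_i$ and this is the first time that it is at distance $1$ from any of the points $x_1,\dots,x_n$; the flow is stopped at that time. *)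

theory Defs
  imports "HOL-Probability.Probability"
begin

text \<open>Particles are indexed by \<open>{1..n}\<close>; values of \<open>x\<close> outside this range play no role.\<close>

definition energy :: "real \<Rightarrow> nat \<Rightarrow> (nat \<Rightarrow> real^2) \<Rightarrow> real^2 \<Rightarrow> real" where
  "energy \<alpha> n x z =
     (if \<alpha> = 0 then (\<Sum>i=1..n. ln (1 / norm (z - x i)))
      else (\<Sum>i=1..n. norm (z - x i) powr (- \<alpha>)))"

definition contact_graph :: "nat \<Rightarrow> (nat \<Rightarrow> real^2) \<Rightarrow> (nat \<times> nat) set" where
  "contact_graph n x = {(i, j). i \<in> {1..n} \<and> j \<in> {1..n} \<and> norm (x i - x j) = 1}"

definition is_cluster :: "nat \<Rightarrow> (nat \<Rightarrow> real^2) \<Rightarrow> bool" where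
  "is_cluster n x \<longleftrightarrow>
     1 \<le> n \<and> x 1 = 0 \<and>
     (\<forall>i\<in>{1..n}. \<forall>j\<in>{1..n}. i \<noteq> j \<longrightarrow> norm (x i - x j) \<ge> 1) \<and>
     (\<forall>i\<in>{1..n}. \<forall>j\<in>{1..n}. (i, j) \<in> (contact_graph n x)\<^sup>*)"

text \<open>The particles themselves are excluded explicitly: there the energy is infinite on paper,
  while its formal counterpart takes the default values of \<open>powr\<close>, \<open>ln\<close> and division at \<open>0\<close>.\<close>

definition critical_points :: "real \<Rightarrow> nat \<Rightarrow> (nat \<Rightarrow> real^2) \<Rightarrow> (real^2) set" where
  "critical_points \<alpha> n x = {z. z \<notin> x ` {1..n} \<and> GDERIV (energy \<alpha> n x) z :> 0}"

definition property_P :: "real \<Rightarrow> nat \<Rightarrow> (nat \<Rightarrow> real^2) \<Rightarrow> bool" where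
  "property_P \<alpha> n x \<longleftrightarrow> finite (critical_points \<alpha> n x)"

definition ascent_flow_on ::
    "real \<Rightarrow> nat \<Rightarrow> (nat \<Rightarrow> real^2) \<Rightarrow> real \<Rightarrow> (real \<Rightarrow> real^2) \<Rightarrow> bool" where
  "ascent_flow_on \<alpha> n x T \<gamma> \<longleftrightarrow>
     (\<forall>t\<in>{0..T}. \<exists>v. GDERIV (energy \<alpha> n x) (\<gamma> t) :> v \<and>
        (\<gamma> has_vector_derivative v) (at t within {0..T}))"

text \<open>The flow is stopped at the attachment time \<open>T\<close>, so it is only required to be a solution on
  \<open>{0..T}\<close>; up to that time it stays away from the singularities and is uniquely determined by
  its starting point \<open>z\<close>.\<close>

definition attaches :: "real \<Rightarrow> nat \<Rightarrow> (nat \<Rightarrow> real^2) \<Rightarrow> real^2 \<Rightarrow> nat \<Rightarrow> bool" where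
  "attaches \<alpha> n x z i \<longleftrightarrow>
     (\<forall>j\<in>{1..n}. norm (z - x j) > 1) \<and>
     (\<exists>T\<ge>0. \<exists>\<gamma>. \<gamma> 0 = z \<and> ascent_flow_on \<alpha> n x T \<gamma> \<and>
        norm (\<gamma> T - x i) = 1 \<and>
        (\<forall>t\<in>{0..<T}. \<forall>j\<in>{1..n}. norm (\<gamma> t - x j) \<noteq> 1))"

text \<open>A uniformly random point of the circle of radius \<open>r\<close> is \<open>(r cos \<theta>, r sin \<theta>)\<close> with the
  angle \<open>\<theta>\<close> uniformly distributed on \<open>{0..<2 * pi}\<close>.\<close>

definition angle_measure :: "real measure" where
  "angle_measure = uniform_measure lborel {0..<2 * pi}"

definition attach_event :: "real \<Rightarrow> nat \<Rightarrow> (nat \<Rightarrow> real^2) \<Rightarrow> real \<Rightarrow> nat \<Rightarrow> real set" where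
  "attach_event \<alpha> n x r i =
     {\<theta> \<in> space angle_measure. attaches \<alpha> n x (r *\<^sub>R vector [cos \<theta>, sin \<theta>]) i}"

definition attach_prob :: "real \<Rightarrow> nat \<Rightarrow> (nat \<Rightarrow> real^2) \<Rightarrow> real \<Rightarrow> nat \<Rightarrow> real" where
  "attach_prob \<alpha> n x r i = measure angle_measure (attach_event \<alpha> n x r i)"

end

theory Submission
  imports Defs
begin

text \<open>Attachment is decided by the flow of a globally Lipschitz field that agrees with \<open>\<nabla>E\<close> outside the
  disks of radius \<open>1/2\<close>. In dimension two \<open>\<Delta>E \<ge> 0\<close> away from the particles, so the ascent flow does
  not decrease area. A bounded set of points that never attach is mapped into itself while \<open>E\<close> stays
  bounded on it; were its area positive, area expansion and the finiteness of the critical points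
  would force \<open>E\<close> to grow at a fixed average rate. Hence almost every point outside the unit disks, and by Fubini
  almost every point of almost every large circle, attaches, and only finitely many points of a
  circle attach to two particles at once.

  For the existence of the limits, use \<open>\<epsilon> = 1/r\<close> as time: the angular equation of the flow far away is
  regular up to \<open>\<epsilon> = 0\<close>. Its solution maps from angles at infinity to angles on the circle of radius
  \<open>1/\<epsilon>\<close> are bi-Lipschitz with constant \<open>exp (C \<epsilon>)\<close>, so \<open>p\<^sub>i(r)\<close> converges to the normalised measure
  of the set of angles at infinity that lead to \<open>x\<^sub>i\<close>.\<close>

subsection \<open>Ordinary differential equations with bounded Lipschitz right-hand side\<close>

text \<open>The area estimate never differentiates the flow in its initial value. It is proved for
  Euler steps \<open>y + h *\<^sub>R field y\<close>, whose Jacobian is explicit: its determinant is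
  1, plus h times a non-negative trace, plus O(h^2). Hence t/h steps lose only O(h) of the area, and
  the iterates converge to the flow. The sign of the Laplacian is used only where the truncation is
  inactive; orbits that never attach keep distance at least 1 from the particles, and cutting at 1/2
  leaves room for the Euler error.

  Fubini alone says nothing about a particular radius. The limits are therefore obtained separately,
  for each particle and along all radii, and only their sum is identified through almost every
  radius. Time is a bad parameter for comparing circles, because an orbit needs infinite time to
  come from infinity; in \<epsilon> the whole outer end of an orbit has length 1/r, so the
  distortion \<open>exp (C * \<epsilon>)\<close> tends to 1.\<close>

lemma mono_of_derivative_nonneg_within:
  fixes g :: "real \<Rightarrow> real"
  assumes "a \<le> b"
    and der: "\<And>t. t \<in> {a..b} \<Longrightarrow> (g has_real_derivative g' t) (at t within {a..b})"
    and nn: "\<And>t. t \<in> {a..b} \<Longrightarrow> 0 \<le> g' t"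
  shows "g a \<le> g b"
proof (rule DERIV_nonneg_imp_increasing_open[OF \<open>a \<le> b\<close>])
  show "continuous_on {a..b} g"
    by (rule DERIV_continuous_on) (use der in auto)
  fix x assume x: "a < x" "x < b"
  then have "(g has_real_derivative g' x) (at x)"
    using der[of x] at_within_Icc_at[of a x b] by auto
  with nn[of x] x show "\<exists>y. (g has_real_derivative y) (at x) \<and> 0 \<le> y" by auto
qed

text \<open>Gronwall's argument in both directions: the bound on \<open>e'\<close> makes
  \<open>exp (- K * (t - a)) * e t\<close> non-increasing and \<open>exp (K * (t - a)) * e t\<close>
  non-decreasing.\<close>

lemma exp_growth_bounds:
  fixes e :: "real \<Rightarrow> real"
  assumes "a \<le> b"
    and der: "\<And>t. t \<in> {a..b} \<Longrightarrow> (e has_real_derivative e' t) (at t within {a..b})"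
    and bd: "\<And>t. t \<in> {a..b} \<Longrightarrow> \<bar>e' t\<bar> \<le> K * e t"
  shows "e b \<le> exp (K * (b - a)) * e a" and "e a \<le> exp (K * (b - a)) * e b"
proof -
  have "- (exp (- K * (a - a)) * e a) \<le> - (exp (- K * (b - a)) * e b)"
  proof (rule mono_of_derivative_nonneg_within[OF \<open>a \<le> b\<close>])
    fix t assume t: "t \<in> {a..b}"
    show "((\<lambda>t. - (exp (- K * (t - a)) * e t)) has_real_derivative
        exp (- K * (t - a)) * (K * e t - e' t)) (at t within {a..b})"
      by (rule derivative_eq_intros refl der[OF t])+ (simp add: algebra_simps)
    show "0 \<le> exp (- K * (t - a)) * (K * e t - e' t)"
      using bd[OF t] by simp
  qed
  then have "exp (K * (b - a)) * (exp (- (K * (b - a))) * e b) \<le> exp (K * (b - a)) * e a"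
    by simp
  then show "e b \<le> exp (K * (b - a)) * e a"
    by (simp flip: mult.assoc exp_add)
  have "exp (K * (a - a)) * e a \<le> exp (K * (b - a)) * e b"
  proof (rule mono_of_derivative_nonneg_within[OF \<open>a \<le> b\<close>])
    fix t assume t: "t \<in> {a..b}"
    show "((\<lambda>t. exp (K * (t - a)) * e t) has_real_derivative
        exp (K * (t - a)) * (K * e t + e' t)) (at t within {a..b})"
      by (rule derivative_eq_intros refl der[OF t])+ (simp add: algebra_simps)
    show "0 \<le> exp (K * (t - a)) * (K * e t + e' t)"
      using bd[OF t] by simp
  qed
  then show "e a \<le> exp (K * (b - a)) * e b" by simp
qed

text \<open>The squared distance is used because it stays differentiable where the two solutions
  meet; by Cauchy-Schwarz its growth rate is at most \<open>2 * L\<close>. The reversed estimate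
  replaces a backward flow: it yields injectivity and the lower Lipschitz bounds.\<close>

lemma ode_dist_bounds:
  fixes u v :: "real \<Rightarrow> 'a::real_inner"
  assumes "a \<le> b"
    and u: "\<And>t. t \<in> {a..b} \<Longrightarrow> (u has_vector_derivative f t (u t)) (at t within {a..b})"
    and v: "\<And>t. t \<in> {a..b} \<Longrightarrow> (v has_vector_derivative f t (v t)) (at t within {a..b})"
    and lip: "\<And>t x y. t \<in> {a..b} \<Longrightarrow> norm (f t x - f t y) \<le> L * norm (x - y)"
  shows "norm (u b - v b) \<le> exp (L * (b - a)) * norm (u a - v a)"
    and "norm (u a - v a) \<le> exp (L * (b - a)) * norm (u b - v b)"
proof -
  define e where "e t = (u t - v t) \<bullet> (u t - v t)" for t
  have der: "(e has_real_derivative 2 * ((u t - v t) \<bullet> (f t (u t) - f t (v t)))) (at t within {a..b})"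
    if t: "t \<in> {a..b}" for t
  proof -
    have d: "((\<lambda>t. u t - v t) has_vector_derivative f t (u t) - f t (v t)) (at t within {a..b})"
      using u[OF t] v[OF t] by (rule has_vector_derivative_diff)
    show ?thesis
      unfolding e_def has_real_derivative_iff_has_vector_derivative
      using bounded_bilinear.has_vector_derivative[OF bounded_bilinear_inner d d]
      by (simp add: inner_commute)
  qed
  have bd: "\<bar>2 * ((u t - v t) \<bullet> (f t (u t) - f t (v t)))\<bar> \<le> (2 * L) * e t" if t: "t \<in> {a..b}" for t
  proof -
    have "\<bar>(u t - v t) \<bullet> (f t (u t) - f t (v t))\<bar> \<le> norm (u t - v t) * norm (f t (u t) - f t (v t))"
      by (rule Cauchy_Schwarz_ineq2)
    also have "\<dots> \<le> norm (u t - v t) * (L * norm (u t - v t))"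
      by (intro mult_left_mono lip[OF t]) auto
    also have "\<dots> = L * e t"
      by (simp add: e_def dot_square_norm power2_eq_square)
    finally show ?thesis by (simp add: abs_mult)
  qed
  have ex: "exp (2 * L * (b - a)) = (exp (L * (b - a)))\<^sup>2"
    by (simp add: power2_eq_square flip: exp_add)
  have e: "e t = (norm (u t - v t))\<^sup>2" for t
    by (simp add: e_def dot_square_norm)
  note g = exp_growth_bounds[OF \<open>a \<le> b\<close> der bd, unfolded ex e, simplified]
  show "norm (u b - v b) \<le> exp (L * (b - a)) * norm (u a - v a)"
    by (rule power2_le_imp_le) (use g(1) in \<open>simp_all add: power_mult_distrib\<close>)
  show "norm (u a - v a) \<le> exp (L * (b - a)) * norm (u b - v b)"
    by (rule power2_le_imp_le) (use g(2) in \<open>simp_all add: power_mult_distrib\<close>)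
qed

text \<open>Picard iteration is a contraction for the supremum norm weighted by \<open>exp (- k t)\<close>, so one
  application of Banach's theorem gives a solution for all positive times.\<close>

lemma ode_solution_exists:
  fixes f :: "real \<Rightarrow> 'a::banach \<Rightarrow> 'a"
  assumes cont: "continuous_on UNIV (\<lambda>(t, x). f t x)"
    and bd: "\<And>t x. norm (f t x) \<le> B"
    and lip: "\<And>t x y. norm (f t x - f t y) \<le> L * norm (x - y)"
  obtains u where "u 0 = x0"
    and "\<And>t. 0 \<le> t \<Longrightarrow> (u has_vector_derivative f t (u t)) (at t within {0..})"
proof -
  \<comment> \<open>With this weight the Picard map contracts by \<open>\<bar>L\<bar> / k\<close>,
    which is at most 1/2; the summand 1 keeps \<open>k\<close> positive when
    \<open>L = 0\<close>.\<close>
  define k where "k = 2 * (\<bar>L\<bar> + 1)"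
  have k: "k > 0" by (simp add: k_def)
  have B: "B \<ge> 0" using bd[of 0 0] norm_ge_zero order_trans by blast
  \<comment> \<open>The unknown \<open>v\<close> is the weighted deviation
    \<open>exp (- k * s) *\<^sub>R (u s - x0)\<close>, so \<open>F v\<close> is the right-hand side
    along the curve \<open>u\<close> encoded by \<open>v\<close>.\<close>
  define F where "F v s = f s (x0 + exp (k * s) *\<^sub>R apply_bcontfun v s)" for v :: "real \<Rightarrow>\<^sub>C 'a" and s
  have Fc: "continuous_on A (F v)" for v A
  proof -
    have "continuous_on A ((\<lambda>(t, x). f t x) \<circ> (\<lambda>s. (s, x0 + exp (k * s) *\<^sub>R apply_bcontfun v s)))"
      by (intro continuous_on_compose continuous_intros continuous_on_subset[OF cont]) auto
    then show ?thesis by (simp add: F_def[abs_def] o_def)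
  qed
  have Fi: "F v integrable_on {0..t}" for v t
    by (rule integrable_continuous_real[OF Fc])
  \<comment> \<open>\<open>max 0 t\<close> makes the image vanish at negative times, so that it is a
    bounded continuous function on the whole line, the space to which Banach's theorem is
    applied.\<close>
  define P where "P v t = exp (- k * max 0 t) *\<^sub>R integral {0..max 0 t} (F v)" for v t
  have Pc: "P v \<in> bcontfun" for v
  proof -
    have "continuous_on UNIV (\<lambda>t. integral {0..max 0 t} (F v))"
    proof (subst continuous_on_eq_continuous_within, rule ballI)
      fix t :: real
      define b where "b = max 0 t + 1"
      have "continuous_on {0..b} (\<lambda>s. integral {0..s} (F v))"
        by (rule indefinite_integral_continuous_1[OF Fi])
      then have "continuous_on {..<b} (\<lambda>t. integral {0..max 0 t} (F v))"
        by (rule continuous_on_compose2) (auto intro!: continuous_intros simp: b_def)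
      moreover have "open {..<b}" "t \<in> {..<b}" by (auto simp: b_def)
      ultimately show "isCont (\<lambda>t. integral {0..max 0 t} (F v)) t"
        by (simp add: continuous_on_eq_continuous_at)
    qed
    then have c: "continuous_on UNIV (P v)"
      unfolding P_def[abs_def] by (intro continuous_intros)
    have "norm (P v t) \<le> B / k" for t
    proof -
      define s where "s = max 0 t"
      have s: "s \<ge> 0" by (simp add: s_def)
      have "norm (integral {0..s} (F v)) \<le> B * (s - 0)"
        by (rule integral_bound[OF s Fc]) (simp add: F_def bd)
      moreover have "k * s * exp (- (k * s)) \<le> 1"
      proof -
        have "k * s \<le> exp (k * s)"
          using exp_ge_add_one_self[of "k * s"] by linarith
        then show ?thesis by (simp add: exp_minus divide_simps)
      qed
      ultimately have "norm (P v t) \<le> exp (- k * s) * (B * s)"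
        unfolding P_def s_def[symmetric] by simp
      also have "\<dots> = B / k * (k * s * exp (- (k * s)))"
        using k by simp
      also have "\<dots> \<le> B / k * 1"
        using \<open>k * s * exp (- (k * s)) \<le> 1\<close> B k by (intro mult_left_mono) auto
      finally show ?thesis by simp
    qed
    then have "bounded (range (P v))"
      by (auto simp: bounded_iff)
    with c show ?thesis by (simp add: bcontfun_def)
  qed
  have contr: "dist (Bcontfun (P v)) (Bcontfun (P w)) \<le> 1/2 * dist v w" for v w
  proof (rule dist_bound)
    fix t :: real
    define s where "s = max 0 t"
    have s: "s \<ge> 0" by (simp add: s_def)
    define D where "D = dist v w"
    have D: "norm (apply_bcontfun v r - apply_bcontfun w r) \<le> D" for r
      unfolding D_def by (metis dist_bounded dist_norm)
    have D0: "D \<ge> 0" by (simp add: D_def)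
    have "norm (integral {0..s} (\<lambda>r. F v r - F w r)) \<le> integral {0..s} (\<lambda>r. \<bar>L\<bar> * D * exp (k * r))"
    proof (rule integral_norm_bound_integral)
      show "(\<lambda>r. F v r - F w r) integrable_on {0..s}"
        by (intro integrable_diff Fi)
      show "(\<lambda>r. \<bar>L\<bar> * D * exp (k * r)) integrable_on {0..s}"
        by (intro integrable_continuous_real continuous_intros)
      fix r assume "r \<in> {0..s}"
      have "norm (F v r - F w r) \<le> L * norm (exp (k * r) *\<^sub>R (apply_bcontfun v r - apply_bcontfun w r))"
        unfolding F_def by (rule order_trans[OF lip]) (simp add: scaleR_diff_right)
      also have "\<dots> \<le> \<bar>L\<bar> * (exp (k * r) * D)"
        by (intro mult_mono) (auto intro: D)
      finally show "norm (F v r - F w r) \<le> \<bar>L\<bar> * D * exp (k * r)"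
        by (simp add: mult_ac)
    qed
    also have "integral {0..s} (\<lambda>r. \<bar>L\<bar> * D * exp (k * r)) = \<bar>L\<bar> * D * exp (k * s) / k - \<bar>L\<bar> * D * exp (k * 0) / k"
    proof (rule integral_unique, rule fundamental_theorem_of_calculus[OF s])
      fix r assume "r \<in> {0..s}"
      show "((\<lambda>r. \<bar>L\<bar> * D * exp (k * r) / k) has_vector_derivative \<bar>L\<bar> * D * exp (k * r)) (at r within {0..s})"
        unfolding has_real_derivative_iff_has_vector_derivative[symmetric]
        using k by (auto intro!: derivative_eq_intros)
    qed
    also have "\<dots> \<le> \<bar>L\<bar> * D * exp (k * s) / k"
      using k D0 by simp
    finally have 1: "norm (integral {0..s} (F v) - integral {0..s} (F w)) \<le> \<bar>L\<bar> * D * exp (k * s) / k"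
      by (simp add: integral_diff[OF Fi Fi])
    have "dist (P v t) (P w t) = exp (- k * s) * norm (integral {0..s} (F v) - integral {0..s} (F w))"
      unfolding P_def s_def[symmetric] dist_norm by (simp flip: scaleR_diff_right)
    also have "\<dots> \<le> exp (- k * s) * (\<bar>L\<bar> * D * exp (k * s) / k)"
      by (intro mult_left_mono 1) auto
    also have "\<dots> = \<bar>L\<bar> / k * D"
      by (simp add: exp_minus)
    also have "\<dots> \<le> 1/2 * D"
      by (intro mult_right_mono D0) (simp add: k_def field_simps)
    finally show "dist (apply_bcontfun (Bcontfun (P v)) t) (apply_bcontfun (Bcontfun (P w)) t) \<le> 1/2 * dist v w"
      by (simp add: Bcontfun_inverse[OF Pc] D_def)
  qed
  obtain v where v: "Bcontfun (P v) = v"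
    using banach_fix_type[of "1/2" "\<lambda>v. Bcontfun (P v)"] contr by auto
  define u where "u t = x0 + exp (k * t) *\<^sub>R apply_bcontfun v t" for t
  have vP: "apply_bcontfun v t = P v t" for t
    using Bcontfun_inverse[OF Pc[of v]] v by simp
  have u_int: "u t = x0 + integral {0..t} (\<lambda>s. f s (u s))" if "t \<ge> 0" for t
  proof -
    have "u t = x0 + exp (k * t) *\<^sub>R (exp (- k * t) *\<^sub>R integral {0..t} (F v))"
      using that by (simp add: u_def vP P_def)
    also have "\<dots> = x0 + integral {0..t} (F v)"
      by (simp add: exp_minus)
    finally show ?thesis by (simp add: F_def[abs_def] u_def)
  qed
  show ?thesis
  proof
    show "u 0 = x0" using u_int[of 0] by simp
    fix t :: real assume t: "0 \<le> t"
    have c: "continuous_on {0..t+1} (\<lambda>s. f s (u s))"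
      using Fc[of _ v] by (simp add: F_def[abs_def] u_def)
    have "((\<lambda>t. x0 + integral {0..t} (\<lambda>s. f s (u s))) has_vector_derivative 0 + f t (u t)) (at t within {0..t+1})"
      by (intro has_vector_derivative_add has_vector_derivative_const integral_has_vector_derivative[OF c])
        (use t in auto)
    then have "((\<lambda>t. x0 + integral {0..t} (\<lambda>s. f s (u s))) has_vector_derivative f t (u t)) (at t within {0..t+1})"
      by simp
    then have "(u has_vector_derivative f t (u t)) (at t within {0..t+1})"
      by (rule has_vector_derivative_transform[rotated 2]) (use t u_int in auto)
    moreover have "at t within {0..t+1} = at t within {0..}"
      using t by (intro at_within_nhd[of _ "{t-1<..<t+1}"]) auto
    ultimately show "(u has_vector_derivative f t (u t)) (at t within {0..})" by simp
  qed
qed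

subsection \<open>Measure-theoretic preliminaries\<close>

text \<open>Cover \<open>S\<close> by intervals with little excess length; each cuts
  \<open>S\<close> in a set whose image lies in an interval at most \<open>K\<close> times as long.
  Working with a measurable subset \<open>T\<close> of the image avoids any claim about
  measurability of the image itself.\<close>

lemma measure_le_lipschitz_image:
  fixes h :: "real \<Rightarrow> real"
  assumes S: "S \<in> lmeasurable" "S \<subseteq> {a..b}" and T: "T \<in> sets lebesgue" "T \<subseteq> h ` S"
    and lip: "\<And>x y. x \<in> S \<Longrightarrow> y \<in> S \<Longrightarrow> \<bar>h x - h y\<bar> \<le> K * \<bar>x - y\<bar>" and K: "0 \<le> K"
  shows "measure lebesgue T \<le> K * measure lebesgue S"
proof (rule field_le_epsilon)
  fix e :: real assume e: "e > 0"
  \<comment> \<open>Dividing by \<open>K + 1\<close> rather than by \<open>K\<close> also covers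
    \<open>K = 0\<close>.\<close>
  define e' where "e' = e / (K + 1)"
  have e': "e' > 0" "K * e' \<le> e"
    using e K by (auto simp: e'_def field_simps)
  have S': "S \<subseteq> cbox a b" using S by simp
  obtain \<D> where D: "countable \<D>"
        "\<And>I. I \<in> \<D> \<Longrightarrow> I \<subseteq> cbox a b \<and> I \<noteq> {} \<and> (\<exists>c d. I = cbox c d)"
        "pairwise (\<lambda>A B. interior A \<inter> interior B = {}) \<D>"
        "S \<subseteq> \<Union>\<D>" "\<Union>\<D> \<in> lmeasurable" "measure lebesgue (\<Union>\<D>) \<le> measure lebesgue S + e'"
    using measurable_outer_intervals_bounded[OF S(1) S' e'(1)] by metis
  \<comment> \<open>The hull of the image of \<open>S \<inter> I\<close>; the empty case is set
    apart because \<open>Inf\<close> and \<open>Sup\<close> carry no information there.\<close>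
  define J where "J I = (if S \<inter> I = {} then {} else {Inf (h ` (S \<inter> I))..Sup (h ` (S \<inter> I))})" for I
  have J: "h ` (S \<inter> I) \<subseteq> J I \<and> measure lebesgue (J I) \<le> K * measure lebesgue I" if I: "I \<in> \<D>" for I
  proof (cases "S \<inter> I = {}")
    case True
    then show ?thesis using K by (simp add: J_def)
  next
    case False
    obtain c d where cd: "I = {c..d}" "c \<le> d"
      using D(2)[OF I] by (auto simp: cbox_interval)
    have diam: "h x - h y \<le> K * (d - c)" if "x \<in> S \<inter> I" "y \<in> S \<inter> I" for x y
    proof -
      have "h x - h y \<le> K * \<bar>x - y\<bar>" using lip[of x y] that by auto
      also have "\<dots> \<le> K * (d - c)"
        using that cd K by (intro mult_left_mono) auto
      finally show ?thesis .
    qed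
    obtain x0 where x0: "x0 \<in> S \<inter> I" using False by blast
    have bdd: "bdd_above (h ` (S \<inter> I))" "bdd_below (h ` (S \<inter> I))"
    proof -
      have "h x \<le> h x0 + K * (d - c)" "h x0 - K * (d - c) \<le> h x" if "x \<in> S \<inter> I" for x
        using diam[OF that x0] diam[OF x0 that] by linarith+
      note hx = this
      show "bdd_above (h ` (S \<inter> I))" by (rule bdd_aboveI2[OF hx(1)])
      show "bdd_below (h ` (S \<inter> I))" by (rule bdd_belowI2[OF hx(2)])
    qed
    have "Sup (h ` (S \<inter> I)) \<le> Inf (h ` (S \<inter> I)) + K * (d - c)"
    proof (rule cSUP_least[OF False])
      fix x assume x: "x \<in> S \<inter> I"
      have "h x - K * (d - c) \<le> Inf (h ` (S \<inter> I))"
        by (rule cINF_greatest[OF False]) (use diam[OF x] in \<open>force simp: algebra_simps\<close>)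
      then show "h x \<le> Inf (h ` (S \<inter> I)) + K * (d - c)" by simp
    qed
    moreover have "Inf (h ` (S \<inter> I)) \<le> Sup (h ` (S \<inter> I))"
      using cInf_lower[OF _ bdd(2)] cSup_upper[OF _ bdd(1)] x0 by (meson imageI order_trans)
    ultimately have "measure lebesgue (J I) \<le> K * measure lebesgue I"
      using False cd by (simp add: J_def)
    moreover have "h ` (S \<inter> I) \<subseteq> J I"
      using False by (auto simp: J_def intro!: cInf_lower cSup_upper bdd)
    ultimately show ?thesis by blast
  qed
  have Jm: "J I \<in> lmeasurable" for I
    by (auto simp: J_def)
  have bound: "measure lebesgue (\<Union>I\<in>\<F>. J I) \<le> K * (measure lebesgue S + e')"
    if F: "\<F> \<subseteq> \<D>" "finite \<F>" for \<F>
  proof -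
    have Fm: "I \<in> lmeasurable" if "I \<in> \<F>" for I
      using D(2) F that by blast
    have "measure lebesgue (\<Union>I\<in>\<F>. J I) \<le> (\<Sum>I\<in>\<F>. measure lebesgue (J I))"
      by (intro measure_UNION_le F fmeasurableD Jm)
    also have "\<dots> \<le> (\<Sum>I\<in>\<F>. K * measure lebesgue I)"
      using F J by (intro sum_mono) auto
    also have "\<dots> = K * measure lebesgue (\<Union>\<F>)"
    proof (subst measure_negligible_finite_Union)
      show "pairwise (\<lambda>S T. negligible (S \<inter> T)) \<F>"
        unfolding pairwise_def
      proof (intro ballI impI)
        fix A B assume AB: "A \<in> \<F>" "B \<in> \<F>" "A \<noteq> B"
        have int: "interior A \<inter> interior B = {}"
          using D(3) AB F unfolding pairwise_def by blast
        obtain c d c' d' where [simp]: "A = {c..d}" "B = {c'..d'}"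
          using D(2) F AB by (metis (no_types, lifting) cbox_interval subsetD)
        have "{c<..<d} \<inter> {c'<..<d'} = {}" using int by simp
        then have disj: "\<not> (c < x \<and> x < d \<and> c' < x \<and> x < d')" for x
          by (metis IntI empty_iff greaterThanLessThan_iff)
        \<comment> \<open>Intervals with disjoint interiors meet only in end points, so their
          lengths add up over \<open>\<F>\<close>.\<close>
        have "{c..d} \<inter> {c'..d'} \<subseteq> {c, d, c', d'}"
        proof
          fix x assume "x \<in> {c..d} \<inter> {c'..d'}"
          then show "x \<in> {c, d, c', d'}" using disj[of x] by force
        qed
        then show "negligible (A \<inter> B)"
          by (auto intro: negligible_subset[OF negligible_finite, rotated])
      qed
    qed (use F Fm in \<open>auto simp: sum_distrib_left\<close>)
    also have "\<dots> \<le> K * measure lebesgue (\<Union>\<D>)"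
    proof (intro mult_left_mono measure_mono_fmeasurable K D(5))
      show "\<Union>\<F> \<subseteq> \<Union>\<D>" using F by blast
      show "\<Union>\<F> \<in> sets lebesgue"
        by (rule sets.finite_Union[OF F(2)], rule subsetI, rule fmeasurableD[OF Fm])
    qed
    also have "\<dots> \<le> K * (measure lebesgue S + e')"
      by (rule mult_left_mono[OF D(6) K])
    finally show ?thesis .
  qed
  have "T \<subseteq> (\<Union>I\<in>\<D>. J I)"
  proof
    fix y assume "y \<in> T"
    then obtain x where x: "x \<in> S" "y = h x" using T(2) by auto
    then obtain I where I: "I \<in> \<D>" "x \<in> I" using D(4) by auto
    then have "y \<in> h ` (S \<inter> I)" using x by auto
    then show "y \<in> (\<Union>I\<in>\<D>. J I)" using I(1) J[OF I(1)] by auto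
  qed
  then have "measure lebesgue T \<le> measure lebesgue (\<Union>I\<in>\<D>. J I)"
    by (intro measure_mono_fmeasurable T fmeasurable_UN_bound[OF D(1) Jm bound])
  also have "\<dots> \<le> K * (measure lebesgue S + e')"
    by (rule measure_UN_bound[OF D(1) Jm bound])
  also have "\<dots> \<le> K * measure lebesgue S + e"
    using e' by (simp add: algebra_simps)
  finally show "measure lebesgue T \<le> K * measure lebesgue S + e" .
qed

section \<open>Measure of periodic sets and their equivariant preimages\<close>

lemma lmeasurable_Int_atLeastLessThan:
  fixes u v :: real
  assumes "A \<in> sets lebesgue"
  shows "A \<inter> {u..<v} \<in> lmeasurable"
proof (rule bounded_set_imp_lmeasurable)
  show "bounded (A \<inter> {u..<v})"
    by (rule bounded_subset[OF bounded_closed_interval[of u v]]) auto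
qed (use assms in auto)

lemma periodic_set_of_int:
  fixes p :: real
  assumes per: "\<And>t. t + p \<in> A \<longleftrightarrow> t \<in> A"
  shows "t + of_int k * p \<in> A \<longleftrightarrow> t \<in> A"
proof -
  have nat: "t + of_nat m * p \<in> A \<longleftrightarrow> t \<in> A" for m t
  proof (induction m)
    case (Suc m)
    have "t + of_nat (Suc m) * p = (t + of_nat m * p) + p" by (simp add: algebra_simps)
    then show ?case using Suc per by metis
  qed simp
  show ?thesis
  proof (cases "k \<ge> 0")
    case True
    then show ?thesis using nat[of t "nat k"] by simp
  next
    case False
    then show ?thesis using nat[of "t + of_int k * p" "nat (-k)"] by simp
  qed
qed

text \<open>The window is cut at the multiple \<open>c\<close> of \<open>p\<close> that it contains.
  Translation by multiples of \<open>p\<close> moves the right piece to the start of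
  \<open>{0..<p}\<close> and the left piece to its end.\<close>

lemma measure_periodic_set:
  fixes p :: real
  assumes per: "\<And>t. t + p \<in> A \<longleftrightarrow> t \<in> A" and p: "p > 0" and A: "A \<in> sets lebesgue"
  shows "measure lebesgue (A \<inter> {a..<a+p}) = measure lebesgue (A \<inter> {0..<p})"
proof -
  define k where "k = \<lceil>a / p\<rceil>"
  define c where "c = of_int k * p"
  have "a / p \<le> of_int k" "of_int k < a / p + 1"
    unfolding k_def by linarith+
  then have c: "a \<le> c" "c < a + p"
    using p by (auto simp: c_def field_simps)
  have sh: "t + c \<in> A \<longleftrightarrow> t \<in> A" for t
    unfolding c_def by (rule periodic_set_of_int[OF per])
  have sh': "t + (c - p) \<in> A \<longleftrightarrow> t \<in> A" for t
    using per[of "t + (c - p)"] sh[of t] by (simp add: algebra_simps)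
  have m: "A \<inter> {u..<v} \<in> lmeasurable" for u v
    using A by (rule lmeasurable_Int_atLeastLessThan)
  have tr: "measure lebesgue (A \<inter> {u..<v}) = measure lebesgue (A \<inter> {u-d..<v-d})"
    if d: "\<And>t. t + d \<in> A \<longleftrightarrow> t \<in> A" for u v d
  proof -
    have "x \<in> A \<longleftrightarrow> x - d \<in> A" for x using d[of "x - d"] by simp
    then have "A \<inter> {u..<v} = {x. x - d \<in> A \<inter> {u-d..<v-d}}" by auto
    also have "\<dots> = (+) d ` (A \<inter> {u-d..<v-d})" (is "_ = (+) d ` ?X")
    proof
      show "{x. x - d \<in> ?X} \<subseteq> (+) d ` ?X"
      proof
        fix x assume "x \<in> {x. x - d \<in> ?X}"
        then have "x - d \<in> ?X" by blast
        then show "x \<in> (+) d ` ?X" by (rule rev_image_eqI) simp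
      qed
      show "(+) d ` ?X \<subseteq> {x. x - d \<in> ?X}" by (rule image_subsetI) simp
    qed
    finally show ?thesis by (simp only: measure_translation)
  qed
  have 1: "measure lebesgue (A \<inter> {c..<a+p}) = measure lebesgue (A \<inter> {0..<a+p-c})"
    using tr[OF sh, of c "a + p"] by simp
  have 2: "measure lebesgue (A \<inter> {a..<c}) = measure lebesgue (A \<inter> {a+p-c..<p})"
    using tr[OF sh', of a c] by (simp add: algebra_simps)
  have "A \<inter> {a..<a+p} = A \<inter> {a..<c} \<union> A \<inter> {c..<a+p}" using c by auto
  then have "measure lebesgue (A \<inter> {a..<a+p}) = measure lebesgue (A \<inter> {a..<c}) + measure lebesgue (A \<inter> {c..<a+p})"
    by (simp only:) (intro measure_Un2[THEN trans] m, auto intro!: arg_cong[where f="measure lebesgue"])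
  also have "\<dots> = measure lebesgue (A \<inter> {0..<a+p-c}) + measure lebesgue (A \<inter> {a+p-c..<p})"
    by (simp add: 1 2)
  also have "\<dots> = measure lebesgue (A \<inter> {0..<a+p-c} \<union> A \<inter> {a+p-c..<p})"
    by (rule sym, intro measure_Un2[THEN trans] m) (auto intro!: arg_cong[where f="measure lebesgue"])
  also have "A \<inter> {0..<a+p-c} \<union> A \<inter> {a+p-c..<p} = A \<inter> {0..<p}"
    using c by auto
  finally show ?thesis .
qed

text \<open>A continuous injective map is monotone on an interval, and \<open>f p = f 0 + p\<close>
  excludes the decreasing case.\<close>

lemma equivariant_image_period:
  fixes f :: "real \<Rightarrow> real"
  assumes cont: "continuous_on UNIV f" and inj: "inj f"
    and eqv: "\<And>t. f (t + p) = f t + p" and p: "p > 0"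
  shows "f ` {0..<p} = {f 0..<f 0 + p}"
proof
  have fp: "f p = f 0 + p" using eqv[of 0] by simp
  have c: "continuous_on {a..b} f" for a b by (rule continuous_on_subset[OF cont]) simp
  show "f ` {0..<p} \<subseteq> {f 0..<f 0 + p}"
  proof safe
    fix x assume x: "x \<in> {0..<p}"
    show "f x \<in> {f 0..<f 0 + p}"
    proof (cases "x = 0")
      case False
      then have "(f 0 < f x \<and> f x < f p) \<or> (f p < f x \<and> f x < f 0)"
        using x by (intro continuous_inj_imp_mono c inj_on_subset[OF inj]) auto
      then show ?thesis using fp p by auto
    qed (use p in auto)
  qed
  show "{f 0..<f 0 + p} \<subseteq> f ` {0..<p}"
  proof
    fix y assume y: "y \<in> {f 0..<f 0 + p}"
    obtain x where x: "0 \<le> x" "x \<le> p" "f x = y"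
      using IVT'[of f 0 y p] y fp p c by auto
    with y fp show "y \<in> f ` {0..<p}"
      by (cases "x = p") auto
  qed
qed

text \<open>\<open>f\<close> carries the part of the preimage of \<open>A\<close> in one period onto
  the part of \<open>A\<close> in the shifted period \<open>{f 0..<f 0 + p}\<close>, which by
  periodicity has the same measure as the part in \<open>{0..<p}\<close>. The two estimates are the
  Lipschitz bounds of \<open>f\<close> and of its inverse.\<close>

lemma measure_bilipschitz_equivariant:
  fixes f :: "real \<Rightarrow> real"
  assumes up: "\<And>s t. \<bar>f s - f t\<bar> \<le> K * \<bar>s - t\<bar>" and lo: "\<And>s t. \<bar>s - t\<bar> \<le> K * \<bar>f s - f t\<bar>"
    and eqv: "\<And>t. f (t + p) = f t + p" and p: "p > 0" and K: "K \<ge> 0"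
    and A: "A \<in> sets borel" and per: "\<And>t. t + p \<in> A \<longleftrightarrow> t \<in> A"
  shows "measure lebesgue (A \<inter> {0..<p}) \<le> K * measure lebesgue (f -` A \<inter> {0..<p})"
    and "measure lebesgue (f -` A \<inter> {0..<p}) \<le> K * measure lebesgue (A \<inter> {0..<p})"
proof -
  have "K-lipschitz_on UNIV f"
    by (rule lipschitz_onI) (use up K in \<open>auto simp: dist_real_def\<close>)
  then have cont: "continuous_on UNIV f" by (rule lipschitz_on_continuous_on)
  have inj: "inj f"
    using lo by (intro injI) (metis abs_le_zero_iff cancel_comm_monoid_add_class.diff_cancel eq_iff_diff_eq_0 mult_zero_right abs_zero)
  note im = equivariant_image_period[OF cont inj eqv p]
  define B where "B = f -` A"
  have "f -` A \<inter> space borel \<in> sets borel"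
    by (rule measurable_sets[OF borel_measurable_continuous_onI[OF cont] A])
  then have B: "B \<in> sets borel" by (simp add: B_def)
  have leb: "X \<in> sets lebesgue" if "X \<in> sets borel" for X :: "real set"
    using that by simp
  have m: "X \<inter> {u..<v} \<in> lmeasurable" if "X \<in> sets borel" for X and u v :: real
    by (rule lmeasurable_Int_atLeastLessThan[OF leb[OF that]])
  have fB: "f ` (B \<inter> {0..<p}) = A \<inter> {f 0..<f 0 + p}"
    unfolding im[symmetric] B_def by auto
  have per_eq: "measure lebesgue (A \<inter> {f 0..<f 0 + p}) = measure lebesgue (A \<inter> {0..<p})"
    by (rule measure_periodic_set[OF per p leb[OF A]])
  have "measure lebesgue (A \<inter> {f 0..<f 0 + p}) \<le> K * measure lebesgue (B \<inter> {0..<p})"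
    by (rule measure_le_lipschitz_image[where h=f and a=0 and b=p])
      (use m[OF B] m[OF A] up K fB in auto)
  then show "measure lebesgue (A \<inter> {0..<p}) \<le> K * measure lebesgue (f -` A \<inter> {0..<p})"
    by (simp add: per_eq B_def)
  have "measure lebesgue (B \<inter> {0..<p}) \<le> K * measure lebesgue (A \<inter> {f 0..<f 0 + p})"
  proof (rule measure_le_lipschitz_image[where h="inv f" and a="f 0" and b="f 0 + p"])
    show "B \<inter> {0..<p} \<subseteq> inv f ` (A \<inter> {f 0..<f 0 + p})"
      unfolding fB[symmetric] by (auto simp: image_iff inv_f_f[OF inj] intro!: bexI)
    fix x y assume "x \<in> A \<inter> {f 0..<f 0 + p}" "y \<in> A \<inter> {f 0..<f 0 + p}"
    then obtain x' y' where "x = f x'" "y = f y'" unfolding fB[symmetric] by auto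
    then show "\<bar>inv f x - inv f y\<bar> \<le> K * \<bar>x - y\<bar>"
      by (simp add: inv_f_f[OF inj] lo)
  qed (use m[OF B] m[OF A] K in auto)
  then show "measure lebesgue (f -` A \<inter> {0..<p}) \<le> K * measure lebesgue (A \<inter> {0..<p})"
    by (simp add: per_eq B_def)
qed

section \<open>Polar coordinates and unit circles in the plane\<close>

definition dir :: "real \<Rightarrow> real^2" where "dir \<theta> = vector [cos \<theta>, sin \<theta>]"

lemma dir_nth [simp]: "dir \<theta> $ 1 = cos \<theta>" "dir \<theta> $ 2 = sin \<theta>"
  by (simp_all add: dir_def)

lemma inner_real2: "(u :: real^2) \<bullet> v = u $ 1 * v $ 1 + u $ 2 * v $ 2"
  by (simp add: inner_vec_def UNIV_2)

lemma vec2_eq_iff: "(u :: real^2) = v \<longleftrightarrow> u $ 1 = v $ 1 \<and> u $ 2 = v $ 2"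
  by (simp add: vec_eq_iff forall_2)

lemma norm_dir [simp]: "norm (dir \<theta>) = 1"
  by (simp add: norm_eq_sqrt_inner inner_real2 flip: power2_eq_square)

lemma dir_eq: "dir = (\<lambda>\<theta>. cos \<theta> *\<^sub>R axis 1 1 + sin \<theta> *\<^sub>R axis 2 1)"
  by (simp add: fun_eq_iff vec2_eq_iff axis_def)

lemma dir_inj_on: "inj_on dir {0..<2*pi}"
proof (rule inj_onI)
  fix s t assume st: "s \<in> {0..<2*pi}" "t \<in> {0..<2*pi}" "dir s = dir t"
  then have "sin s = sin t \<and> cos s = cos t" by (simp add: vec2_eq_iff)
  then obtain k :: int where k: "s = t + 2 * pi * of_int k" unfolding sin_cos_eq_iff by blast
  have st': "0 \<le> s" "s < 2*pi" "0 \<le> t" "t < 2*pi" using st by simp_all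
  have "2 * pi * of_int k < 2 * pi * 1" "2 * pi * (-1) < 2 * pi * of_int k"
    using st' k by linarith+
  then have "real_of_int k < 1" "-1 < real_of_int k"
    using mult_less_cancel_left_pos[of "2 * pi"] by (metis m2pi_less_pi pi_gt_zero zero_less_mult_iff zero_less_numeral)+
  then have "k = 0" by linarith
  then show "s = t" using k by simp
qed

lemma dir_periodic: "dir (\<theta> + 2 * pi) = dir \<theta>"
  by (simp add: vec2_eq_iff)

definition dir' :: "real \<Rightarrow> real^2" where "dir' \<theta> = - sin \<theta> *\<^sub>R axis 1 1 + cos \<theta> *\<^sub>R axis 2 1"

lemma dir_has_derivative: "(dir has_vector_derivative dir' \<theta>) (at \<theta> within S)"
  unfolding dir_eq dir'_def
  by (auto intro!: derivative_eq_intros simp: has_vector_derivative_def algebra_simps)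

text \<open>In polar coordinates, cut along the positive half-axis, this is Fubini's theorem.\<close>

lemma negligible_circle_sections:
  fixes N :: "(real^2) set"
  assumes N: "negligible N"
  shows "AE r in lborel. r > 0 \<longrightarrow> negligible {\<theta> \<in> {0<..<2*pi}. r *\<^sub>R dir \<theta> \<in> N}"
proof -
  define C where "C p = (p $ 1) *\<^sub>R 1 + (p $ 2) *\<^sub>R \<i>" for p :: "real^2"
  \<comment> \<open>Polar coordinates from the principal logarithm. Evaluating at
    \<open>- C p\<close> moves the branch cut to the positive half-axis, and adding
    \<open>pi\<close> brings the angle back to the interval from 0 to 2 pi.\<close>
  define G where "G p = (norm p, Im (Ln (- C p)) + pi)" for p :: "real^2"
  define S where "S = N \<inter> {p. - C p \<notin> \<real>\<^sub>\<le>\<^sub>0}"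
  have "linear C"
    by (rule linearI) (auto simp: C_def algebra_simps)
  then have blC: "bounded_linear C" by (simp add: linear_conv_bounded_linear)
  have "G differentiable_on S"
    unfolding differentiable_on_def
  proof
    fix p assume p: "p \<in> S"
    have p0: "p \<noteq> 0" using p by (auto simp: S_def C_def)
    have "(C has_derivative C) (at p)" by (rule bounded_linear_imp_has_derivative[OF blC])
    then have 1: "((\<lambda>p. - C p) has_derivative (\<lambda>p. - C p)) (at p)" by (rule has_derivative_minus)
    have 2: "(Ln has_derivative (*) (inverse (- C p))) (at (- C p))"
      using has_field_derivative_Ln[of "- C p"] p by (auto simp: S_def has_field_derivative_def)
    have 3: "((\<lambda>p. Ln (- C p)) has_derivative (\<lambda>h. inverse (- C p) * (- C h))) (at p)"
      by (rule has_derivative_compose[OF 1 2])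
    then have "((\<lambda>p. Im (Ln (- C p)) + pi) has_derivative (\<lambda>h. Im (inverse (- C p) * (- C h)))) (at p)"
      by (auto intro!: derivative_eq_intros)
    moreover have "(norm has_derivative (\<lambda>h. h \<bullet> sgn p)) (at p)"
      by (rule has_derivative_norm[OF p0])
    ultimately have "G differentiable (at p)"
      unfolding G_def[abs_def] by (intro differentiableI[OF has_derivative_Pair])
    then show "G differentiable (at p within S)"
      by (rule differentiable_at_withinI)
  qed
  then have "negligible (G ` S)"
    using N by (intro negligible_differentiable_image_negligible) (auto simp: S_def intro: negligible_subset)
  \<comment> \<open>A Borel null set around the image is needed, since the Fubini statement concerns
    the uncompleted product measure.\<close>
  then obtain Z where Z: "Z \<in> null_sets lborel" "G ` S \<subseteq> Z"
    unfolding negligible_iff_null_sets null_sets_completion_iff2 by blast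
  have "AE z in lborel \<Otimes>\<^sub>M lborel. z \<notin> Z"
    unfolding lborel_prod by (rule AE_not_in[OF Z(1)])
  then have "AE r in lborel. AE \<theta> in lborel. (r, \<theta>) \<notin> Z"
    by (rule lborel_pair.AE_pair)
  then show ?thesis
  proof eventually_elim
    case (elim r)
    show ?case
    proof
      assume r: "r > 0"
      have sub: "{\<theta> \<in> {0<..<2*pi}. r *\<^sub>R dir \<theta> \<in> N} \<subseteq> {\<theta>. (r, \<theta>) \<in> Z}"
      proof safe
        fix \<theta> :: real assume \<theta>: "\<theta> \<in> {0<..<2*pi}" "r *\<^sub>R dir \<theta> \<in> N"
        have eC: "- C (r *\<^sub>R dir \<theta>) = exp (Complex (ln r) (\<theta> - pi))"
          using r by (simp add: C_def complex_eq_iff Re_exp Im_exp cos_diff sin_diff)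
        have Ln: "Ln (exp (Complex (ln r) (\<theta> - pi))) = Complex (ln r) (\<theta> - pi)"
          by (rule Ln_exp) (use \<theta> in auto)
        have "exp (Complex (ln r) (\<theta> - pi)) \<notin> \<real>\<^sub>\<le>\<^sub>0"
        proof
          assume "exp (Complex (ln r) (\<theta> - pi)) \<in> \<real>\<^sub>\<le>\<^sub>0"
          then have "Im (exp (Complex (ln r) (\<theta> - pi))) = 0" "Re (exp (Complex (ln r) (\<theta> - pi))) \<le> 0"
            by (auto simp: complex_nonpos_Reals_iff)
          then have "r * sin \<theta> = 0" "0 \<le> r * cos \<theta>"
            using r by (auto simp: Re_exp Im_exp cos_diff sin_diff)
          then have "sin \<theta> = 0" "cos \<theta> \<ge> 0"
            using r by (simp_all add: zero_le_mult_iff)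
          from \<open>sin \<theta> = 0\<close> have "\<theta> = pi"
            using \<theta> sin_gt_zero[of \<theta>] sin_lt_zero[of \<theta>] by (cases "\<theta> < pi"; cases "\<theta> > pi") auto
          with \<open>cos \<theta> \<ge> 0\<close> show False by simp
        qed
        then have "r *\<^sub>R dir \<theta> \<in> S"
          using \<theta> unfolding S_def Int_iff mem_Collect_eq eC by blast
        moreover have "G (r *\<^sub>R dir \<theta>) = (r, \<theta>)"
          using r unfolding G_def eC Ln by simp
        ultimately show "(r, \<theta>) \<in> Z" using Z(2) by (metis imageI subsetD)
      qed
      obtain Z' where "Z' \<in> null_sets lborel" "{\<theta>. (r, \<theta>) \<in> Z} \<subseteq> Z'"
        using elim by (auto simp: eventually_ae_filter)
      then show "negligible {\<theta> \<in> {0<..<2*pi}. r *\<^sub>R dir \<theta> \<in> N}"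
        unfolding negligible_iff_null_sets null_sets_completion_iff2 using sub by blast
    qed
  qed
qed

text \<open>Seen from the midpoint of \<open>a\<close> and \<open>b\<close>, such a point is
  orthogonal to \<open>b - a\<close>, and Pythagoras fixes its distance to the midpoint; this leaves
  two candidates.\<close>

lemma finite_unit_circles_Int:
  fixes a b :: "real^2"
  assumes "a \<noteq> b"
  shows "finite {q. norm (q - a) = 1 \<and> norm (q - b) = 1}"
proof -
  define d where "d = b - a"
  \<comment> \<open>For centers more than 2 apart the radicand is negative and \<open>l\<close> is
    meaningless, but then there is no \<open>q\<close>: only \<open>\<bar>m\<bar> = l\<close> is
    used, for an \<open>m\<close> whose square is the radicand.\<close>
  define l where "l = sqrt ((1 - (norm d)\<^sup>2 / 4) / (norm d)\<^sup>2)"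
  define d' :: "real^2" where "d' = vector [- d $ 2, d $ 1]"
  have d0: "norm d > 0" using assms by (simp add: d_def)
  have nd: "(norm d)\<^sup>2 = (d$1)\<^sup>2 + (d$2)\<^sup>2"
    unfolding power2_norm_eq_inner inner_real2 by (simp add: power2_eq_square)
  have d'[simp]: "d' $ 1 = - d $ 2" "d' $ 2 = d $ 1" by (simp_all add: d'_def)
  have "{q. norm (q - a) = 1 \<and> norm (q - b) = 1} \<subseteq> {(a + d /\<^sub>R 2) + l *\<^sub>R d', (a + d /\<^sub>R 2) - l *\<^sub>R d'}"
  proof
    fix q assume "q \<in> {q. norm (q - a) = 1 \<and> norm (q - b) = 1}"
    then have q: "norm (q - a) = 1" "norm (q - b) = 1" by auto
    define w where "w = q - (a + d /\<^sub>R 2)"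
    have wa: "q - a = w + d /\<^sub>R 2" and wb: "q - b = w - d /\<^sub>R 2"
      by (simp_all add: w_def d_def vec2_eq_iff field_simps)
    have e1: "(w$1 + d$1/2)\<^sup>2 + (w$2 + d$2/2)\<^sup>2 = 1"
      using arg_cong[OF q(1), of power2] unfolding wa power2_norm_eq_inner inner_real2 by (simp add: power2_eq_square)
    have e2: "(w$1 - d$1/2)\<^sup>2 + (w$2 - d$2/2)\<^sup>2 = 1"
      using arg_cong[OF q(2), of power2] unfolding wb power2_norm_eq_inner inner_real2 by (simp add: power2_eq_square)
    note e12 = e1[unfolded power2_sum power_divide] e2[unfolded power2_diff power_divide]
    have o: "w$1 * d$1 + w$2 * d$2 = 0" using e12 by (simp add: field_simps)
    have n: "(w$1)\<^sup>2 + (w$2)\<^sup>2 = 1 - (norm d)\<^sup>2 / 4"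
      using e12 unfolding nd by (simp add: field_simps)
    define m where "m = (w$2 * d$1 - w$1 * d$2) / (norm d)\<^sup>2"
    have md: "m * (norm d)\<^sup>2 = w$2 * d$1 - w$1 * d$2" using d0 by (simp add: m_def)
    have "w$1 * (norm d)\<^sup>2 = - (m * (norm d)\<^sup>2) * d$2" "w$2 * (norm d)\<^sup>2 = (m * (norm d)\<^sup>2) * d$1"
      unfolding md unfolding nd using o by algebra+
    then have "w$1 * (norm d)\<^sup>2 = (- m * d$2) * (norm d)\<^sup>2" "w$2 * (norm d)\<^sup>2 = (m * d$1) * (norm d)\<^sup>2"
      by simp_all
    then have w12: "w$1 = - m * d$2" "w$2 = m * d$1"
      using d0 unfolding mult_right_cancel[OF power_not_zero[OF less_imp_neq[OF d0, symmetric]]] by blast+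
    have "m\<^sup>2 * (norm d)\<^sup>2 = 1 - (norm d)\<^sup>2 / 4"
      using n unfolding w12 nd by algebra
    then have "m\<^sup>2 = (1 - (norm d)\<^sup>2 / 4) / (norm d)\<^sup>2" using d0 by (simp add: field_simps)
    then have "\<bar>m\<bar> = l" unfolding l_def by (metis real_sqrt_abs)
    then consider "m = l" | "m = - l" by linarith
    then have "w = l *\<^sub>R d' \<or> w = - (l *\<^sub>R d')"
      by cases (auto simp: vec2_eq_iff w12)
    then show "q \<in> {(a + d /\<^sub>R 2) + l *\<^sub>R d', (a + d /\<^sub>R 2) - l *\<^sub>R d'}"
      by (auto simp: w_def algebra_simps)
  qed
  then show ?thesis by (rule finite_subset) simp
qed

subsection \<open>The truncated gradient field and its flow\<close>

text \<open>Truncating the distance at \<open>1/2\<close> makes the force of a single particle globally Lipschitz and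
  bounded without changing it outside the unit disk.\<close>

definition cut_force :: "real \<Rightarrow> real^2 \<Rightarrow> real^2" where
  "cut_force \<alpha> u = max (1/2) (norm u) powr (- \<alpha> - 2) *\<^sub>R u"

text \<open>Mean value theorem; the derivative of the power is largest in absolute value at the left
  end \<open>a\<close>.\<close>

lemma powr_diff_le:
  fixes a b p :: real
  assumes "0 < a" "a \<le> b" "0 \<le> p"
  shows "\<bar>a powr (- p) - b powr (- p)\<bar> \<le> p * a powr (- p - 1) * (b - a)"
proof (cases "a = b")
  case False
  then have ab: "a < b" using assms by simp
  have "\<exists>z>a. z < b \<and> b powr (- p) - a powr (- p) = (b - a) * ((- p) * z powr (- p - 1))"
    by (rule MVT2[OF ab]) (use assms in \<open>auto intro!: derivative_eq_intros\<close>)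
  then obtain z where z: "z > a" "z < b" "b powr (- p) - a powr (- p) = (b - a) * ((- p) * z powr (- p - 1))"
    by blast
  have "\<bar>a powr (- p) - b powr (- p)\<bar> = (b - a) * p * z powr (- p - 1)"
    using z assms by (simp add: abs_minus_commute[of "a powr (- p)"] abs_mult)
  also have "\<dots> \<le> (b - a) * p * a powr (- p - 1)"
    using z assms by (intro mult_left_mono powr_mono2') auto
  finally show ?thesis by (simp add: mult_ac)
qed simp

text \<open>For \<open>norm v \<le> norm u\<close> the difference splits into the change of the
  vector, with coefficient at most \<open>(1/2) powr (- \<alpha> - 2)\<close>, and the change of the
  coefficient times \<open>v\<close>. In the second part \<open>norm v \<le> a\<close> makes up for
  the power lost by differentiation, leaving the factor \<open>\<alpha> + 2\<close>; together this
  is \<open>\<alpha> + 3\<close>.\<close>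

lemma cut_force_lipschitz:
  assumes "0 \<le> \<alpha>"
  shows "norm (cut_force \<alpha> u - cut_force \<alpha> v) \<le> (\<alpha> + 3) * (1/2) powr (- \<alpha> - 2) * norm (u - v)"
proof -
  have *: "norm (cut_force \<alpha> u - cut_force \<alpha> v) \<le> (\<alpha> + 3) * (1/2) powr (- \<alpha> - 2) * norm (u - v)"
    if le: "norm v \<le> norm u" for u v
  proof -
    define a b where "a = max (1/2) (norm v)" and "b = max (1/2) (norm u)"
    have ab: "1/2 \<le> a" "a \<le> b" "b - a \<le> norm (u - v)" "norm v \<le> a"
      using le norm_triangle_ineq2[of u v] by (auto simp: a_def b_def)
    have k: "x powr (- \<alpha> - 2) \<le> (1/2) powr (- \<alpha> - 2)" if "1/2 \<le> x" for x :: real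
      using that assms by (intro powr_mono2') auto
    have "cut_force \<alpha> u - cut_force \<alpha> v = b powr (- \<alpha> - 2) *\<^sub>R (u - v) + (b powr (- \<alpha> - 2) - a powr (- \<alpha> - 2)) *\<^sub>R v"
      by (simp add: cut_force_def a_def b_def algebra_simps)
    also have "norm \<dots> \<le> b powr (- \<alpha> - 2) * norm (u - v) + (\<alpha> + 2) * a powr (- \<alpha> - 2) * norm (u - v)"
    proof -
      have "\<bar>a powr (- \<alpha> - 2) - b powr (- \<alpha> - 2)\<bar> * norm v
          \<le> ((\<alpha> + 2) * a powr (- \<alpha> - 2 - 1) * norm (u - v)) * a"
      proof (intro mult_mono)
        have "\<bar>a powr (- \<alpha> - 2) - b powr (- \<alpha> - 2)\<bar> \<le> (\<alpha> + 2) * a powr (- \<alpha> - 2 - 1) * (b - a)"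
          using powr_diff_le[of a b "\<alpha> + 2"] ab assms by simp
        also have "\<dots> \<le> (\<alpha> + 2) * a powr (- \<alpha> - 2 - 1) * norm (u - v)"
          using ab assms by (intro mult_left_mono) auto
        finally show "\<bar>a powr (- \<alpha> - 2) - b powr (- \<alpha> - 2)\<bar> \<le> (\<alpha> + 2) * a powr (- \<alpha> - 2 - 1) * norm (u - v)" .
      qed (use ab assms in auto)
      also have "\<dots> = (\<alpha> + 2) * (a powr (- \<alpha> - 2 - 1) * a powr 1) * norm (u - v)"
        using ab by simp
      also have "a powr (- \<alpha> - 2 - 1) * a powr 1 = a powr (- \<alpha> - 2)"
        by (simp only: powr_add[symmetric], rule arg_cong[where f="(powr) a"], simp)
      finally show ?thesis
        by (intro norm_triangle_le) (simp add: abs_minus_commute)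
    qed
    also have "b powr (- \<alpha> - 2) * norm (u - v) + (\<alpha> + 2) * a powr (- \<alpha> - 2) * norm (u - v) \<le>
        (1/2) powr (- \<alpha> - 2) * norm (u - v) + (\<alpha> + 2) * (1/2) powr (- \<alpha> - 2) * norm (u - v)"
      using ab assms k by (intro add_mono mult_right_mono mult_left_mono) auto
    also have "\<dots> = (\<alpha> + 3) * (1/2) powr (- \<alpha> - 2) * norm (u - v)"
      by (simp add: algebra_simps)
    finally show ?thesis by simp
  qed
  show ?thesis
    using *[of v u] *[of u v] by (cases "norm v \<le> norm u") (auto simp: norm_minus_commute)
qed

lemma norm_cut_force_le:
  assumes "0 \<le> \<alpha>"
  shows "norm (cut_force \<alpha> u) \<le> (1/2) powr (- \<alpha> - 1)"
proof -
  define m where "m = max (1/2) (norm u)"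
  have m: "1/2 \<le> m" "norm u \<le> m" by (auto simp: m_def)
  have "norm (cut_force \<alpha> u) = m powr (- \<alpha> - 2) * norm u" by (simp add: cut_force_def m_def)
  also have "\<dots> \<le> m powr (- \<alpha> - 2) * m" using m by (intro mult_left_mono) auto
  also have "\<dots> = m powr (- \<alpha> - 2) * m powr 1" using m by simp
  also have "\<dots> = m powr (- \<alpha> - 1)" by (simp only: powr_add[symmetric], rule arg_cong[where f="(powr) m"], simp)
  also have "\<dots> \<le> (1/2) powr (- \<alpha> - 1)" using m assms by (intro powr_mono2') auto
  finally show ?thesis .
qed

lemma gderiv_unique:
  fixes f :: "'a::real_inner \<Rightarrow> real"
  assumes "GDERIV f y :> v" "GDERIV f y :> w"
  shows "v = w"
proof -
  have "(\<lambda>h. h \<bullet> v) = (\<lambda>h. h \<bullet> w)"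
    using assms unfolding gderiv_def by (rule has_derivative_unique)
  then have "\<forall>h. h \<bullet> v = h \<bullet> w" by (simp add: fun_eq_iff)
  then show ?thesis by (simp add: vector_eq_ldot)
qed

locale cluster =
  fixes \<alpha> :: real and n :: nat and x :: "nat \<Rightarrow> real^2"
  assumes alpha_nonneg: "0 \<le> \<alpha>" and cluster: "is_cluster n x"
begin

lemma n_pos: "1 \<le> n"
  using cluster by (simp add: is_cluster_def)

lemma particles_distinct: "i \<in> {1..n} \<Longrightarrow> j \<in> {1..n} \<Longrightarrow> i \<noteq> j \<Longrightarrow> x i \<noteq> x j"
  using cluster unfolding is_cluster_def by (metis norm_zero not_one_le_zero right_minus_eq)

text \<open>In terms of the distance \<open>r\<close>, the derivative of a summand of the energy is
  \<open>- strength * r powr (- \<alpha> - 1)\<close> in the logarithmic case as well, which lets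
  both cases run together.\<close>

definition strength :: real where "strength = (if \<alpha> = 0 then 1 else \<alpha>)"

lemma strength_pos: "0 < strength"
  using alpha_nonneg by (auto simp: strength_def)

definition field :: "real^2 \<Rightarrow> real^2" where
  "field y = - strength *\<^sub>R (\<Sum>j=1..n. cut_force \<alpha> (y - x j))"

definition lip :: real where
  "lip = strength * (real n * ((\<alpha> + 3) * (1/2) powr (- \<alpha> - 2)))"

definition speed :: real where
  "speed = strength * (real n * (1/2) powr (- \<alpha> - 1))"

lemma lip_nonneg: "0 \<le> lip"
  using strength_pos alpha_nonneg by (simp add: lip_def)

lemma speed_nonneg: "0 \<le> speed"
  using strength_pos by (simp add: speed_def)

lemma field_lipschitz: "norm (field y - field z) \<le> lip * norm (y - z)"
proof -
  have "field y - field z = - strength *\<^sub>R (\<Sum>j=1..n. cut_force \<alpha> (y - x j) - cut_force \<alpha> (z - x j))"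
    by (simp add: field_def sum_subtractf scaleR_diff_right)
  also have "norm \<dots> = strength * norm (\<Sum>j=1..n. cut_force \<alpha> (y - x j) - cut_force \<alpha> (z - x j))"
    using strength_pos by simp
  also have "\<dots> \<le> strength * (\<Sum>j=1..n. (\<alpha> + 3) * (1/2) powr (- \<alpha> - 2) * norm (y - z))"
  proof (intro mult_left_mono sum_norm_le)
    show "norm (cut_force \<alpha> (y - x j) - cut_force \<alpha> (z - x j)) \<le> (\<alpha> + 3) * (1/2) powr (- \<alpha> - 2) * norm (y - z)" for j
      using cut_force_lipschitz[OF alpha_nonneg, of "y - x j" "z - x j"] by simp
  qed (use strength_pos in auto)
  finally show ?thesis by (simp add: lip_def)
qed

lemma norm_field_le: "norm (field y) \<le> speed"
proof -
  have "norm (field y) = strength * norm (\<Sum>j=1..n. cut_force \<alpha> (y - x j))"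
    using strength_pos by (simp add: field_def)
  also have "\<dots> \<le> strength * (\<Sum>j=1..n. (1/2) powr (- \<alpha> - 1))"
    using strength_pos norm_cut_force_le[OF alpha_nonneg]
    by (intro mult_left_mono sum_norm_le) auto
  finally show ?thesis by (simp add: speed_def)
qed

lemma continuous_on_field [continuous_intros]:
  "continuous_on A f \<Longrightarrow> continuous_on A (\<lambda>t. field (f t))"
proof -
  have "lip-lipschitz_on UNIV field"
    by (rule lipschitz_onI) (auto simp: dist_norm field_lipschitz lip_nonneg)
  then have "continuous_on UNIV field" by (rule lipschitz_on_continuous_on)
  then show "continuous_on A f \<Longrightarrow> continuous_on A (\<lambda>t. field (f t))"
    by (rule continuous_on_compose2) auto
qed

lemma energy_gderiv:
  assumes far: "\<And>j. j \<in> {1..n} \<Longrightarrow> 1/2 \<le> norm (y - x j)"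
  shows "GDERIV (energy \<alpha> n x) y :> field y"
proof -
  define e where "e r = (if \<alpha> = 0 then ln (1 / r) else r powr (- \<alpha>))" for r
  have e': "(e has_real_derivative - strength * r powr (- \<alpha> - 1)) (at r)" if r: "0 < r" for r
  proof (cases "\<alpha> = 0")
    case True
    have "((\<lambda>r. ln (1 / r)) has_real_derivative - strength * r powr (- \<alpha> - 1)) (at r)"
      using r True unfolding strength_def
      by (auto intro!: derivative_eq_intros simp: powr_minus_divide power2_eq_square)
    then show ?thesis using True by (simp add: e_def[abs_def])
  next
    case False
    have "((\<lambda>r. r powr (- \<alpha>)) has_real_derivative - strength * r powr (- \<alpha> - 1)) (at r)"
      using r False unfolding strength_def by (auto intro!: derivative_eq_intros)
    then show ?thesis using False by (simp add: e_def[abs_def])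
  qed
  have sum: "energy \<alpha> n x = (\<lambda>z. \<Sum>j=1..n. e (norm (z - x j)))"
    by (auto simp: fun_eq_iff energy_def e_def)
  have summand: "((\<lambda>z. e (norm (z - x j))) has_derivative (\<lambda>h. h \<bullet> (- strength *\<^sub>R cut_force \<alpha> (y - x j)))) (at y)"
    if j: "j \<in> {1..n}" for j
  proof -
    define u where "u = y - x j"
    have u: "1/2 \<le> norm u" using far[OF j] by (simp add: u_def)
    have u0: "u \<noteq> 0" using u by auto
    have "((\<lambda>z. z - x j) has_derivative (\<lambda>h. h)) (at y)"
      by (auto intro!: derivative_eq_intros)
    from has_derivative_compose[OF this has_derivative_norm[of "y - x j"]] u0
    have 1: "((\<lambda>z. norm (z - x j)) has_derivative (\<lambda>h. h \<bullet> sgn u)) (at y)"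
      by (simp add: u_def)
    have "(e has_derivative (*) (- strength * norm u powr (- \<alpha> - 1))) (at (norm u))"
      by (rule e'[unfolded has_field_derivative_def]) (use u0 in simp)
    from has_derivative_compose[OF 1 this[unfolded u_def]]
    have 2: "((\<lambda>z. e (norm (z - x j))) has_derivative
        (\<lambda>h. (- strength * norm u powr (- \<alpha> - 1)) * (h \<bullet> sgn u))) (at y)"
      by (simp add: u_def)
    have "norm u powr (- \<alpha> - 1) / norm u = norm u powr (- \<alpha> - 1) / norm u powr 1"
      using u by simp
    also have "\<dots> = norm u powr (- \<alpha> - 2)"
      by (simp only: powr_diff[symmetric], rule arg_cong[where f="(powr) (norm u)"], simp)
    finally have pw: "norm u powr (- \<alpha> - 1) / norm u = norm u powr (- \<alpha> - 2)" .
    have mx: "max (1/2) (norm u) = norm u" using u by simp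
    have "cut_force \<alpha> u = (norm u powr (- \<alpha> - 1)) *\<^sub>R sgn u"
      unfolding cut_force_def mx pw[symmetric] by (simp add: sgn_div_norm divide_inverse)
    then show ?thesis using 2 by (simp add: u_def)
  qed
  have "((\<lambda>z. \<Sum>j=1..n. e (norm (z - x j))) has_derivative (\<lambda>h. \<Sum>j=1..n. h \<bullet> (- strength *\<^sub>R cut_force \<alpha> (y - x j)))) (at y)"
    by (rule has_derivative_sum[OF summand])
  moreover have "(\<Sum>j=1..n. h \<bullet> (- strength *\<^sub>R cut_force \<alpha> (y - x j))) = h \<bullet> field y" for h
    unfolding field_def scaleR_sum_right inner_sum_right ..
  ultimately show ?thesis unfolding gderiv_def sum by simp
qed

lemma critical_if_field_0:
  assumes "\<And>j. j \<in> {1..n} \<Longrightarrow> 1 \<le> norm (y - x j)" and "field y = 0"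
  shows "y \<in> critical_points \<alpha> n x"
proof -
  have "GDERIV (energy \<alpha> n x) y :> field y"
    by (rule energy_gderiv) (use assms(1) in fastforce)
  moreover have "y \<notin> x ` {1..n}" using assms(1) by fastforce
  ultimately show ?thesis using assms(2) by (simp add: critical_points_def)
qed

section \<open>The flow and its dependence on time and starting point\<close>

definition flow :: "real^2 \<Rightarrow> real \<Rightarrow> real^2" where
  "flow z = (SOME u. u 0 = z \<and> (\<forall>t\<ge>0. (u has_vector_derivative field (u t)) (at t within {0..})))"

lemma flow_exists:
  "flow z 0 = z \<and> (\<forall>t\<ge>0. (flow z has_vector_derivative field (flow z t)) (at t within {0..}))"
  unfolding flow_def
proof (rule someI_ex[where P="\<lambda>u. u 0 = z \<and> (\<forall>t\<ge>0. (u has_vector_derivative field (u t)) (at t within {0..}))"])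
  have "continuous_on UNIV (\<lambda>(t :: real, y). field y)"
    by (auto simp: case_prod_unfold intro!: continuous_intros)
  from ode_solution_exists[OF this norm_field_le field_lipschitz, of z]
  show "\<exists>u. u 0 = z \<and> (\<forall>t\<ge>0. (u has_vector_derivative field (u t)) (at t within {0..}))"
    by metis
qed

lemma flow_0 [simp]: "flow z 0 = z"
  using flow_exists by blast

lemma flow_deriv:
  assumes "0 \<le> t" "S \<subseteq> {0..}"
  shows "(flow z has_vector_derivative field (flow z t)) (at t within S)"
  using flow_exists assms has_vector_derivative_within_subset by blast

lemma flow_unique:
  assumes \<gamma>: "\<And>t. t \<in> {0..T} \<Longrightarrow> (\<gamma> has_vector_derivative field (\<gamma> t)) (at t within {0..T})"
    and t: "t \<in> {0..T}"
  shows "\<gamma> t = flow (\<gamma> 0) t"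
proof -
  have "norm (\<gamma> t - flow (\<gamma> 0) t) \<le> exp (lip * (t - 0)) * norm (\<gamma> 0 - flow (\<gamma> 0) 0)"
  proof (rule ode_dist_bounds(1))
    fix s assume s: "s \<in> {0..t}"
    show "(\<gamma> has_vector_derivative field (\<gamma> s)) (at s within {0..t})"
      by (rule has_vector_derivative_within_subset[OF \<gamma>]) (use s t in auto)
    show "(flow (\<gamma> 0) has_vector_derivative field (flow (\<gamma> 0) s)) (at s within {0..t})"
      by (rule flow_deriv) (use s in auto)
  qed (use t field_lipschitz in auto)
  then show ?thesis by simp
qed

lemma flow_add:
  assumes "0 \<le> s" "0 \<le> t"
  shows "flow (flow z s) t = flow z (s + t)"
proof -
  have "(flow z \<circ> (\<lambda>t. s + t) has_vector_derivative 1 *\<^sub>R field (flow z (s + r))) (at r within {0..t})"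
    if "r \<in> {0..t}" for r
    by (rule vector_diff_chain_within) (use that assms in \<open>auto intro!: derivative_eq_intros flow_deriv\<close>)
  then have "flow z (s + t) = flow (flow z (s + 0)) t"
    using flow_unique[where \<gamma>="\<lambda>t. flow z (s + t)" and T=t and t=t] assms by (simp add: o_def)
  then show ?thesis by simp
qed

text \<open>The lower bound makes each time map injective. This stands in for a backward flow, since
  \<open>flow\<close> is specified for non-negative times only.\<close>

lemma flow_dist:
  assumes "0 \<le> t"
  shows "norm (flow y t - flow z t) \<le> exp (lip * t) * norm (y - z)"
    and "norm (y - z) \<le> exp (lip * t) * norm (flow y t - flow z t)"
proof -
  have d: "(flow w has_vector_derivative field (flow w s)) (at s within {0..t})" if "s \<in> {0..t}" for w s
    by (rule flow_deriv) (use that in auto)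
  note b = ode_dist_bounds[where f="\<lambda>_. field", OF assms d d field_lipschitz]
  show "norm (flow y t - flow z t) \<le> exp (lip * t) * norm (y - z)"
    using b(1) by simp
  show "norm (y - z) \<le> exp (lip * t) * norm (flow y t - flow z t)"
    using b(2) by simp
qed

lemma flow_inj: "0 \<le> t \<Longrightarrow> flow y t = flow z t \<Longrightarrow> y = z"
  using flow_dist(2)[of t y z] by simp

lemma flow_time_lipschitz:
  assumes "0 \<le> s" "0 \<le> t"
  shows "norm (flow z t - flow z s) \<le> speed * \<bar>t - s\<bar>"
proof -
  have "norm (flow z t - flow z s) \<le> speed * norm (t - s)"
  proof (rule differentiable_bound[where S="{0..}" and f'="\<lambda>t h. h *\<^sub>R field (flow z t)"])
    fix r :: real assume "r \<in> {0..}"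
    then show "(flow z has_derivative (\<lambda>h. h *\<^sub>R field (flow z r))) (at r within {0..})"
      using flow_deriv[of r "{0..}" z] by (simp add: has_vector_derivative_def)
    show "onorm (\<lambda>h. h *\<^sub>R field (flow z r)) \<le> speed"
      by (rule onorm_le) (use norm_field_le[of "flow z r"] in \<open>auto simp: mult.commute intro: mult_left_mono\<close>)
  qed (use assms in auto)
  then show ?thesis by simp
qed

text \<open>Change the starting point at fixed time by \<open>flow_dist\<close>, then the time by
  \<open>flow_time_lipschitz\<close>. Joint continuity is what \<open>closed_hit\<close> needs in
  order to project along time.\<close>

lemma continuous_on_flow_pair: "continuous_on ({0..} \<times> UNIV) (\<lambda>(t, z). flow z t)"
proof -
  have "((\<lambda>(t, z). flow z t) \<longlongrightarrow> flow w s) (at (s, w) within {0..} \<times> UNIV)" if s: "0 \<le> s" for s w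
  proof (rule Lim_transform_bound[where g="\<lambda>p. exp (lip * fst p) * norm (snd p - w) + speed * \<bar>fst p - s\<bar>", THEN Lim_null[THEN iffD2]])
    have "eventually (\<lambda>p. p \<in> {0..} \<times> UNIV) (at (s, w) within {0..} \<times> UNIV)"
      by (simp add: eventually_at_filter)
    then show "\<forall>\<^sub>F p in at (s, w) within {0..} \<times> UNIV. norm ((case p of (t, z) \<Rightarrow> flow z t) - flow w s)
        \<le> norm (exp (lip * fst p) * norm (snd p - w) + speed * \<bar>fst p - s\<bar>)"
    proof eventually_elim
      case (elim p)
      obtain t z where p: "p = (t, z)" "0 \<le> t" using elim by auto
      have "norm (flow z t - flow w s) \<le> norm (flow z t - flow w t) + norm (flow w t - flow w s)"
        by (rule norm_diff_triangle_ineq[THEN order_trans[rotated]]) (auto intro: norm_triangle_le simp: )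
      also have "\<dots> \<le> exp (lip * t) * norm (z - w) + speed * \<bar>t - s\<bar>"
        by (intro add_mono flow_dist flow_time_lipschitz p s)
      finally show ?case by (simp add: p)
    qed
    have "((\<lambda>p. exp (lip * fst p) * norm (snd p - w) + speed * \<bar>fst p - s\<bar>) \<longlongrightarrow>
        exp (lip * fst (s, w)) * norm (snd (s, w) - w) + speed * \<bar>fst (s, w) - s\<bar>) (at (s, w) within {0..} \<times> UNIV)"
      by (intro tendsto_intros)
    then show "((\<lambda>p. exp (lip * fst p) * norm (snd p - w) + speed * \<bar>fst p - s\<bar>) \<longlongrightarrow> 0) (at (s, w) within {0..} \<times> UNIV)"
      by simp
  qed
  then show ?thesis by (auto simp: continuous_on_def)
qed

lemma continuous_on_flow [continuous_intros]:
  assumes "continuous_on A f" "continuous_on A g" "\<And>a. a \<in> A \<Longrightarrow> 0 \<le> g a"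
  shows "continuous_on A (\<lambda>a. flow (f a) (g a))"
  using continuous_on_compose2[OF continuous_on_flow_pair, of A "\<lambda>a. (g a, f a)"] assms
  by (auto intro!: continuous_intros)

section \<open>Attachment in terms of the flow\<close>

definition outside :: "real^2 \<Rightarrow> bool" where
  "outside z \<longleftrightarrow> (\<forall>j\<in>{1..n}. 1 < norm (z - x j))"

text \<open>By the intermediate value theorem a curve cannot come closer than 1 to a particle
  without passing distance exactly 1. So the condition in \<open>attaches\<close>, which only
  excludes equality, amounts to staying outside the disks.\<close>

lemma flow_stays_outside:
  fixes T :: real
  assumes cont: "continuous_on {0..T} \<gamma>" and out: "outside (\<gamma> 0)"
    and ne: "\<forall>t\<in>{0..<T}. \<forall>j\<in>{1..n}. norm (\<gamma> t - x j) \<noteq> 1" and j: "j \<in> {1..n}" and t: "t \<in> {0..T}"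
  shows "1 \<le> norm (\<gamma> t - x j)" and "t < T \<Longrightarrow> 1 < norm (\<gamma> t - x j)"
proof -
  have less: "1 < norm (\<gamma> r - x j)" if r: "0 \<le> r" "r \<le> T" and ne': "\<forall>s\<in>{0..r}. norm (\<gamma> s - x j) \<noteq> 1" for r
  proof (rule ccontr)
    assume "\<not> 1 < norm (\<gamma> r - x j)"
    moreover have "continuous_on {0..r} (\<lambda>t. norm (\<gamma> t - x j))"
      by (intro continuous_intros continuous_on_subset[OF cont]) (use r in auto)
    moreover have "1 < norm (\<gamma> 0 - x j)" using out j by (simp add: outside_def)
    ultimately obtain s where "0 \<le> s" "s \<le> r" "norm (\<gamma> s - x j) = 1"
      using IVT2'[of "\<lambda>t. norm (\<gamma> t - x j)" r 1 0] r by auto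
    then show False using ne' by auto
  qed
  show less': "1 < norm (\<gamma> t - x j)" if "t < T"
    by (rule less) (use t ne j that in auto)
  show "1 \<le> norm (\<gamma> t - x j)"
  proof (cases "t < T \<or> norm (\<gamma> t - x j) = 1")
    case False
    have "1 < norm (\<gamma> t - x j)"
      by (rule less) (use False t ne j in \<open>auto simp: order_le_less\<close>)
    then show ?thesis by simp
  qed (use less' in auto)
qed

text \<open>Up to attachment every admissible curve keeps distance at least 1 from the particles,
  where \<open>field\<close> is the gradient of the energy; uniqueness then identifies the curve
  with \<open>flow z\<close>.\<close>

lemma attaches_iff:
  "attaches \<alpha> n x z i \<longleftrightarrow> outside z \<and>
     (\<exists>T\<ge>0. norm (flow z T - x i) = 1 \<and> (\<forall>t\<in>{0..<T}. \<forall>j\<in>{1..n}. norm (flow z t - x j) \<noteq> 1))"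
  (is "_ \<longleftrightarrow> _ \<and> (\<exists>T\<ge>0. ?P T)")
proof
  assume "attaches \<alpha> n x z i"
  then obtain T \<gamma> where out: "outside z" and T: "T \<ge> 0" "\<gamma> 0 = z" "ascent_flow_on \<alpha> n x T \<gamma>"
      "norm (\<gamma> T - x i) = 1" "\<forall>t\<in>{0..<T}. \<forall>j\<in>{1..n}. norm (\<gamma> t - x j) \<noteq> 1"
    by (auto simp: attaches_def outside_def)
  have "continuous_on {0..T} \<gamma>"
    using T(3) unfolding ascent_flow_on_def continuous_on_eq_continuous_within
    by (meson has_vector_derivative_continuous)
  note far = flow_stays_outside[OF this _ T(5)]
  have "(\<gamma> has_vector_derivative field (\<gamma> t)) (at t within {0..T})" if t: "t \<in> {0..T}" for t
  proof -
    obtain v where v: "GDERIV (energy \<alpha> n x) (\<gamma> t) :> v" "(\<gamma> has_vector_derivative v) (at t within {0..T})"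
      using T(3) t unfolding ascent_flow_on_def by blast
    have "GDERIV (energy \<alpha> n x) (\<gamma> t) :> field (\<gamma> t)"
      by (rule energy_gderiv) (use far(1)[OF _ _ t] out T(2) in fastforce)
    with v show ?thesis using gderiv_unique by blast
  qed
  then have "\<gamma> t = flow z t" if "t \<in> {0..T}" for t
    using flow_unique[of T \<gamma>] that T(2) by simp
  then have "?P T" using T by auto
  then show "outside z \<and> (\<exists>T\<ge>0. ?P T)" using out T(1) by blast
next
  assume "outside z \<and> (\<exists>T\<ge>0. ?P T)"
  then obtain T where out: "outside z" and T: "T \<ge> 0" "?P T" by blast
  have "continuous_on {0..T} (flow z)" by (intro continuous_intros) auto
  note far = flow_stays_outside[OF this _ T(2)[THEN conjunct2]]
  have "ascent_flow_on \<alpha> n x T (flow z)"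
    unfolding ascent_flow_on_def
  proof (intro ballI exI conjI)
    fix t assume t: "t \<in> {0..T}"
    show "GDERIV (energy \<alpha> n x) (flow z t) :> field (flow z t)"
      by (rule energy_gderiv) (use far(1)[OF _ _ t] out in fastforce)
    show "(flow z has_vector_derivative field (flow z t)) (at t within {0..T})"
      by (rule flow_deriv) (use t in auto)
  qed
  with T out show "attaches \<alpha> n x z i"
    unfolding attaches_def outside_def by (intro conjI exI[of _ T] exI[of _ "flow z"]) auto
qed

text \<open>Moving the start along an orbit that is still outside the disks only shifts the
  attachment time. This transports attachment from one large circle to another.\<close>

lemma attaches_flow_iff:
  assumes T: "0 \<le> T" and out: "\<And>t. t \<in> {0..T} \<Longrightarrow> outside (flow z t)" and i: "i \<in> {1..n}"
  shows "attaches \<alpha> n x (flow z T) i \<longleftrightarrow> attaches \<alpha> n x z i"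
proof -
  have o: "outside z" "outside (flow z T)" using out[of 0] out[of T] T by auto
  have ne: "norm (flow z t - x j) \<noteq> 1" if "t \<in> {0..T}" "j \<in> {1..n}" for t j
    using out[OF that(1)] that(2) unfolding outside_def by (metis less_irrefl)
  show ?thesis
    unfolding attaches_iff
  proof (intro iffI conjI o; elim conjE exE)
    fix S assume S: "0 \<le> S" "norm (flow (flow z T) S - x i) = 1"
      "\<forall>t\<in>{0..<S}. \<forall>j\<in>{1..n}. norm (flow (flow z T) t - x j) \<noteq> 1"
    have "norm (flow z t - x j) \<noteq> 1" if "t \<in> {0..<T + S}" "j \<in> {1..n}" for t j
    proof (cases "t \<le> T")
      case False
      then have "flow z t = flow (flow z T) (t - T)" using T by (simp add: flow_add)
      then show ?thesis using S(3) that False by auto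
    qed (use ne that in auto)
    then show "\<exists>T\<ge>0. norm (flow z T - x i) = 1 \<and> (\<forall>t\<in>{0..<T}. \<forall>j\<in>{1..n}. norm (flow z t - x j) \<noteq> 1)"
      using S T by (intro exI[of _ "T + S"]) (auto simp: flow_add)
  next
    fix S assume S: "0 \<le> S" "norm (flow z S - x i) = 1"
      "\<forall>t\<in>{0..<S}. \<forall>j\<in>{1..n}. norm (flow z t - x j) \<noteq> 1"
    have "T < S" using ne[of S i] S i by force
    then show "\<exists>S\<ge>0. norm (flow (flow z T) S - x i) = 1 \<and>
        (\<forall>t\<in>{0..<S}. \<forall>j\<in>{1..n}. norm (flow (flow z T) t - x j) \<noteq> 1)"
      using S T by (intro exI[of _ "S - T"]) (auto simp: flow_add)
  qed
qed

subsection \<open>The flow far away from the cluster\<close>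

definition extent :: real where "extent = (\<Sum>j=1..n. norm (x j))"

lemma norm_particle_le: "j \<in> {1..n} \<Longrightarrow> norm (x j) \<le> extent"
  unfolding extent_def by (rule member_le_sum) auto

lemma extent_nonneg: "0 \<le> extent"
  unfolding extent_def by (rule sum_nonneg) simp

text \<open>Every single force already points inward: \<open>y \<bullet> (y - x j)\<close> is
  positive as soon as \<open>norm (x j) < norm y\<close>, and the truncation changes only a positive
  factor.\<close>

lemma field_inward:
  assumes y: "extent < norm y"
  shows "y \<bullet> field y < 0"
proof -
  have pos: "0 < y \<bullet> cut_force \<alpha> (y - x j)" if j: "j \<in> {1..n}" for j
  proof -
    have "y \<bullet> x j \<le> norm y * norm (x j)" by (rule norm_cauchy_schwarz)
    also have "\<dots> < norm y * norm y"
      using norm_particle_le[OF j] y extent_nonneg by (intro mult_strict_left_mono) auto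
    finally have "0 < y \<bullet> (y - x j)"
      by (simp add: inner_diff_right dot_square_norm power2_eq_square)
    then show ?thesis by (simp add: cut_force_def)
  qed
  have "0 < (\<Sum>j=1..n. y \<bullet> cut_force \<alpha> (y - x j))"
    by (rule sum_pos) (use n_pos pos in auto)
  then have "0 < strength * (y \<bullet> (\<Sum>j=1..n. cut_force \<alpha> (y - x j)))"
    using strength_pos by (simp add: inner_sum_right)
  then show ?thesis by (simp add: field_def)
qed

lemma norm_flow_deriv:
  assumes "0 \<le> t" "S \<subseteq> {0..}"
  shows "((\<lambda>t. (norm (flow z t))\<^sup>2) has_real_derivative 2 * (flow z t \<bullet> field (flow z t))) (at t within S)"
  using bounded_bilinear.has_vector_derivative
    [OF bounded_bilinear_inner flow_deriv[OF assms, of z] flow_deriv[OF assms, of z]]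
  by (simp add: has_real_derivative_iff_has_vector_derivative power2_norm_eq_inner inner_commute)

text \<open>After the last time at which the norm is at most \<open>R\<close>,
  \<open>field_inward\<close> makes it decrease, so it cannot end up above \<open>R\<close>.\<close>

lemma norm_flow_le:
  assumes R: "extent < R" and z: "norm z \<le> R" and t: "0 \<le> t"
  shows "norm (flow z t) \<le> R"
proof (rule ccontr)
  assume neg: "\<not> norm (flow z t) \<le> R"
  define S where "S = {0..t} \<inter> (\<lambda>s. norm (flow z s)) -` {..R}"
  have cont: "continuous_on {0..t} (\<lambda>s. norm (flow z s))"
    by (intro continuous_intros) auto
  have "closed S"
    unfolding S_def by (rule continuous_closed_preimage[OF cont]) auto
  moreover have "S \<noteq> {}" "bdd_above S"
    using z t by (auto simp: S_def intro!: exI[of _ 0] bdd_aboveI[of _ t])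
  ultimately have "Sup S \<in> S" by (intro closed_contains_Sup)
  define s where "s = Sup S"
  have s: "0 \<le> s" "s \<le> t" "norm (flow z s) \<le> R" using \<open>Sup S \<in> S\<close> by (auto simp: S_def s_def)
  have above: "R < norm (flow z r)" if "s < r" "r \<le> t" for r
  proof (rule ccontr)
    assume "\<not> R < norm (flow z r)"
    then have "r \<in> S" using that s by (auto simp: S_def)
    then show False using cSup_upper[OF _ \<open>bdd_above S\<close>] that by (fastforce simp: s_def)
  qed
  have "(norm (flow z t))\<^sup>2 \<le> (norm (flow z s))\<^sup>2"
  proof (rule DERIV_nonpos_imp_decreasing_open[OF s(2)])
    fix r assume r: "s < r" "r < t"
    have "at r within {0..} = at r" using r s by (intro at_within_interior) auto
    then have "((\<lambda>t. (norm (flow z t))\<^sup>2) has_real_derivative 2 * (flow z r \<bullet> field (flow z r))) (at r)"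
      using norm_flow_deriv[of r "{0..}" z] r s by auto
    moreover have "flow z r \<bullet> field (flow z r) < 0"
      by (rule field_inward) (use above[of r] r R in auto)
    ultimately show "\<exists>y. ((\<lambda>t. (norm (flow z t))\<^sup>2) has_real_derivative y) (at r) \<and> y \<le> 0"
      by (intro exI conjI) auto
  next
    show "continuous_on {s..t} (\<lambda>t. (norm (flow z t))\<^sup>2)"
      by (intro continuous_intros) (use s in auto)
  qed
  then have "norm (flow z t) \<le> norm (flow z s)" by (rule power2_le_imp_le) simp
  then show False using neg s by simp
qed

text \<open>The norm never exceeds its initial value; were it equal at time \<open>t\<close>, its
  negative derivative there would put it above that value shortly before. Hence an orbit started on
  a large circle does not return to it.\<close>

lemma norm_flow_less:
  assumes z: "extent < norm z" and t: "0 < t"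
  shows "norm (flow z t) < norm z"
proof (rule ccontr)
  assume "\<not> norm (flow z t) < norm z"
  then have eq: "norm (flow z t) = norm z"
    using norm_flow_le[OF z order_refl] t by (simp add: order_antisym)
  have "2 * (flow z t \<bullet> field (flow z t)) < 0"
    using field_inward[of "flow z t"] z eq by simp
  from has_real_derivative_neg_dec_left[OF norm_flow_deriv[of t "{0..}" z] this] t
  obtain d where d: "d > 0" "\<And>h. 0 < h \<Longrightarrow> t - h \<in> {0..} \<Longrightarrow> h < d \<Longrightarrow> (norm (flow z t))\<^sup>2 < (norm (flow z (t - h)))\<^sup>2"
    by auto
  define h where "h = min t (d / 2)"
  have h: "0 < h" "h \<le> t" "h < d" using t d(1) by (auto simp: h_def)
  then have "(norm z)\<^sup>2 < (norm (flow z (t - h)))\<^sup>2" using d(2)[of h] eq by auto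
  moreover have "norm (flow z (t - h)) \<le> norm z"
    using norm_flow_le[OF z order_refl, of "t - h"] h by simp
  ultimately show False by (smt (verit) norm_ge_zero power_mono)
qed

subsection \<open>The flow does not decrease area\<close>

definition cut_force_deriv :: "real^2 \<Rightarrow> real^2 \<Rightarrow> real^2" where
  "cut_force_deriv u v = norm u powr (- \<alpha> - 2) *\<^sub>R v
     - ((\<alpha> + 2) * norm u powr (- \<alpha> - 3) * (v \<bullet> sgn u)) *\<^sub>R u"

lemma cut_force_has_derivative:
  assumes u: "1/2 < norm u"
  shows "(cut_force \<alpha> has_derivative cut_force_deriv u) (at u)"
proof -
  have u0: "u \<noteq> 0" using u by auto
  define p where "p = - \<alpha> - 2"
  have "((\<lambda>r. r powr p) has_derivative (*) (p * norm u powr (p - 1))) (at (norm u))"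
    using u0 by (auto intro!: derivative_eq_intros simp flip: has_field_derivative_def)
  from has_derivative_compose[OF has_derivative_norm[OF u0] this]
  have "((\<lambda>u. norm u powr p *\<^sub>R u) has_derivative
      (\<lambda>v. norm u powr p *\<^sub>R v + (p * norm u powr (p - 1) * (v \<bullet> sgn u)) *\<^sub>R u)) (at u)"
    by (rule has_derivative_scaleR) (rule has_derivative_ident)
  moreover have "norm u powr p *\<^sub>R v + (p * norm u powr (p - 1) * (v \<bullet> sgn u)) *\<^sub>R u = cut_force_deriv u v" for v
  proof -
    have "p - 1 = - \<alpha> - 3" by (simp add: p_def)
    then have "(p * norm u powr (p - 1) * (v \<bullet> sgn u)) = - ((\<alpha> + 2) * norm u powr (- \<alpha> - 3) * (v \<bullet> sgn u))"
      by (simp add: p_def algebra_simps)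
    then show ?thesis unfolding cut_force_deriv_def p_def by simp
  qed
  ultimately have "((\<lambda>u. norm u powr p *\<^sub>R u) has_derivative cut_force_deriv u) (at u)"
    by simp
  moreover have "open {u :: real^2. 1/2 < norm u}"
    by (intro open_Collect_less continuous_intros)
  ultimately show ?thesis
    by (rule has_derivative_transform_within_open) (use u in \<open>auto simp: cut_force_def p_def\<close>)
qed

lemma norm_cut_force_deriv_le:
  assumes u: "1/2 < norm u"
  shows "norm (cut_force_deriv u v) \<le> (\<alpha> + 3) * (1/2) powr (- \<alpha> - 2) * norm v"
proof -
  have "norm u powr (- \<alpha> - 3) * norm u = norm u powr (- \<alpha> - 3) * norm u powr 1"
    using u by simp
  also have "\<dots> = norm u powr (- \<alpha> - 2)"
    by (simp only: powr_add[symmetric], rule arg_cong[where f="(powr) (norm u)"], simp)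
  finally have pw: "norm u powr (- \<alpha> - 3) * norm u = norm u powr (- \<alpha> - 2)" .
  have "\<bar>v \<bullet> sgn u\<bar> \<le> norm v * norm (sgn u)" by (rule Cauchy_Schwarz_ineq2)
  also have "norm (sgn u) = 1" using u by (auto simp: norm_sgn)
  finally have vs: "\<bar>v \<bullet> sgn u\<bar> \<le> norm v" by simp
  have "norm (cut_force_deriv u v) \<le> norm u powr (- \<alpha> - 2) * norm v
      + (\<alpha> + 2) * norm u powr (- \<alpha> - 3) * \<bar>v \<bullet> sgn u\<bar> * norm u"
    unfolding cut_force_deriv_def
    by (rule norm_triangle_ineq4[THEN order_trans]) (use alpha_nonneg in \<open>simp add: abs_mult\<close>)
  also have "\<dots> \<le> norm u powr (- \<alpha> - 2) * norm v + (\<alpha> + 2) * norm u powr (- \<alpha> - 3) * norm v * norm u"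
    using vs alpha_nonneg by (intro add_left_mono mult_right_mono mult_left_mono) auto
  also have "\<dots> = norm u powr (- \<alpha> - 2) * norm v + (\<alpha> + 2) * (norm u powr (- \<alpha> - 3) * norm u) * norm v"
    by simp
  also have "\<dots> = (\<alpha> + 3) * (norm u powr (- \<alpha> - 2) * norm v)"
    unfolding pw by (simp add: algebra_simps)
  also have "\<dots> \<le> (\<alpha> + 3) * ((1/2) powr (- \<alpha> - 2) * norm v)"
    using u alpha_nonneg by (intro mult_left_mono mult_right_mono powr_mono2') auto
  finally show ?thesis by (simp add: mult_ac)
qed

text \<open>The divergence of \<open>norm u powr p *\<^sub>R u\<close> in the plane is
  \<open>(2 + p) * norm u powr p\<close>, here with \<open>p = - \<alpha> - 2\<close>; the 2 is the
  dimension.\<close>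

lemma trace_cut_force_deriv:
  assumes u: "1/2 < norm u"
  shows "cut_force_deriv u (axis 1 1) $ 1 + cut_force_deriv u (axis 2 1) $ 2 = - \<alpha> * norm u powr (- \<alpha> - 2)"
proof -
  have "(norm u)\<^sup>2 = u$1 * u$1 + u$2 * u$2"
    unfolding power2_norm_eq_inner inner_real2 by simp
  then have s: "u$1 * u$1 / norm u + u$2 * u$2 / norm u = norm u"
    using u by (simp add: add_divide_distrib[symmetric] divide_eq_eq power2_eq_square)
  have "norm u powr (- \<alpha> - 3) * norm u = norm u powr (- \<alpha> - 3) * norm u powr 1"
    using u by simp
  also have "\<dots> = norm u powr (- \<alpha> - 2)"
    by (simp only: powr_add[symmetric], rule arg_cong[where f="(powr) (norm u)"], simp)
  finally have pw: "norm u powr (- \<alpha> - 3) * norm u = norm u powr (- \<alpha> - 2)" .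
  have ax: "axis 1 1 \<bullet> sgn u = u $ 1 / norm u" "axis 2 1 \<bullet> sgn u = u $ 2 / norm u"
    by (simp_all add: inner_real2 axis_def sgn_div_norm divide_inverse)
  have "cut_force_deriv u (axis 1 1) $ 1 + cut_force_deriv u (axis 2 1) $ 2
      = 2 * norm u powr (- \<alpha> - 2)
        - (\<alpha> + 2) * norm u powr (- \<alpha> - 3) * (u$1 * u$1 / norm u + u$2 * u$2 / norm u)"
    unfolding cut_force_deriv_def ax by (simp add: axis_def algebra_simps)
  also have "\<dots> = 2 * norm u powr (- \<alpha> - 2) - (\<alpha> + 2) * (norm u powr (- \<alpha> - 3) * norm u)"
    unfolding s by simp
  also have "\<dots> = - \<alpha> * norm u powr (- \<alpha> - 2)"
    unfolding pw by (simp add: algebra_simps)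
  finally show ?thesis .
qed

definition field_deriv :: "real^2 \<Rightarrow> real^2 \<Rightarrow> real^2" where
  "field_deriv y v = - strength *\<^sub>R (\<Sum>j=1..n. cut_force_deriv (y - x j) v)"

text \<open>The inequality is strict because the truncated force has a kink at distance 1/2; on this
  open set \<open>field\<close> is differentiable.\<close>

definition far :: "(real^2) set" where
  "far = {y. \<forall>j\<in>{1..n}. 1/2 < norm (y - x j)}"

lemma field_has_derivative:
  assumes "y \<in> far"
  shows "(field has_derivative field_deriv y) (at y)"
proof -
  have "((\<lambda>y. cut_force \<alpha> (y - x j)) has_derivative cut_force_deriv (y - x j)) (at y)" if "j \<in> {1..n}" for j
  proof -
    have "((\<lambda>z. z - x j) has_derivative (\<lambda>h. h)) (at y)"
      by (auto intro!: derivative_eq_intros)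
    then show ?thesis
      by (rule has_derivative_compose[where g="cut_force \<alpha>"])
        (rule cut_force_has_derivative, use assms that in \<open>auto simp: far_def\<close>)
  qed
  then have "((\<lambda>y. \<Sum>j=1..n. cut_force \<alpha> (y - x j)) has_derivative (\<lambda>v. \<Sum>j=1..n. cut_force_deriv (y - x j) v)) (at y)"
    by (intro has_derivative_sum) auto
  then show ?thesis
    unfolding field_def[abs_def] field_deriv_def[abs_def] by (rule has_derivative_scaleR_right)
qed

lemma norm_field_deriv_le:
  assumes "y \<in> far"
  shows "norm (field_deriv y v) \<le> lip * norm v"
proof -
  have "norm (field_deriv y v) = strength * norm (\<Sum>j=1..n. cut_force_deriv (y - x j) v)"
    using strength_pos by (simp add: field_deriv_def)
  also have "\<dots> \<le> strength * (\<Sum>j=1..n. (\<alpha> + 3) * (1/2) powr (- \<alpha> - 2) * norm v)"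
    using strength_pos assms
    by (intro mult_left_mono sum_norm_le norm_cut_force_deriv_le) (auto simp: far_def)
  finally show ?thesis by (simp add: lip_def)
qed

text \<open>The trace of the Hessian of the energy is non-negative in dimension two: this is what makes
  the ascent flow area-expanding.\<close>

lemma trace_field_deriv_nonneg:
  assumes "y \<in> far"
  shows "0 \<le> field_deriv y (axis 1 1) $ 1 + field_deriv y (axis 2 1) $ 2"
proof -
  have "field_deriv y (axis 1 1) $ 1 + field_deriv y (axis 2 1) $ 2
     = - strength * (\<Sum>j=1..n. cut_force_deriv (y - x j) (axis 1 1) $ 1 + cut_force_deriv (y - x j) (axis 2 1) $ 2)"
    by (simp add: field_deriv_def sum.distrib algebra_simps)
  also have "\<dots> = strength * (\<Sum>j=1..n. \<alpha> * norm (y - x j) powr (- \<alpha> - 2))"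
    using assms by (simp add: trace_cut_force_deriv far_def sum_negf)
  also have "0 \<le> \<dots>"
    using strength_pos alpha_nonneg by (intro mult_nonneg_nonneg sum_nonneg) auto
  finally show ?thesis .
qed

section \<open>Euler steps and their effect on area\<close>

definition euler :: "real \<Rightarrow> real^2 \<Rightarrow> real^2" where
  "euler h y = y + h *\<^sub>R field y"

text \<open>The determinant is 1 plus h times the trace plus \<open>h\<^sup>2\<close> times the
  determinant of the derivative of \<open>field\<close>. The first-order term has the good sign, and
  the entries are bounded by \<open>lip\<close>; a loss of second order per step survives t/h
  steps.\<close>

lemma det_euler_ge:
  assumes y: "y \<in> far" and h: "0 \<le> h"
  shows "1 - 2 * lip\<^sup>2 * h\<^sup>2 \<le> det (matrix (\<lambda>v. v + h *\<^sub>R field_deriv y v))"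
proof -
  define a where "a i j = field_deriv y (axis j 1) $ i" for i j
  have a: "\<bar>a i j\<bar> \<le> lip" for i j
  proof -
    have "\<bar>a i j\<bar> \<le> norm (field_deriv y (axis j 1))" unfolding a_def by (rule component_le_norm_cart)
    also have "\<dots> \<le> lip * norm (axis j (1::real) :: real^2)" by (rule norm_field_deriv_le[OF y])
    finally show ?thesis by (simp add: norm_axis_1)
  qed
  have prod: "\<bar>a i j * a k l\<bar> \<le> lip * lip" for i j k l
    unfolding abs_mult by (intro mult_mono a) (auto simp: lip_nonneg)
  have "det (matrix (\<lambda>v. v + h *\<^sub>R field_deriv y v)) =
      (1 + h * a 1 1) * (1 + h * a 2 2) - (h * a 1 2) * (h * a 2 1)"
    by (simp add: det_2 matrix_def axis_def a_def)
  also have "\<dots> = 1 + h * (a 1 1 + a 2 2) + h\<^sup>2 * (a 1 1 * a 2 2 - a 1 2 * a 2 1)"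
    by (simp add: algebra_simps power2_eq_square)
  also have "\<dots> \<ge> 1 + 0 + h\<^sup>2 * (- (2 * lip\<^sup>2))"
  proof (intro add_mono mult_left_mono order_refl)
    show "0 \<le> h * (a 1 1 + a 2 2)"
      using trace_field_deriv_nonneg[OF y] h by (simp add: a_def)
    show "- (2 * lip\<^sup>2) \<le> a 1 1 * a 2 2 - a 1 2 * a 2 1"
      using prod[of 1 1 2 2] prod[of 1 2 2 1] by (simp add: power2_eq_square abs_le_iff)
  qed simp
  finally show ?thesis by (simp add: algebra_simps)
qed

lemma compact_euler_image: "compact K \<Longrightarrow> compact (euler h ` K)"
  unfolding euler_def by (intro compact_continuous_image continuous_intros)

text \<open>For \<open>h * lip < 1\<close> the step is an injective perturbation of the identity, so
  the area of the image is the integral of the absolute Jacobian over \<open>K\<close>.\<close>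

lemma measure_euler_image_ge:
  assumes K: "compact K" "K \<subseteq> far" and h: "0 \<le> h" "h * lip < 1"
  shows "(1 - 2 * lip\<^sup>2 * h\<^sup>2) * measure lebesgue K \<le> measure lebesgue (euler h ` K)"
proof -
  let ?D = "\<lambda>y v. v + h *\<^sub>R field_deriv y v"
  have inj: "inj_on (euler h) K"
  proof (rule inj_onI)
    fix y z assume "euler h y = euler h z"
    then have "y - z = h *\<^sub>R (field z - field y)" by (simp add: euler_def algebra_simps)
    then have "norm (y - z) = h * norm (field z - field y)" using h by simp
    also have "\<dots> \<le> h * (lip * norm (z - y))"
      by (rule mult_left_mono[OF field_lipschitz h(1)])
    finally have "(1 - h * lip) * norm (y - z) \<le> 0"
      by (simp add: algebra_simps norm_minus_commute)
    then have "norm (y - z) \<le> 0" using h by (simp add: mult_le_0_iff)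
    then show "y = z" by simp
  qed
  have der: "(euler h has_derivative ?D y) (at y within K)" if "y \<in> K" for y
  proof -
    have "(euler h has_derivative ?D y) (at y)"
      unfolding euler_def[abs_def] using that K
      by (intro has_derivative_add has_derivative_ident has_derivative_scaleR_right field_has_derivative) auto
    then show ?thesis by (rule has_derivative_at_withinI)
  qed
  have Kl: "K \<in> lmeasurable" and el: "euler h ` K \<in> lmeasurable"
    using K compact_euler_image by (auto intro: lmeasurable_compact)
  have "((\<lambda>y. \<bar>det (matrix (?D y))\<bar>) has_integral measure lebesgue (euler h ` K)) K"
    using has_measure_differentiable_image[OF fmeasurableD[OF Kl] der inj, of "measure lebesgue (euler h ` K)"] el
    by simp
  note hi = this
  have "((\<lambda>y. 1 - 2 * lip\<^sup>2 * h\<^sup>2) has_integral (1 - 2 * lip\<^sup>2 * h\<^sup>2) * measure lebesgue K) K"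
  proof -
    have "((\<lambda>y. 1) has_integral measure lebesgue K) K"
      using Kl by (simp add: has_integral_iff lmeasurable_iff_integrable_on lmeasure_integral)
    from has_integral_mult_right[OF this, of "1 - 2 * lip\<^sup>2 * h\<^sup>2"] show ?thesis by simp
  qed
  from this hi show ?thesis
    by (rule has_integral_le) (use det_euler_ge h K in force)
qed

text \<open>Mean value inequality for \<open>flow y t - t *\<^sub>R field y\<close>: its derivative
  is the change of \<open>field\<close> along a piece of orbit of length at most
  \<open>speed * h\<close>.\<close>

lemma euler_local_error:
  assumes h: "0 \<le> h"
  shows "norm (flow y h - euler h y) \<le> lip * speed * h\<^sup>2"
proof -
  define g where "g t = flow y t - t *\<^sub>R field y" for t
  have "norm (g h - g 0) \<le> (lip * speed * h) * norm (h - 0)"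
  proof (rule differentiable_bound[where S="{0..h}" and f'="\<lambda>t r. r *\<^sub>R (field (flow y t) - field y)"])
    fix t assume t: "t \<in> {0..h}"
    have "(g has_vector_derivative field (flow y t) - 1 *\<^sub>R field y) (at t within {0..h})"
      unfolding g_def by (intro has_vector_derivative_diff flow_deriv)
        (use t in \<open>auto intro!: derivative_eq_intros\<close>)
    then show "(g has_derivative (\<lambda>r. r *\<^sub>R (field (flow y t) - field y))) (at t within {0..h})"
      by (simp add: has_vector_derivative_def)
    have "norm (field (flow y t) - field y) \<le> lip * norm (flow y t - flow y 0)"
      using field_lipschitz[of "flow y t" y] by simp
    also have "\<dots> \<le> lip * (speed * \<bar>t - 0\<bar>)"
      by (intro mult_left_mono flow_time_lipschitz lip_nonneg) (use t in auto)
    also have "\<dots> \<le> lip * (speed * h)"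
      using t lip_nonneg speed_nonneg by (intro mult_left_mono) auto
    finally have "norm (field (flow y t) - field y) \<le> lip * speed * h" by simp
    from mult_left_mono[OF this abs_ge_zero]
    show "onorm (\<lambda>r. r *\<^sub>R (field (flow y t) - field y)) \<le> lip * speed * h"
      by (intro onorm_le) (simp add: mult.commute)
  qed (use h in auto)
  then show ?thesis
    using h by (simp add: g_def euler_def power2_eq_square diff_diff_eq2 algebra_simps)
qed

lemma euler_global_error:
  assumes h: "0 \<le> h"
  shows "norm ((euler h ^^ k) y - flow y (real k * h)) \<le> h * (real k * h) * lip * speed * exp (lip * (real k * h))"
proof -
  define q A where "q = 1 + h * lip" and "A = lip * speed * h\<^sup>2"
  have q: "1 \<le> q" and A: "0 \<le> A" using h lip_nonneg speed_nonneg by (auto simp: q_def A_def)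
  \<comment> \<open>Each step multiplies the error by at most \<open>q\<close> and adds at most
    \<open>A\<close>. This bound is coarser than the geometric sum but needs no division by
    \<open>lip\<close>.\<close>
  have "norm ((euler h ^^ k) y - flow y (real k * h)) \<le> real k * A * q ^ k"
  proof (induction k)
    case (Suc k)
    let ?u = "(euler h ^^ k) y" and ?v = "flow y (real k * h)"
    have fl: "flow y (real (Suc k) * h) = flow ?v h"
      using h by (simp add: flow_add algebra_simps)
    have split: "(euler h ^^ Suc k) y - flow y (real (Suc k) * h)
        = (?u - ?v) + h *\<^sub>R (field ?u - field ?v) + (euler h ?v - flow ?v h)"
      unfolding fl by (simp add: euler_def algebra_simps)
    have "norm ((euler h ^^ Suc k) y - flow y (real (Suc k) * h)) \<le> norm (?u - ?v) + h * (lip * norm (?u - ?v)) + A"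
      unfolding split
    proof (intro norm_triangle_mono order_refl)
      show "norm (h *\<^sub>R (field ?u - field ?v)) \<le> h * (lip * norm (?u - ?v))"
        using h field_lipschitz by (simp add: mult_left_mono)
      show "norm (euler h ?v - flow ?v h) \<le> A"
        using euler_local_error[OF h, of ?v] by (simp add: A_def norm_minus_commute)
    qed
    then have 1: "norm ((euler h ^^ Suc k) y - flow y (real (Suc k) * h)) \<le> q * norm (?u - ?v) + A"
      by (simp add: q_def algebra_simps)
    have 2: "q * norm (?u - ?v) \<le> q * (real k * A * q ^ k)"
      using Suc q by (intro mult_left_mono) auto
    have 3: "A \<le> A * q ^ Suc k"
      using A one_le_power[OF q, of "Suc k"] mult_left_mono[of 1 "q ^ Suc k" A] by simp
    have 4: "q * (real k * A * q ^ k) + A * q ^ Suc k = real (Suc k) * A * q ^ Suc k"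
      by (simp add: algebra_simps)
    show ?case using 1 2 3 unfolding 4[symmetric] by linarith
  qed simp
  also have "\<dots> \<le> real k * A * exp (h * lip) ^ k"
    using A q exp_ge_add_one_self[of "h * lip"] by (intro mult_left_mono power_mono) (auto simp: q_def)
  also have "\<dots> = h * (real k * h) * lip * speed * exp (lip * (real k * h))"
    by (simp add: A_def power2_eq_square exp_of_nat_mult[symmetric] mult_ac)
  finally show ?thesis .
qed

text \<open>The inequality is weak to make the set compact. It contains every point outside the
  disks, of norm at most \<open>R\<close>, that never attaches. Points whose orbit touches a unit
  circle without entering a disk belong to it too, which is harmless because the whole set turns out
  to be null.\<close>

definition trap :: "real \<Rightarrow> (real^2) set" where
  "trap R = {y \<in> cball 0 R. \<forall>t\<ge>0. \<forall>j\<in>{1..n}. 1 \<le> norm (flow y t - x j)}"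

lemma compact_trap: "compact (trap R)"
proof -
  have cl: "closed {y. 1 \<le> norm (flow y t - x j)}" if "0 \<le> t" for t j
    by (intro closed_Collect_le continuous_intros) (use that in auto)
  have "trap R = cball 0 R \<inter> (\<Inter>t\<in>{0..}. \<Inter>j\<in>{1..n}. {y. 1 \<le> norm (flow y t - x j)})"
    by (auto simp: trap_def)
  moreover have "closed (\<Inter>t\<in>{0..}. \<Inter>j\<in>{1..n}. {y. 1 \<le> norm (flow y t - x j)})"
    by (intro closed_INT ballI cl) auto
  ultimately show ?thesis by (simp add: compact_Int_closed)
qed

lemma flow_in_trap:
  assumes "extent < R" "y \<in> trap R" "0 \<le> t"
  shows "flow y t \<in> trap R"
  using assms norm_flow_le[of R y t] by (auto simp: trap_def flow_add)

lemma trap_far: "y \<in> trap R \<Longrightarrow> j \<in> {1..n} \<Longrightarrow> 1 \<le> norm (y - x j)"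
  by (auto simp: trap_def dest!: spec[of _ 0])

text \<open>The image is compared with \<open>m\<close> Euler steps of length
  \<open>h = t / m\<close>. Their iterates stay within 1/2 of orbits in the trap, hence in
  \<open>far\<close>, where each step multiplies area by at least
  \<open>1 - 2 * lip\<^sup>2 * h\<^sup>2\<close>; Bernoulli's inequality bounds the product below by
  \<open>1 - 2 * lip\<^sup>2 * t * h\<close>.\<close>

lemma measure_flow_image_ge:
  assumes R: "extent < R" and K: "compact K" "K \<subseteq> trap R" and t: "0 \<le> t"
  shows "measure lebesgue K \<le> measure lebesgue ((\<lambda>y. flow y t) ` K)"
proof (rule field_le_epsilon)
  fix e :: real assume e: "0 < e"
  define I where "I = (\<lambda>y. flow y t) ` K"
  have I: "compact I"
    unfolding I_def by (intro compact_continuous_image K continuous_intros) (use t in auto)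
  have Il: "I \<in> lmeasurable" by (rule lmeasurable_compact[OF I])
  \<comment> \<open>Outer regularity supplies a neighbourhood with little extra area; the last Euler
    image will lie in it, being uniformly close to the compact set \<open>I\<close>.\<close>
  obtain V where V: "open V" "I \<subseteq> V" "V - I \<in> lmeasurable" "emeasure lebesgue (V - I) < ennreal (e/2)"
    using sets_lebesgue_outer_open[OF fmeasurableD[OF Il], of "e/2"] e by auto
  have VI: "measure lebesgue (V - I) \<le> e/2"
    using V(4) e by (simp add: emeasure_eq_measure2[OF V(3)] ennreal_less_iff)
  have Veq: "V = I \<union> (V - I)" using V(2) by auto
  have Vl: "V \<in> lmeasurable" by (subst Veq) (intro fmeasurable.Un Il V)
  have Vm: "measure lebesgue V \<le> measure lebesgue I + e/2"
    using VI measure_Un_le[of I lebesgue "V - I"] fmeasurableD[OF Il] fmeasurableD[OF V(3)] Veq by simp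
  obtain d where d: "0 < d" "(\<Union>y\<in>I. ball y d) \<subseteq> V"
    using compact_subset_open_imp_ball_epsilon_subset[OF I V(1,2)] by auto
  \<comment> \<open>In this order: injectivity of a step, a positive factor per step, total loss of
    area below \<open>e/2\<close>, and an Euler error small enough both for \<open>V\<close> and for
    staying in \<open>far\<close>.\<close>
  have "\<forall>\<^sub>F h in at_right 0. h * lip < 1 \<and> 2 * lip\<^sup>2 * h\<^sup>2 < 1
      \<and> 2 * lip\<^sup>2 * t * h * measure lebesgue K < e/2 \<and> h * t * lip * speed * exp (lip * t) < min d (1/2)"
  proof (intro eventually_conj)
    have ev: "\<forall>\<^sub>F h in at_right 0. f h < c" if "continuous_on UNIV f" "f 0 < c" for f :: "real \<Rightarrow> real" and c
    proof -
      have "(f \<longlongrightarrow> f 0) (at_right 0)"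
        using that(1) by (metis UNIV_I continuous_on_def tendsto_within_subset subset_UNIV)
      then show ?thesis using that(2) by (rule order_tendstoD(2))
    qed
    show "\<forall>\<^sub>F h in at_right 0. h * lip < 1" by (rule ev) (auto intro!: continuous_intros)
    show "\<forall>\<^sub>F h in at_right 0. 2 * lip\<^sup>2 * h\<^sup>2 < 1" by (rule ev) (auto intro!: continuous_intros)
    show "\<forall>\<^sub>F h in at_right 0. 2 * lip\<^sup>2 * t * h * measure lebesgue K < e/2"
      by (rule ev) (use e in \<open>auto intro!: continuous_intros\<close>)
    show "\<forall>\<^sub>F h in at_right 0. h * t * lip * speed * exp (lip * t) < min d (1/2)"
      by (rule ev) (use d in \<open>auto intro!: continuous_intros\<close>)
  qed
  then obtain b where b: "0 < b" "\<And>h. 0 < h \<Longrightarrow> h < b \<Longrightarrow> h * lip < 1 \<and> 2 * lip\<^sup>2 * h\<^sup>2 < 1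
      \<and> 2 * lip\<^sup>2 * t * h * measure lebesgue K < e/2 \<and> h * t * lip * speed * exp (lip * t) < min d (1/2)"
    unfolding eventually_at_right_field by auto
  show "measure lebesgue K \<le> measure lebesgue ((\<lambda>y. flow y t) ` K) + e"
  proof (cases "t = 0")
    case True
    then show ?thesis using e by simp
  next
    case False
    then have tpos: "0 < t" using t by simp
    obtain m :: nat where m: "t / b < real m" using reals_Archimedean2 by blast
    define h where "h = t / real m"
    have mpos: "0 < real m" using m tpos b(1) by (smt (verit) divide_pos_pos)
    have h: "0 < h" "h < b" "real m * h = t"
      using m mpos tpos b(1) by (auto simp: h_def field_simps)
    note hb = b(2)[OF h(1,2)]
    have err: "norm ((euler h ^^ k) y - flow y (real k * h)) < min d (1/2)" if k: "k \<le> m" for k y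
    proof -
      have kt: "real k * h \<le> t" using k h by (metis mult_right_mono of_nat_le_iff less_imp_le)
      have "norm ((euler h ^^ k) y - flow y (real k * h)) \<le> h * (real k * h) * lip * speed * exp (lip * (real k * h))"
        by (rule euler_global_error) (use h in simp)
      also have "\<dots> \<le> h * t * lip * speed * exp (lip * t)"
        using kt h tpos lip_nonneg speed_nonneg by (intro mult_mono) (auto intro: mult_left_mono)
      finally show ?thesis using hb by simp
    qed
    have step: "compact ((euler h ^^ k) ` K) \<and>
        (1 - 2 * lip\<^sup>2 * h\<^sup>2) ^ k * measure lebesgue K \<le> measure lebesgue ((euler h ^^ k) ` K)" if "k \<le> m" for k
      using that
    proof (induction k)
      case (Suc k)
      have far: "(euler h ^^ k) ` K \<subseteq> far"
      proof
        fix z assume "z \<in> (euler h ^^ k) ` K"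
        then obtain y where y: "y \<in> K" "z = (euler h ^^ k) y" by auto
        have "1/2 < norm (z - x j)" if j: "j \<in> {1..n}" for j
        proof -
        have "1 \<le> norm (flow y (real k * h) - x j)"
          using trap_far[OF flow_in_trap[OF R]] K(2) y h(1) j by (auto simp: subset_iff)
        also have "\<dots> \<le> norm ((euler h ^^ k) y - x j) + norm ((euler h ^^ k) y - flow y (real k * h))"
          using dist_triangle3[of "flow y (real k * h)" "x j" "(euler h ^^ k) y"] by (simp add: dist_norm)
        finally show ?thesis
          using err[of k y] Suc.prems y by simp
        qed
        then show "z \<in> far" by (simp add: far_def)
      qed
      have im: "(euler h ^^ Suc k) ` K = euler h ` ((euler h ^^ k) ` K)"
        by (simp add: image_image)
      have IH: "compact ((euler h ^^ k) ` K)"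
        "(1 - 2 * lip\<^sup>2 * h\<^sup>2) ^ k * measure lebesgue K \<le> measure lebesgue ((euler h ^^ k) ` K)"
        using Suc by auto
      have "(1 - 2 * lip\<^sup>2 * h\<^sup>2) ^ Suc k * measure lebesgue K
          = (1 - 2 * lip\<^sup>2 * h\<^sup>2) * ((1 - 2 * lip\<^sup>2 * h\<^sup>2) ^ k * measure lebesgue K)" by simp
      also have "\<dots> \<le> (1 - 2 * lip\<^sup>2 * h\<^sup>2) * measure lebesgue ((euler h ^^ k) ` K)"
        using hb by (intro mult_left_mono IH) auto
      also have "\<dots> \<le> measure lebesgue ((euler h ^^ Suc k) ` K)"
        unfolding im by (rule measure_euler_image_ge[OF IH(1) far]) (use h hb in auto)
      finally show ?case unfolding im using compact_euler_image[OF IH(1)] by blast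
    qed (use K in simp)
    have "measure lebesgue K - e/2 \<le> measure lebesgue K - 2 * lip\<^sup>2 * t * h * measure lebesgue K"
      using hb by simp
    also have "\<dots> = (1 + real m * (- (2 * lip\<^sup>2 * h\<^sup>2))) * measure lebesgue K"
      unfolding h(3)[symmetric] by (simp add: algebra_simps power2_eq_square)
    also have "\<dots> \<le> (1 + (- (2 * lip\<^sup>2 * h\<^sup>2))) ^ m * measure lebesgue K"
      using hb by (intro mult_right_mono Bernoulli_inequality) auto
    also have "\<dots> \<le> measure lebesgue ((euler h ^^ m) ` K)"
      using step[of m] by simp
    also have "\<dots> \<le> measure lebesgue V"
    proof (rule measure_mono_fmeasurable[OF _ _ Vl])
      show "(euler h ^^ m) ` K \<subseteq> V"
      proof
        fix z assume "z \<in> (euler h ^^ m) ` K"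
        then obtain y where y: "y \<in> K" "z = (euler h ^^ m) y" by auto
        have "z \<in> ball (flow y t) d"
          using err[of m y] h(3) y by (simp add: dist_norm norm_minus_commute)
        moreover have "flow y t \<in> I" using y by (auto simp: I_def)
        ultimately show "z \<in> V" using d(2) by blast
      qed
      show "(euler h ^^ m) ` K \<in> sets lebesgue"
        using step[of m] by (auto intro: fmeasurableD lmeasurable_compact)
    qed
    finally show ?thesis using Vm by (simp add: I_def)
  qed
qed

subsection \<open>Almost every point of the plane is attached\<close>

lemma continuous_on_energy:
  assumes "\<And>y j. y \<in> A \<Longrightarrow> j \<in> {1..n} \<Longrightarrow> 1 \<le> norm (y - x j)"
  shows "continuous_on A (energy \<alpha> n x)"
proof (rule continuous_at_imp_continuous_on, rule ballI)
  fix y assume y: "y \<in> A"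
  have "GDERIV (energy \<alpha> n x) y :> field y"
    by (rule energy_gderiv) (use assms[OF y] in fastforce)
  then show "isCont (energy \<alpha> n x) y"
    unfolding gderiv_def by (rule has_derivative_continuous)
qed

lemma energy_flow_deriv:
  assumes far: "\<And>j. j \<in> {1..n} \<Longrightarrow> 1 \<le> norm (flow y t - x j)" and t: "0 \<le> t"
  shows "((\<lambda>t. energy \<alpha> n x (flow y t)) has_real_derivative (norm (field (flow y t)))\<^sup>2) (at t within {0..})"
proof -
  have "(energy \<alpha> n x has_derivative (\<lambda>h. h \<bullet> field (flow y t))) (at (flow y t))"
    using energy_gderiv[of "flow y t"] far unfolding gderiv_def by fastforce
  moreover have "(flow y has_derivative (\<lambda>h. h *\<^sub>R field (flow y t))) (at t within {0..})"
    using flow_deriv[OF t order_refl] by (simp add: has_vector_derivative_def)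
  ultimately have "((\<lambda>t. energy \<alpha> n x (flow y t)) has_derivative (\<lambda>h. (h *\<^sub>R field (flow y t)) \<bullet> field (flow y t))) (at t within {0..})"
    by (rule has_derivative_compose[rotated])
  then show ?thesis
    by (rule has_derivative_imp_has_field_derivative) (simp add: power2_norm_eq_inner)
qed

definition gain :: "real^2 \<Rightarrow> real" where
  "gain y = energy \<alpha> n x (flow y 1) - energy \<alpha> n x y"

text \<open>Along an orbit the energy has derivative
  \<open>(norm (field (flow y t)))\<^sup>2\<close>. If the field does not vanish at the start, the
  energy increases strictly at once and never loses that increase.\<close>

lemma gain_nonneg:
  assumes y: "y \<in> trap R"
  shows "0 \<le> gain y" and "gain y = 0 \<Longrightarrow> field y = 0"
proof -
  let ?e = "\<lambda>t. energy \<alpha> n x (flow y t)"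
  have far: "1 \<le> norm (flow y t - x j)" if "0 \<le> t" "j \<in> {1..n}" for t j
    using y that by (auto simp: trap_def)
  have mono: "?e s \<le> ?e t" if "0 \<le> s" "s \<le> t" for s t
  proof (rule mono_of_derivative_nonneg_within[OF \<open>s \<le> t\<close>])
    fix r assume "r \<in> {s..t}"
    then show "(?e has_real_derivative (norm (field (flow y r)))\<^sup>2) (at r within {s..t})"
      using that by (intro has_field_derivative_subset[OF energy_flow_deriv]) (auto intro: far)
  qed simp
  show "0 \<le> gain y" using mono[of 0 1] by (simp add: gain_def)
  show "field y = 0" if "gain y = 0"
  proof (rule ccontr)
    assume ne: "field y \<noteq> 0"
    have "(?e has_real_derivative (norm (field (flow y 0)))\<^sup>2) (at 0 within {0..})"
      by (rule energy_flow_deriv) (use far[of 0] in auto)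
    from has_real_derivative_pos_inc_right[OF this] ne
    obtain d where d: "d > 0" "\<And>h. 0 < h \<Longrightarrow> h < d \<Longrightarrow> ?e 0 < ?e h" by auto
    define h where "h = min 1 (d / 2)"
    have "0 < h" "h < d" "h \<le> 1" using d(1) by (auto simp: h_def)
    then have "?e 0 < ?e 1" using d(2)[of h] mono[of h 1] by simp
    then show False using that by (simp add: gain_def)
  qed
qed

lemma continuous_on_gain:
  assumes R: "extent < R"
  shows "continuous_on (trap R) gain"
proof -
  have e: "continuous_on (trap R) (energy \<alpha> n x)"
    by (rule continuous_on_energy) (rule trap_far)
  have "continuous_on (trap R) (\<lambda>y. energy \<alpha> n x (flow y 1))"
    by (rule continuous_on_compose2[OF e]) (auto intro!: continuous_intros flow_in_trap R)
  then show ?thesis unfolding gain_def[abs_def] by (intro continuous_on_diff e)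
qed

text \<open>If the trap had positive area, then by area expansion a fixed proportion of it would gain a
  fixed amount of energy in each unit of time, although the energy is bounded on the trap.\<close>

lemma negligible_trap:
  assumes R: "extent < R" and P: "property_P \<alpha> n x"
  shows "negligible (trap R)"
proof -
  define N where "N = trap R"
  define \<mu> where "\<mu> = measure lebesgue N"
  have N: "compact N" unfolding N_def by (rule compact_trap)
  have lN: "N \<in> lmeasurable" by (rule lmeasurable_compact[OF N])
  have cg: "continuous_on N gain" unfolding N_def by (rule continuous_on_gain[OF R])
  have ce: "continuous_on N (energy \<alpha> n x)"
    by (rule continuous_on_energy) (auto simp: N_def intro: trap_far)
  have inv: "flow y t \<in> N" if "y \<in> N" "0 \<le> t" for y t
    using that flow_in_trap[OF R] by (simp add: N_def)
  have cf: "continuous_on N (\<lambda>y. flow y t)" if "0 \<le> t" for t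
    by (intro continuous_intros) (use that in auto)
  have cgf: "continuous_on N (\<lambda>y. gain (flow y t))" if "0 \<le> t" for t
    by (rule continuous_on_compose2[OF cg cf[OF that]]) (use inv that in auto)
  have sub: "compact {y \<in> N. f y \<le> c}" if "continuous_on N f" for f :: "real^2 \<Rightarrow> real" and c
  proof -
    have "{y \<in> N. f y \<le> c} = N \<inter> f -` {..c}" by auto
    moreover have "closed (N \<inter> f -` {..c})"
      by (rule continuous_closed_preimage[OF that compact_imp_closed[OF N]]) simp
    ultimately show ?thesis using N by (metis compact_Int_closed inf.left_idem)
  qed
  \<comment> \<open>Points that gain almost nothing in unit time. These compact sets shrink to
    points without gain, which are critical, so by property (P) their areas tend to 0.\<close>
  define Z where "Z k = {y \<in> N. gain y \<le> 1 / real (Suc k)}" for k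
  have Zc: "compact (Z k)" for k unfolding Z_def by (rule sub[OF cg])
  have Zl: "Z k \<in> lmeasurable" for k by (rule lmeasurable_compact[OF Zc])
  have "(\<lambda>k. measure lebesgue (Z k)) \<longlonglongrightarrow> measure lebesgue (\<Inter>k. Z k)"
  proof (rule Lim_measure_decseq)
    show "range Z \<subseteq> sets lebesgue" using fmeasurableD[OF Zl] by auto
    show "decseq Z"
    proof (rule antimonoI)
      fix k l :: nat assume "k \<le> l"
      then have "1 / real (Suc l) \<le> 1 / real (Suc k)" by (simp add: frac_le)
      then show "Z l \<subseteq> Z k" by (auto simp: Z_def)
    qed
    show "emeasure lebesgue (Z k) \<noteq> \<infinity>" for k
      unfolding infinity_ennreal_def by (rule fmeasurableD2[OF Zl])
  qed
  moreover have "measure lebesgue (\<Inter>k. Z k) = 0"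
  proof -
    have "(\<Inter>k. Z k) \<subseteq> critical_points \<alpha> n x"
    proof
      fix y assume y: "y \<in> (\<Inter>k. Z k)"
      then have yN: "y \<in> trap R" by (auto simp: Z_def N_def)
      have "gain y \<le> 0"
      proof (rule LIMSEQ_le_const[OF LIMSEQ_inverse_real_of_nat])
        show "\<exists>m. \<forall>k\<ge>m. gain y \<le> inverse (real (Suc k))"
          using y by (auto simp: Z_def divide_inverse)
      qed
      then have "field y = 0" using gain_nonneg[OF yN] by auto
      then show "y \<in> critical_points \<alpha> n x"
        using critical_if_field_0 trap_far[OF yN] by blast
    qed
    then have "finite (\<Inter>k. Z k)" using P unfolding property_P_def by (rule finite_subset)
    then show ?thesis by (intro negligible_imp_measure0 negligible_finite)
  qed
  ultimately have lim: "(\<lambda>k. measure lebesgue (Z k)) \<longlonglongrightarrow> 0" by simp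
  have "\<mu> = 0"
  proof (rule ccontr)
    assume "\<mu> \<noteq> 0"
    then have \<mu>: "\<mu> > 0" unfolding \<mu>_def using measure_nonneg[of lebesgue N] by linarith
    then obtain k where k: "measure lebesgue (Z k) < \<mu> / 2"
      using order_tendstoD(2)[OF lim, of "\<mu> / 2"] by (auto dest: eventually_happens)
    define \<epsilon> where "\<epsilon> = 1 / real (Suc k)"
    have \<epsilon>: "\<epsilon> > 0" by (simp add: \<epsilon>_def)
    have intg: "integrable lborel (\<lambda>y. indicator N y *\<^sub>R gain (flow y (real i)))" for i
      by (rule borel_integrable_compact[OF N cgf]) simp
    have each: "\<epsilon> * (\<mu> / 2) \<le> (\<integral>y. indicator N y *\<^sub>R gain (flow y (real i)) \<partial>lborel)" for i :: nat
    proof -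
      define K where "K = {y \<in> N. gain (flow y (real i)) \<le> \<epsilon>}"
      have Kc: "compact K" unfolding K_def by (rule sub[OF cgf]) simp
      have Kl: "K \<in> lmeasurable" by (rule lmeasurable_compact[OF Kc])
      \<comment> \<open>\<open>K\<close> collects the points that gain little in the unit of time
        after \<open>real i\<close>. The flow carries them into \<open>Z k\<close> without
        decreasing area, so \<open>K\<close> has at most the area of \<open>Z k\<close>, and more
        than half of \<open>N\<close> gains more than \<open>\<epsilon>\<close>.\<close>
      have "measure lebesgue K \<le> measure lebesgue ((\<lambda>y. flow y (real i)) ` K)"
        by (rule measure_flow_image_ge[OF R Kc]) (auto simp: K_def N_def)
      also have "\<dots> \<le> measure lebesgue (Z k)"
      proof (rule measure_mono_fmeasurable[OF _ _ Zl])
        show "(\<lambda>y. flow y (real i)) ` K \<subseteq> Z k"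
          using inv by (auto simp: K_def Z_def \<epsilon>_def)
        have "compact ((\<lambda>y. flow y (real i)) ` K)"
          by (rule compact_continuous_image[OF continuous_on_subset[OF cf] Kc]) (auto simp: K_def)
        then show "(\<lambda>y. flow y (real i)) ` K \<in> sets lebesgue"
          by (intro fmeasurableD lmeasurable_compact)
      qed
      finally have Kk: "measure lebesgue K < \<mu> / 2" using k by simp
      have NK: "N - K \<in> sets borel" using N Kc by (intro sets.Diff) (auto intro: borel_compact)
      have "measure lebesgue (N - K) = \<mu> - measure lebesgue K"
        unfolding \<mu>_def by (rule measurable_measure_Diff[OF lN fmeasurableD[OF Kl]]) (auto simp: K_def)
      then have m: "\<mu> / 2 \<le> measure lborel (N - K)" using Kk NK by simp
      have fin: "emeasure lborel (N - K) < \<infinity>"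
        by (rule emeasure_bounded_finite, rule bounded_subset[OF compact_imp_bounded[OF N]]) auto
      have hb: "has_bochner_integral lborel (indicator (N - K)) (measure lborel (N - K))"
        by (rule has_bochner_integral_real_indicator) (use NK fin in auto)
      have "\<epsilon> * (\<mu> / 2) \<le> \<epsilon> * measure lborel (N - K)"
        using m \<epsilon> by simp
      also have "\<dots> = (\<integral>y. \<epsilon> * indicator (N - K) y \<partial>lborel)"
        using has_bochner_integral_integral_eq[OF hb] by simp
      also have "\<dots> \<le> (\<integral>y. indicator N y *\<^sub>R gain (flow y (real i)) \<partial>lborel)"
      proof (rule integral_mono)
        show "integrable lborel (\<lambda>y. \<epsilon> * indicator (N - K) y)"
          using hb by (intro integrable_mult_right) (auto simp: has_bochner_integral_iff)
        fix y :: "real^2"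
        have "0 \<le> gain (flow y (real i))" if "y \<in> N"
          using gain_nonneg(1)[of "flow y (real i)" R] inv[OF that] by (simp add: N_def)
        then show "\<epsilon> * indicator (N - K) y \<le> indicator N y *\<^sub>R gain (flow y (real i))"
          by (auto simp: indicator_def K_def)
      qed (rule intg)
      finally show ?thesis .
    qed
    obtain M where M: "\<And>y. y \<in> N \<Longrightarrow> \<bar>energy \<alpha> n x y\<bar> \<le> M"
      using compact_imp_bounded[OF compact_continuous_image[OF ce N]] by (auto simp: bounded_iff)
    \<comment> \<open>Summed over the units of time, the gains telescope to a difference of two
      values of the energy on \<open>N\<close>, which is at most \<open>2 * M\<close>.\<close>
    have bound: "real m * (\<epsilon> * (\<mu> / 2)) \<le> 2 * M * \<mu>" for m :: nat
    proof -
      have "real m * (\<epsilon> * (\<mu> / 2)) = (\<Sum>i<m. \<epsilon> * (\<mu> / 2))" by simp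
      also have "\<dots> \<le> (\<Sum>i<m. \<integral>y. indicator N y *\<^sub>R gain (flow y (real i)) \<partial>lborel)"
        by (intro sum_mono each)
      also have "\<dots> = (\<integral>y. (\<Sum>i<m. indicator N y *\<^sub>R gain (flow y (real i))) \<partial>lborel)"
        by (rule Bochner_Integration.integral_sum[symmetric]) (rule intg)
      also have "\<dots> \<le> (\<integral>y. 2 * M * indicator N y \<partial>lborel)"
      proof (rule integral_mono)
        show "integrable lborel (\<lambda>y. \<Sum>i<m. indicator N y *\<^sub>R gain (flow y (real i)))"
          by (intro Bochner_Integration.integrable_sum intg)
        show "integrable lborel (\<lambda>y. 2 * M * indicator N y)"
          using borel_integrable_compact[OF N, of "\<lambda>_. 1::real"]
          by (intro integrable_mult_right) simp
        fix y
        have "(\<Sum>i<m. gain (flow y (real i))) \<le> 2 * M" if y: "y \<in> N"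
        proof -
          have "(\<Sum>i<m. gain (flow y (real i)))
              = (\<Sum>i<m. energy \<alpha> n x (flow y (real (Suc i))) - energy \<alpha> n x (flow y (real i)))"
            by (intro sum.cong refl) (simp add: gain_def flow_add add.commute)
          also have "\<dots> = energy \<alpha> n x (flow y (real m)) - energy \<alpha> n x y"
            by (subst sum_lessThan_telescope) simp
          also have "\<dots> \<le> 2 * M"
            using M[OF y] M[OF inv[OF y, of "real m"]] by linarith
          finally show ?thesis .
        qed
        then show "(\<Sum>i<m. indicator N y *\<^sub>R gain (flow y (real i))) \<le> 2 * M * indicator N y"
          by (simp add: indicator_def)
      qed
      also have "\<dots> = 2 * M * \<mu>"
        using borel_compact[OF N] by (simp add: \<mu>_def)
      finally show ?thesis .
    qed
    obtain m :: nat where m: "4 * M / \<epsilon> < real m" using reals_Archimedean2 by blast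
    have "real m * \<epsilon> \<le> 4 * M" using bound[of m] \<mu> by (simp add: field_simps)
    then show False using m \<epsilon> by (simp add: field_simps)
  qed
  then show ?thesis unfolding \<mu>_def N_def[symmetric] using lN by (simp add: negligible_iff_measure)
qed

subsection \<open>First hitting times\<close>

definition contact :: "(real^2) set" where
  "contact = {y. \<not> outside y}"

lemma closed_contact: "closed contact"
proof -
  have "contact = (\<Union>j\<in>{1..n}. {y. norm (y - x j) \<le> 1})"
    by (auto simp: contact_def outside_def not_less)
  then show ?thesis by (auto intro!: closed_UN closed_Collect_le continuous_intros)
qed

text \<open>The times of contact up to \<open>s\<close> form a closed set, and \<open>T\<close> is
  its infimum. No particle is closer than 1 at time \<open>T\<close>, which forces the contact to
  happen on a unit circle.\<close>

lemma first_contact: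
  assumes out: "outside z" and hit: "0 \<le> s" "flow z s \<in> contact"
  obtains T where "0 \<le> T" "T \<le> s" "flow z T \<in> contact" "\<And>t. 0 \<le> t \<Longrightarrow> t < T \<Longrightarrow> outside (flow z t)"
    and "\<And>j. j \<in> {1..n} \<Longrightarrow> 1 \<le> norm (flow z T - x j)"
proof -
  define H where "H = {0..s} \<inter> flow z -` contact"
  have H: "closed H" unfolding H_def
    by (intro continuous_closed_preimage closed_contact continuous_intros) auto
  have ne: "H \<noteq> {}" "bdd_below H" using hit by (auto simp: H_def intro: bdd_belowI[of _ 0])
  define T where "T = Inf H"
  have T: "T \<in> H" unfolding T_def by (rule closed_contains_Inf[OF ne H])
  have before: "outside (flow z t)" if "0 \<le> t" "t < T" for t
  proof (rule ccontr)
    assume "\<not> outside (flow z t)"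
    then have "t \<in> H" using that T by (auto simp: H_def contact_def)
    then show False using cInf_lower[OF _ ne(2)] that by (fastforce simp: T_def)
  qed
  have far: "1 \<le> norm (flow z T - x j)" if j: "j \<in> {1..n}" for j
  proof (rule flow_stays_outside(1)[where T=T])
    show "continuous_on {0..T} (flow z)" by (intro continuous_intros) auto
    show "\<forall>t\<in>{0..<T}. \<forall>j\<in>{1..n}. norm (flow z t - x j) \<noteq> 1"
      using before by (force simp: outside_def)
  qed (use j T out in \<open>auto simp: H_def\<close>)
  show ?thesis
    by (rule that[of T]) (use T before far in \<open>auto simp: H_def\<close>)
qed

text \<open>A point that is not trapped enters some open unit disk; at its first contact the
  distance to some particle is both at most 1 and at least 1.\<close>

lemma attaches_or_trapped:
  assumes out: "outside z" and z: "norm z \<le> R"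
  shows "(\<exists>i\<in>{1..n}. attaches \<alpha> n x z i) \<or> z \<in> trap R"
proof (cases "z \<in> trap R")
  case False
  then obtain s j where s: "0 \<le> s" "j \<in> {1..n}" "\<not> 1 \<le> norm (flow z s - x j)"
    using z by (auto simp: trap_def)
  then have "flow z s \<in> contact" by (force simp: contact_def outside_def)
  from first_contact[OF out s(1) this] obtain T where T: "0 \<le> T" "flow z T \<in> contact"
    "\<And>t. 0 \<le> t \<Longrightarrow> t < T \<Longrightarrow> outside (flow z t)" "\<And>j. j \<in> {1..n} \<Longrightarrow> 1 \<le> norm (flow z T - x j)"
    by metis
  obtain i where i: "i \<in> {1..n}" "norm (flow z T - x i) \<le> 1"
    using T(2) by (auto simp: contact_def outside_def not_less)
  have "norm (flow z T - x i) = 1" using T(4)[OF i(1)] i(2) by simp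
  moreover have "\<forall>t\<in>{0..<T}. \<forall>j\<in>{1..n}. norm (flow z t - x j) \<noteq> 1"
    using T(3) by (force simp: outside_def)
  ultimately have "attaches \<alpha> n x z i" unfolding attaches_iff using out T(1) by blast
  then show ?thesis using i by blast
qed simp

text \<open>The projection of a closed set along a compact factor is closed; the factor is the
  interval of times.\<close>

lemma closed_hit:
  assumes S: "closed S" and a: "0 \<le> a"
  shows "closed {z. \<exists>t\<in>{a..b}. flow z t \<in> S}"
proof -
  have "closed (({a..b} \<times> UNIV) \<inter> (\<lambda>(t, z). flow z t) -` S)"
    by (intro continuous_closed_preimage continuous_on_subset[OF continuous_on_flow_pair] closed_Times S)
      (use a in auto)
  from closed_compact_projection[OF compact_Icc this]
  have "closed {z. \<exists>t. t \<in> {a..b} \<and> (t, z) \<in> ({a..b} \<times> UNIV) \<inter> (\<lambda>(t, z). flow z t) -` S}" .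
  also have "{z. \<exists>t. t \<in> {a..b} \<and> (t, z) \<in> ({a..b} \<times> UNIV) \<inter> (\<lambda>(t, z). flow z t) -` S}
      = {z. \<exists>t\<in>{a..b}. flow z t \<in> S}" by auto
  finally show ?thesis .
qed

text \<open>The first contact happens on the \<open>i\<close>-th circle iff arbitrarily short time intervals, with
  rational left endpoint and no contact before, contain a visit to that circle.\<close>

lemma attaches_borel:
  assumes i: "i \<in> {1..n}"
  shows "{z. attaches \<alpha> n x z i} \<in> sets borel"
proof -
  define C where "C = {y. norm (y - x i) = 1}"
  have C: "closed C" unfolding C_def by (intro closed_Collect_eq continuous_intros)
  have CF: "C \<subseteq> contact" using i by (force simp: C_def contact_def outside_def)
  define Q where "Q = {q \<in> \<rat>. 0 \<le> (q :: real)}"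
  have Q: "countable Q" unfolding Q_def by (rule countable_subset[OF _ countable_rat]) auto
  define A where "A k q = - {z. \<exists>t\<in>{0..q}. flow z t \<in> contact} \<inter> {z. \<exists>t\<in>{q..q + 1 / real (Suc k)}. flow z t \<in> C}" for k q
  have A: "A k q \<in> sets borel" if "q \<in> Q" for k q
    unfolding A_def using that C closed_contact
    by (intro sets.Int borel_closed borel_comp closed_hit) (auto simp: Q_def)
  have "{z. attaches \<alpha> n x z i} = - contact \<inter> (\<Inter>k. \<Union>q\<in>Q. A k q)"
  proof (intro set_eqI iffI)
    fix z assume "z \<in> {z. attaches \<alpha> n x z i}"
    then obtain T where out: "outside z" and T: "0 \<le> T" "norm (flow z T - x i) = 1"
      "\<forall>t\<in>{0..<T}. \<forall>j\<in>{1..n}. norm (flow z t - x j) \<noteq> 1"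
      unfolding attaches_iff by auto
    have cont: "continuous_on {0..T} (flow z)" by (intro continuous_intros) auto
    have before: "flow z t \<notin> contact" if "0 \<le> t" "t < T" for t
      using flow_stays_outside(2)[OF cont _ T(3)] that out by (auto simp: contact_def outside_def)
    have "T \<noteq> 0" using out T(2) i by (force simp: outside_def)
    have "z \<in> (\<Union>q\<in>Q. A k q)" for k
    proof -
      have "max 0 (T - 1 / real (Suc k)) < T" using T(1) \<open>T \<noteq> 0\<close> by simp
      from Rats_dense_in_real[OF this] obtain q where q: "q \<in> \<rat>" "max 0 (T - 1 / real (Suc k)) < q" "q < T"
        by blast
      have "\<not> (\<exists>t\<in>{0..q}. flow z t \<in> contact)" using before q(3) by auto
      moreover have "\<exists>t\<in>{q..q + 1 / real (Suc k)}. flow z t \<in> C"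
        by (rule bexI[of _ T]) (use q T(2) in \<open>auto simp: C_def\<close>)
      ultimately show ?thesis using q by (auto simp: A_def Q_def)
    qed
    then show "z \<in> - contact \<inter> (\<Inter>k. \<Union>q\<in>Q. A k q)" using out by (auto simp: contact_def)
  next
    fix z assume "z \<in> - contact \<inter> (\<Inter>k. \<Union>q\<in>Q. A k q)"
    then have out: "outside z" and "\<forall>k. \<exists>q\<in>Q. z \<in> A k q" by (auto simp: contact_def)
    then obtain q where q: "\<And>k. q k \<in> Q" "\<And>k. z \<in> A k (q k)" by metis
    have "\<exists>t. t \<in> {q k..q k + 1 / real (Suc k)} \<and> flow z t \<in> C" for k using q(2)[of k] by (auto simp: A_def)
    then obtain t where t: "\<And>k. t k \<in> {q k..q k + 1 / real (Suc k)}" "\<And>k. flow z (t k) \<in> C" by metis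
    have t0: "0 \<le> t k" for k using t(1)[of k] q(1)[of k] by (auto simp: Q_def)
    have "flow z (t 0) \<in> contact" using t(2) CF by blast
    from first_contact[OF out t0 this] obtain T where T: "0 \<le> T" "flow z T \<in> contact"
      "\<And>t. 0 \<le> t \<Longrightarrow> t < T \<Longrightarrow> outside (flow z t)"
      by metis
    \<comment> \<open>No contact up to \<open>q k\<close> gives \<open>q k < T\<close>, so the
      visits at times \<open>t k\<close> are squeezed onto the first contact \<open>T\<close>;
      closedness of \<open>C\<close> then puts \<open>flow z T\<close> on the circle.\<close>
    have close: "T \<le> t k" "t k \<le> T + 1 / real (Suc k)" for k
    proof -
      show "T \<le> t k" using T(3)[OF t0[of k]] t(2)[of k] CF by (force simp: contact_def)
      have "q k < T" using q(2)[of k] T(1,2) by (force simp: A_def)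
      then show "t k \<le> T + 1 / real (Suc k)" using t(1)[of k] by auto
    qed
    have "t \<longlonglongrightarrow> T"
    proof (rule tendsto_sandwich[of "\<lambda>_. T" t sequentially "\<lambda>k. T + 1 / real (Suc k)"])
      have "(\<lambda>k. T + 1 / real (Suc k)) \<longlonglongrightarrow> T + 0"
        using LIMSEQ_inverse_real_of_nat by (intro tendsto_add tendsto_const) (simp add: divide_inverse)
      then show "(\<lambda>k. T + 1 / real (Suc k)) \<longlonglongrightarrow> T" by simp
    qed (use close in auto)
    moreover have "continuous_on {0..} (flow z)" by (intro continuous_intros) auto
    ultimately have "(\<lambda>k. flow z (t k)) \<longlonglongrightarrow> flow z T"
      using T(1) t0 by (intro continuous_on_tendsto_compose[of "{0..}" "flow z"]) auto
    then have "flow z T \<in> C"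
      using closed_sequentially[OF C, of "\<lambda>k. flow z (t k)"] t by blast
    moreover have "\<forall>t\<in>{0..<T}. \<forall>j\<in>{1..n}. norm (flow z t - x j) \<noteq> 1"
      using T(3) by (force simp: outside_def)
    ultimately show "z \<in> {z. attaches \<alpha> n x z i}"
      unfolding mem_Collect_eq attaches_iff using out T(1) by (auto simp: C_def)
  qed
  also have "\<dots> \<in> sets borel"
  proof (rule sets.Int)
    show "- contact \<in> sets borel" by (intro borel_comp borel_closed closed_contact)
    have "(\<Union>q\<in>Q. A k q) \<in> sets borel" for k by (rule sets.countable_UN'[OF Q]) (use A in blast)
    then show "(\<Inter>k. \<Union>q\<in>Q. A k q) \<in> sets borel" by (intro sets.countable_INT'') simp_all
  qed
  finally show ?thesis .
qed

section \<open>Attachment angles on large circles\<close>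

lemma outside_if_norm_gt:
  assumes "extent + 1 < norm z"
  shows "outside z"
  unfolding outside_def
proof
  fix j assume "j \<in> {1..n}"
  then show "1 < norm (z - x j)"
    using norm_particle_le[of j] norm_triangle_ineq2[of z "x j"] assms by linarith
qed

text \<open>Both attachments happen at the same time, at one of the finitely many common points of
  two unit circles. Each such point comes from at most one start: by injectivity of the flow two
  starts would lie on one orbit, along which the norm drops strictly below \<open>r\<close>.\<close>

lemma finite_double_attachments:
  assumes r: "extent + 1 < r" and ij: "i \<in> {1..n}" "j \<in> {1..n}" "i \<noteq> j"
  shows "finite {\<theta> \<in> {0..<2*pi}. attaches \<alpha> n x (r *\<^sub>R dir \<theta>) i \<and> attaches \<alpha> n x (r *\<^sub>R dir \<theta>) j}"
    (is "finite ?E")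
proof -
  define Q where "Q = {q. norm (q - x i) = 1 \<and> norm (q - x j) = 1}"
  have Q: "finite Q" unfolding Q_def by (rule finite_unit_circles_Int[OF particles_distinct[OF ij]])
  have r0: "0 < r" using r extent_nonneg by simp
  define P where "P \<theta> q \<longleftrightarrow> (\<exists>T\<ge>0. flow (r *\<^sub>R dir \<theta>) T = q)" for \<theta> q
  have ex: "\<exists>q\<in>Q. P \<theta> q" if \<theta>: "\<theta> \<in> ?E" for \<theta>
  proof -
    let ?z = "r *\<^sub>R dir \<theta>"
    obtain S where S: "0 \<le> S" "norm (flow ?z S - x i) = 1" "\<forall>t\<in>{0..<S}. \<forall>j\<in>{1..n}. norm (flow ?z t - x j) \<noteq> 1"
      using \<theta> unfolding attaches_iff by blast
    obtain T where T: "0 \<le> T" "norm (flow ?z T - x j) = 1" "\<forall>t\<in>{0..<T}. \<forall>j\<in>{1..n}. norm (flow ?z t - x j) \<noteq> 1"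
      using \<theta> unfolding attaches_iff by blast
    have "\<not> S < T" using T(3) S(1,2) ij(1) by auto
    moreover have "\<not> T < S" using S(3) T(1,2) ij(2) by auto
    ultimately have "S = T" by simp
    then show ?thesis using S T by (auto simp: Q_def P_def)
  qed
  have le: "\<theta> = \<theta>'" if E: "\<theta> \<in> ?E" "\<theta>' \<in> ?E" and eq: "flow (r *\<^sub>R dir \<theta>) S = flow (r *\<^sub>R dir \<theta>') T"
    and ST: "0 \<le> S" "S \<le> T" for \<theta> \<theta>' S T
  proof -
    have "flow (r *\<^sub>R dir \<theta>) S = flow (flow (r *\<^sub>R dir \<theta>') (T - S)) S"
      using eq ST by (simp add: flow_add)
    then have z: "r *\<^sub>R dir \<theta> = flow (r *\<^sub>R dir \<theta>') (T - S)" by (rule flow_inj[OF ST(1)])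
    have "T - S = 0"
    proof (rule ccontr)
      assume "T - S \<noteq> 0"
      then have "norm (flow (r *\<^sub>R dir \<theta>') (T - S)) < norm (r *\<^sub>R dir \<theta>')"
        by (intro norm_flow_less) (use ST r r0 in auto)
      then show False unfolding z[symmetric] by simp
    qed
    then have "dir \<theta> = dir \<theta>'" using z r0 by simp
    then show ?thesis using E by (intro inj_onD[OF dir_inj_on]) auto
  qed
  have uniq: "\<theta> = \<theta>'" if E: "\<theta> \<in> ?E" "\<theta>' \<in> ?E" "P \<theta> q" "P \<theta>' q" for \<theta> \<theta>' q
  proof -
    obtain S T where ST: "0 \<le> S" "0 \<le> T" "flow (r *\<^sub>R dir \<theta>) S = q" "flow (r *\<^sub>R dir \<theta>') T = q"
      using E(3,4) by (auto simp: P_def)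
    show ?thesis
    proof (cases "S \<le> T")
      case True
      then show ?thesis by (intro le[OF E(1,2) _ ST(1), where T=T]) (simp_all add: ST)
    next
      case False
      then show ?thesis by (intro le[OF E(2,1) _ ST(2), where T=S, symmetric]) (simp_all add: ST)
    qed
  qed
  have "\<forall>\<theta>\<in>?E. \<exists>q. q \<in> Q \<and> P \<theta> q" using ex by blast
  from bchoice[OF this] obtain g where g: "\<And>\<theta>. \<theta> \<in> ?E \<Longrightarrow> g \<theta> \<in> Q \<and> P \<theta> (g \<theta>)" by blast
  have "inj_on g ?E"
  proof (rule inj_onI)
    fix a b assume ab: "a \<in> ?E" "b \<in> ?E" "g a = g b"
    have "P a (g a)" "P b (g a)" using g[OF ab(1)] g[OF ab(2)] ab(3) by simp_all
    then show "a = b" by (rule uniq[OF ab(1,2)])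
  qed
  moreover have "g ` ?E \<subseteq> Q" using g by blast
  ultimately show ?thesis using Q by (rule inj_on_finite)
qed

definition attach_angles :: "real \<Rightarrow> nat \<Rightarrow> real set" where
  "attach_angles r i = {\<theta>. attaches \<alpha> n x (r *\<^sub>R dir \<theta>) i}"

lemma attach_angles_borel:
  assumes "i \<in> {1..n}"
  shows "attach_angles r i \<in> sets borel"
proof -
  have "continuous_on UNIV dir"
    unfolding dir_eq by (intro continuous_intros)
  then have "(\<lambda>\<theta>. r *\<^sub>R dir \<theta>) \<in> borel_measurable borel"
    by (intro borel_measurable_continuous_onI continuous_intros)
  from measurable_sets[OF this attaches_borel[OF assms]] show ?thesis
    by (simp add: attach_angles_def vimage_def)
qed

lemma attach_angles_periodic: "\<theta> + 2 * pi \<in> attach_angles r i \<longleftrightarrow> \<theta> \<in> attach_angles r i"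
  by (simp add: attach_angles_def dir_periodic)

text \<open>The attachment sets cover the circle up to the trapped angles and overlap only in the
  finitely many double attachments.\<close>

lemma sum_measure_attach_angles:
  assumes r: "extent + 1 < r" and neg: "negligible {\<theta> \<in> {0<..<2*pi}. r *\<^sub>R dir \<theta> \<in> trap r}"
  shows "(\<Sum>i=1..n. measure lebesgue (attach_angles r i \<inter> {0..<2*pi})) = 2 * pi"
proof -
  have r0: "0 < r" using r extent_nonneg by simp
  define E where "E i = attach_angles r i \<inter> {0..<2*pi}" for i
  have E: "E i \<in> lmeasurable" if "i \<in> {1..n}" for i
    unfolding E_def by (rule lmeasurable_Int_atLeastLessThan) (use attach_angles_borel[OF that] in simp)
  have "measure lebesgue (\<Union>(E ` {1..n})) = (\<Sum>i\<in>{1..n}. measure lebesgue (E i))"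
  proof (rule measure_negligible_finite_Union_image)
    show "pairwise (\<lambda>i j. negligible (E i \<inter> E j)) {1..n}"
      unfolding pairwise_def
    proof (intro ballI impI)
      fix i j assume ij: "i \<in> {1..n}" "j \<in> {1..n}" "i \<noteq> j"
      have "E i \<inter> E j = {\<theta> \<in> {0..<2*pi}. attaches \<alpha> n x (r *\<^sub>R dir \<theta>) i \<and> attaches \<alpha> n x (r *\<^sub>R dir \<theta>) j}"
        by (auto simp: E_def attach_angles_def)
      then show "negligible (E i \<inter> E j)"
        using finite_double_attachments[OF r ij] by (simp add: negligible_finite)
    qed
  qed (use E in auto)
  moreover have "measure lebesgue (\<Union>(E ` {1..n})) = measure lebesgue {0..<2*pi}"
  proof (rule measure_negligible_symdiff)
    \<comment> \<open>The angle 0 is added by hand because polar coordinates are cut along the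
      positive half-axis.\<close>
    have "{0..<2*pi} - \<Union>(E ` {1..n}) \<union> (\<Union>(E ` {1..n}) - {0..<2*pi})
        \<subseteq> insert 0 {\<theta> \<in> {0<..<2*pi}. r *\<^sub>R dir \<theta> \<in> trap r}"
    proof
      fix \<theta> assume "\<theta> \<in> {0..<2*pi} - \<Union>(E ` {1..n}) \<union> (\<Union>(E ` {1..n}) - {0..<2*pi})"
      then have \<theta>: "\<theta> \<in> {0..<2*pi}" "\<theta> \<notin> \<Union>(E ` {1..n})" by (auto simp: E_def)
      have "outside (r *\<^sub>R dir \<theta>)" by (rule outside_if_norm_gt) (use r r0 in simp)
      moreover have "norm (r *\<^sub>R dir \<theta>) \<le> r" using r0 by simp
      ultimately have "(\<exists>i\<in>{1..n}. attaches \<alpha> n x (r *\<^sub>R dir \<theta>) i) \<or> r *\<^sub>R dir \<theta> \<in> trap r"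
        by (rule attaches_or_trapped)
      then have "r *\<^sub>R dir \<theta> \<in> trap r" using \<theta> unfolding E_def attach_angles_def by blast
      then show "\<theta> \<in> insert 0 {\<theta> \<in> {0<..<2*pi}. r *\<^sub>R dir \<theta> \<in> trap r}" using \<theta> by auto
    qed
    then show "negligible ({0..<2*pi} - \<Union>(E ` {1..n}) \<union> (\<Union>(E ` {1..n}) - {0..<2*pi}))"
      by (rule negligible_subset[rotated]) (use neg in \<open>simp add: negligible_insert\<close>)
    show "{0..<2*pi} \<in> lmeasurable"
      using lmeasurable_Int_atLeastLessThan[of UNIV 0 "2*pi"] by simp
  qed
  ultimately show ?thesis by (simp add: E_def)
qed

text \<open>Countably many traps exhaust all radii, so a single null set serves every circle and
  Fubini is applied to it once.\<close>

lemma AE_sum_measure_attach_angles: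
  assumes P: "property_P \<alpha> n x"
  shows "AE r in lborel. extent + 1 < r \<longrightarrow>
    (\<Sum>i=1..n. measure lebesgue (attach_angles r i \<inter> {0..<2*pi})) = 2 * pi"
proof -
  have "negligible (\<Union>k::nat. trap (extent + 1 + real k))"
    by (rule negligible_countable_Union) (auto intro!: negligible_trap P)
  from negligible_circle_sections[OF this] show ?thesis
  proof eventually_elim
    case (elim r)
    show ?case
    proof
      assume r: "extent + 1 < r"
      then have r0: "0 < r" using extent_nonneg by simp
      obtain k :: nat where k: "r < real k" using reals_Archimedean2 by blast
      have "trap r \<subseteq> trap (extent + 1 + real k)" using k extent_nonneg by (auto simp: trap_def)
      then have "{\<theta> \<in> {0<..<2*pi}. r *\<^sub>R dir \<theta> \<in> trap r}
          \<subseteq> {\<theta> \<in> {0<..<2*pi}. r *\<^sub>R dir \<theta> \<in> (\<Union>k::nat. trap (extent + 1 + real k))}" by blast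
      with elim r0 have "negligible {\<theta> \<in> {0<..<2*pi}. r *\<^sub>R dir \<theta> \<in> trap r}"
        by (blast intro: negligible_subset)
      then show "(\<Sum>i=1..n. measure lebesgue (attach_angles r i \<inter> {0..<2*pi})) = 2 * pi"
        by (rule sum_measure_attach_angles[OF r])
    qed
  qed
qed

subsection \<open>The angular equation in the variable \<open>\<epsilon> = 1 / r\<close>\<close>

text \<open>Away from the cluster an orbit is a curve \<open>(1 / \<epsilon>) dir (\<phi> \<epsilon>)\<close> with
  \<open>\<phi>' = rate \<epsilon> \<phi>\<close>. The right-hand side extends smoothly to \<open>\<epsilon> = 0\<close>, so solutions can be
  started at infinity.\<close>

definition "radial j \<theta> = x j $ 1 * cos \<theta> + x j $ 2 * sin \<theta>"
definition "tangential j \<theta> = x j $ 2 * cos \<theta> - x j $ 1 * sin \<theta>"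
text \<open>The squared norm of \<open>dir \<theta> - \<epsilon> *\<^sub>R x j\<close>. Scaling the
  circle of radius 1/\<epsilon> to the unit circle removes the singularity at infinity: at
  \<open>\<epsilon> = 0\<close> this quantity is simply 1.\<close>

definition "sqdist j \<epsilon> \<theta> = 1 - 2 * \<epsilon> * radial j \<theta> + \<epsilon>\<^sup>2 * (norm (x j))\<^sup>2"
definition "weight j \<epsilon> \<theta> = sqdist j \<epsilon> \<theta> powr (- (\<alpha> + 2) / 2)"
definition "weight' j \<epsilon> \<theta> = (- (\<alpha> + 2) / 2) * sqdist j \<epsilon> \<theta> powr (- (\<alpha> + 2) / 2 - 1) * (- 2 * \<epsilon> * tangential j \<theta>)"
definition "tang_sum \<epsilon> \<theta> = (\<Sum>j=1..n. tangential j \<theta> * weight j \<epsilon> \<theta>)"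
definition "tang_sum' \<epsilon> \<theta> = (\<Sum>j=1..n. - radial j \<theta> * weight j \<epsilon> \<theta> + tangential j \<theta> * weight' j \<epsilon> \<theta>)"
definition "rad_sum \<epsilon> \<theta> = (\<Sum>j=1..n. (1 - \<epsilon> * radial j \<theta>) * weight j \<epsilon> \<theta>)"
definition "rad_sum' \<epsilon> \<theta> = (\<Sum>j=1..n. - \<epsilon> * tangential j \<theta> * weight j \<epsilon> \<theta> + (1 - \<epsilon> * radial j \<theta>) * weight' j \<epsilon> \<theta>)"
text \<open>Up to the factor \<open>- \<epsilon>\<close>, the ratio of the tangential to the radial
  part of \<open>field\<close>, in which the strength and the common power of \<epsilon> cancel. At
  \<open>\<epsilon> = 0\<close> it is the mean of the \<open>tangential j \<theta>\<close>.\<close>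

definition "rate \<epsilon> \<theta> = tang_sum \<epsilon> \<theta> / rad_sum \<epsilon> \<theta>"
definition "rate' \<epsilon> \<theta> = (tang_sum' \<epsilon> \<theta> * rad_sum \<epsilon> \<theta> - tang_sum \<epsilon> \<theta> * rad_sum' \<epsilon> \<theta>) / (rad_sum \<epsilon> \<theta> * rad_sum \<epsilon> \<theta>)"

lemmas rate_defs = radial_def tangential_def sqdist_def weight_def weight'_def tang_sum_def tang_sum'_def
  rad_sum_def rad_sum'_def rate_def rate'_def

text \<open>Circles of radius at least \<open>extent + 2\<close> lie outside all unit disks, and
  \<open>\<epsilon> * norm (x j) < 1\<close> holds there, which keeps \<open>sqdist\<close> and
  \<open>rad_sum\<close> positive.\<close>

definition eps0 :: real where "eps0 = 1 / (extent + 2)"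

lemma eps0_pos: "0 < eps0"
  using extent_nonneg by (simp add: eps0_def)

lemma radial_eq: "radial j \<theta> = x j \<bullet> dir \<theta>"
  by (simp add: radial_def inner_real2)

lemma eps_norm_less_1:
  assumes "0 \<le> \<epsilon>" "\<epsilon> \<le> eps0" "j \<in> {1..n}"
  shows "\<epsilon> * norm (x j) < 1"
proof -
  have "\<epsilon> * norm (x j) \<le> eps0 * extent"
    using assms norm_particle_le[OF assms(3)] eps0_pos by (intro mult_mono) auto
  also have "\<dots> < 1" using extent_nonneg by (simp add: eps0_def)
  finally show ?thesis .
qed

lemma eps_radial_less_1:
  assumes "0 \<le> \<epsilon>" "\<epsilon> \<le> eps0" "j \<in> {1..n}"
  shows "\<epsilon> * radial j \<theta> < 1"
proof -
  have "radial j \<theta> \<le> norm (x j) * norm (dir \<theta>)" unfolding radial_eq by (rule norm_cauchy_schwarz)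
  then have "\<epsilon> * radial j \<theta> \<le> \<epsilon> * norm (x j)" using assms(1) by (intro mult_left_mono) auto
  then show ?thesis using eps_norm_less_1[OF assms] by simp
qed

lemma norm_scaled_diff: "(norm (dir \<theta> - \<epsilon> *\<^sub>R x j))\<^sup>2 = sqdist j \<epsilon> \<theta>"
proof -
  have "(norm (dir \<theta> - \<epsilon> *\<^sub>R x j))\<^sup>2 = (norm (dir \<theta>))\<^sup>2 - 2 * \<epsilon> * (x j \<bullet> dir \<theta>) + \<epsilon>\<^sup>2 * (norm (x j))\<^sup>2"
    unfolding power2_norm_eq_inner
    by (simp add: inner_diff_left inner_diff_right inner_commute algebra_simps power2_eq_square)
  then show ?thesis by (simp add: sqdist_def radial_eq)
qed

lemma sqdist_pos:
  assumes "0 \<le> \<epsilon>" "\<epsilon> \<le> eps0" "j \<in> {1..n}"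
  shows "0 < sqdist j \<epsilon> \<theta>"
proof -
  have "norm (dir \<theta>) - norm (\<epsilon> *\<^sub>R x j) \<le> norm (dir \<theta> - \<epsilon> *\<^sub>R x j)" by (rule norm_triangle_ineq2)
  moreover have "norm (\<epsilon> *\<^sub>R x j) = \<epsilon> * norm (x j)" using assms(1) by simp
  ultimately have "0 < norm (dir \<theta> - \<epsilon> *\<^sub>R x j)"
    using eps_norm_less_1[OF assms] unfolding norm_dir by linarith
  then show ?thesis unfolding norm_scaled_diff[symmetric] by simp
qed

lemma weight_eq: "weight j \<epsilon> \<theta> = norm (dir \<theta> - \<epsilon> *\<^sub>R x j) powr (- \<alpha> - 2)"
proof -
  define N where "N = norm (dir \<theta> - \<epsilon> *\<^sub>R x j)"
  have "weight j \<epsilon> \<theta> = (N\<^sup>2) powr (- (\<alpha> + 2) / 2)" by (simp add: weight_def norm_scaled_diff N_def)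
  also have "\<dots> = N powr (- \<alpha> - 2)"
  proof (cases "N = 0")
    case False
    then have "N > 0" by (simp add: N_def)
    then have "(N\<^sup>2) powr (- (\<alpha> + 2) / 2) = (N powr 2) powr (- (\<alpha> + 2) / 2)" by simp
    also have "\<dots> = N powr (2 * (- (\<alpha> + 2) / 2))" by (rule powr_powr)
    also have "2 * (- (\<alpha> + 2) / 2) = - \<alpha> - 2" by simp
    finally show ?thesis .
  qed simp
  finally show ?thesis by (simp add: N_def)
qed

lemma rad_sum_pos:
  assumes "0 \<le> \<epsilon>" "\<epsilon> \<le> eps0"
  shows "0 < rad_sum \<epsilon> \<theta>"
  unfolding rad_sum_def
proof (rule sum_pos)
  fix j assume j: "j \<in> {1..n}"
  show "0 < (1 - \<epsilon> * radial j \<theta>) * weight j \<epsilon> \<theta>"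
    using eps_radial_less_1[OF assms j, of \<theta>] sqdist_pos[OF assms j, of \<theta>] by (simp add: weight_def)
qed (use n_pos in auto)

lemma rate_has_derivative:
  assumes \<epsilon>: "0 \<le> \<epsilon>" "\<epsilon> \<le> eps0"
  shows "(rate \<epsilon> has_real_derivative rate' \<epsilon> \<theta>) (at \<theta>)"
proof -
  have r: "(radial j has_real_derivative tangential j \<theta>) (at \<theta>)" for j
    unfolding radial_def[abs_def] tangential_def by (auto intro!: derivative_eq_intros)
  have t: "(tangential j has_real_derivative - radial j \<theta>) (at \<theta>)" for j
    unfolding radial_def tangential_def[abs_def] by (auto intro!: derivative_eq_intros)
  have s: "(sqdist j \<epsilon> has_real_derivative - 2 * \<epsilon> * tangential j \<theta>) (at \<theta>)" for j
    unfolding sqdist_def[abs_def] by (auto intro!: derivative_eq_intros r)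
  have w: "(weight j \<epsilon> has_real_derivative weight' j \<epsilon> \<theta>) (at \<theta>)" if j: "j \<in> {1..n}" for j
    unfolding weight_def[abs_def] weight'_def
    by (rule DERIV_chain2[OF _ s, of "\<lambda>u. u powr (- (\<alpha> + 2) / 2)"])
      (rule has_real_derivative_powr[OF sqdist_pos[OF \<epsilon> j]])
  have ts: "(tang_sum \<epsilon> has_real_derivative tang_sum' \<epsilon> \<theta>) (at \<theta>)"
    unfolding tang_sum_def[abs_def] tang_sum'_def
    by (rule DERIV_sum) (auto intro!: derivative_eq_intros t w)
  have rs: "(rad_sum \<epsilon> has_real_derivative rad_sum' \<epsilon> \<theta>) (at \<theta>)"
    unfolding rad_sum_def[abs_def] rad_sum'_def
    by (rule DERIV_sum) (auto intro!: derivative_eq_intros r w)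
  show ?thesis
    unfolding rate_def[abs_def] rate'_def
    by (rule DERIV_divide[OF ts rs]) (use rad_sum_pos[OF \<epsilon>, of \<theta>] in simp)
qed

lemma rate_continuous:
  "continuous_on ({0..eps0} \<times> UNIV) (\<lambda>(\<epsilon>, \<theta>). rate \<epsilon> \<theta>)"
  "continuous_on ({0..eps0} \<times> UNIV) (\<lambda>(\<epsilon>, \<theta>). rate' \<epsilon> \<theta>)"
proof -
  let ?S = "{0..eps0} \<times> (UNIV :: real set)"
  have r: "continuous_on ?S (\<lambda>p. radial j (snd p))" "continuous_on ?S (\<lambda>p. tangential j (snd p))" for j
    unfolding radial_def tangential_def by (intro continuous_intros)+
  have s: "continuous_on ?S (\<lambda>p. sqdist j (fst p) (snd p))" for j
    unfolding sqdist_def by (intro continuous_intros r)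
  have nz: "\<forall>p\<in>?S. sqdist j (fst p) (snd p) \<noteq> 0" if "j \<in> {1..n}" for j
  proof
    fix p assume "p \<in> ?S"
    then show "sqdist j (fst p) (snd p) \<noteq> 0"
      using sqdist_pos[of "fst p" j "snd p"] that by (simp add: mem_Times_iff)
  qed
  have w: "continuous_on ?S (\<lambda>p. weight j (fst p) (snd p))" "continuous_on ?S (\<lambda>p. weight' j (fst p) (snd p))"
    if j: "j \<in> {1..n}" for j
    unfolding weight_def weight'_def by (intro continuous_intros r s nz[OF j])+
  have ts: "continuous_on ?S (\<lambda>p. tang_sum (fst p) (snd p))" "continuous_on ?S (\<lambda>p. tang_sum' (fst p) (snd p))"
    unfolding tang_sum_def tang_sum'_def by (intro continuous_intros r w; assumption)+
  have rs: "continuous_on ?S (\<lambda>p. rad_sum (fst p) (snd p))" "continuous_on ?S (\<lambda>p. rad_sum' (fst p) (snd p))"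
    unfolding rad_sum_def rad_sum'_def by (intro continuous_intros r w; assumption)+
  have nz': "\<forall>p\<in>?S. rad_sum (fst p) (snd p) \<noteq> 0"
  proof
    fix p assume "p \<in> ?S"
    then show "rad_sum (fst p) (snd p) \<noteq> 0"
      using rad_sum_pos[of "fst p" "snd p"] by (simp add: mem_Times_iff)
  qed
  then have nz2: "\<forall>p\<in>?S. rad_sum (fst p) (snd p) * rad_sum (fst p) (snd p) \<noteq> 0" by simp
  show "continuous_on ?S (\<lambda>(\<epsilon>, \<theta>). rate \<epsilon> \<theta>)"
    unfolding rate_def case_prod_unfold by (intro continuous_on_divide ts rs nz')
  show "continuous_on ?S (\<lambda>(\<epsilon>, \<theta>). rate' \<epsilon> \<theta>)"
    unfolding rate'_def case_prod_unfold
    by (intro continuous_on_divide continuous_on_diff continuous_on_mult ts rs nz2)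
qed

text \<open>Both functions depend on \<theta> through its sine and cosine only, so continuity on the
  compact rectangle over one period gives bounds for all angles.\<close>

lemma rate_bounds_exist:
  "\<exists>C. \<forall>\<epsilon>\<in>{0..eps0}. \<forall>\<theta>. \<bar>rate \<epsilon> \<theta>\<bar> \<le> C \<and> \<bar>rate' \<epsilon> \<theta>\<bar> \<le> C"
proof -
  let ?K = "{0..eps0} \<times> {0..2*pi}"
  have K: "compact ?K" by (intro compact_Times compact_Icc)
  have c: "continuous_on ?K (\<lambda>(\<epsilon>, \<theta>). rate \<epsilon> \<theta>)" "continuous_on ?K (\<lambda>(\<epsilon>, \<theta>). rate' \<epsilon> \<theta>)"
    by (rule continuous_on_subset[OF rate_continuous(1)], blast) (rule continuous_on_subset[OF rate_continuous(2)], blast)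
  obtain C1 where C1: "\<And>p. p \<in> ?K \<Longrightarrow> \<bar>case p of (\<epsilon>, \<theta>) \<Rightarrow> rate \<epsilon> \<theta>\<bar> \<le> C1"
    using compact_imp_bounded[OF compact_continuous_image[OF c(1) K]] unfolding bounded_iff by (metis image_eqI real_norm_def)
  obtain C2 where C2: "\<And>p. p \<in> ?K \<Longrightarrow> \<bar>case p of (\<epsilon>, \<theta>) \<Rightarrow> rate' \<epsilon> \<theta>\<bar> \<le> C2"
    using compact_imp_bounded[OF compact_continuous_image[OF c(2) K]] unfolding bounded_iff by (metis image_eqI real_norm_def)
  have "\<bar>rate \<epsilon> \<theta>\<bar> \<le> max C1 C2 \<and> \<bar>rate' \<epsilon> \<theta>\<bar> \<le> max C1 C2" if \<epsilon>: "\<epsilon> \<in> {0..eps0}" for \<epsilon> \<theta>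
  proof -
    obtain \<theta>' where \<theta>': "0 \<le> \<theta>'" "\<theta>' < 2 * pi" "cos \<theta> = cos \<theta>'" "sin \<theta> = sin \<theta>'"
      by (rule sincos_total_2pi[of "cos \<theta>" "sin \<theta>"]) (auto simp: add.commute)
    have "rate \<epsilon> \<theta> = rate \<epsilon> \<theta>'" "rate' \<epsilon> \<theta> = rate' \<epsilon> \<theta>'"
      unfolding rate_defs \<theta>' by simp_all
    moreover have "(\<epsilon>, \<theta>') \<in> ?K" using \<epsilon> \<theta>' by auto
    ultimately show ?thesis using C1[of "(\<epsilon>, \<theta>')"] C2[of "(\<epsilon>, \<theta>')"] by auto
  qed
  then show ?thesis by blast
qed

definition bound :: real where
  "bound = (SOME C. \<forall>\<epsilon>\<in>{0..eps0}. \<forall>\<theta>. \<bar>rate \<epsilon> \<theta>\<bar> \<le> C \<and> \<bar>rate' \<epsilon> \<theta>\<bar> \<le> C)"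

lemma rate_bounds:
  assumes "0 \<le> \<epsilon>" "\<epsilon> \<le> eps0"
  shows "\<bar>rate \<epsilon> \<theta>\<bar> \<le> bound" "\<bar>rate' \<epsilon> \<theta>\<bar> \<le> bound"
  using someI_ex[OF rate_bounds_exist] assms unfolding bound_def by auto

lemma rate_lipschitz:
  assumes "0 \<le> \<epsilon>" "\<epsilon> \<le> eps0"
  shows "\<bar>rate \<epsilon> s - rate \<epsilon> t\<bar> \<le> bound * \<bar>s - t\<bar>"
proof -
  have "norm (rate \<epsilon> s - rate \<epsilon> t) \<le> bound * norm (s - t)"
    by (rule field_differentiable_bound[where S=UNIV and f'="rate' \<epsilon>"])
      (use rate_has_derivative[OF assms] rate_bounds[OF assms] in auto)
  then show ?thesis by simp
qed

text \<open>Freezing \<epsilon> outside \<open>{0..eps0}\<close> makes the right-hand side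
  continuous, bounded and Lipschitz at all times, as \<open>ode_solution_exists\<close>
  requires.\<close>

definition clamp :: "real \<Rightarrow> real" where "clamp t = max 0 (min eps0 t)"

lemma clamp_mem: "0 \<le> clamp t" "clamp t \<le> eps0"
  using eps0_pos by (auto simp: clamp_def)

lemma clamp_id: "t \<in> {0..eps0} \<Longrightarrow> clamp t = t"
  by (auto simp: clamp_def)

text \<open>For small positive \<epsilon>, \<open>angle \<theta> \<epsilon>\<close> is the angle at
  which the orbit arriving from direction \<theta> at infinity crosses the circle of radius
  1/\<epsilon>.\<close>

definition angle :: "real \<Rightarrow> real \<Rightarrow> real" where
  "angle \<theta> = (SOME u. u 0 = \<theta> \<and> (\<forall>t\<ge>0. (u has_vector_derivative rate (clamp t) (u t)) (at t within {0..})))"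

lemma angle_exists:
  "angle \<theta> 0 = \<theta> \<and> (\<forall>t\<ge>0. (angle \<theta> has_vector_derivative rate (clamp t) (angle \<theta> t)) (at t within {0..}))"
  unfolding angle_def
proof (rule someI_ex[where P="\<lambda>u. u 0 = \<theta> \<and> (\<forall>t\<ge>0. (u has_vector_derivative rate (clamp t) (u t)) (at t within {0..}))"])
  have "continuous_on UNIV (\<lambda>p :: real \<times> real. (clamp (fst p), snd p))"
    unfolding clamp_def by (intro continuous_intros)
  moreover have "range (\<lambda>p :: real \<times> real. (clamp (fst p), snd p)) \<subseteq> {0..eps0} \<times> UNIV"
    using clamp_mem by auto
  ultimately have "continuous_on UNIV (\<lambda>p. case (clamp (fst p), snd p) of (\<epsilon>, \<theta>) \<Rightarrow> rate \<epsilon> \<theta>)"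
    by (rule continuous_on_compose2[OF rate_continuous(1)])
  then have c: "continuous_on UNIV (\<lambda>(t, y). rate (clamp t) y)"
    by (simp add: case_prod_unfold)
  have b: "norm (rate (clamp t) y) \<le> bound" for t y
    using rate_bounds(1)[OF clamp_mem] by simp
  have l: "norm (rate (clamp t) y - rate (clamp t) z) \<le> bound * norm (y - z)" for t y z
    using rate_lipschitz[OF clamp_mem] by simp
  show "\<exists>u. u 0 = \<theta> \<and> (\<forall>t\<ge>0. (u has_vector_derivative rate (clamp t) (u t)) (at t within {0..}))"
    using ode_solution_exists[OF c b l, of \<theta>] by metis
qed

lemma angle_0 [simp]: "angle \<theta> 0 = \<theta>"
  using angle_exists by blast

lemma angle_deriv:
  assumes "t \<in> {0..eps0}" "S \<subseteq> {0..}"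
  shows "(angle \<theta> has_vector_derivative rate t (angle \<theta> t)) (at t within S)"
proof -
  have "(angle \<theta> has_vector_derivative rate (clamp t) (angle \<theta> t)) (at t within {0..})"
    using angle_exists assms(1) by auto
  then show ?thesis
    unfolding clamp_id[OF assms(1)] by (rule has_vector_derivative_within_subset) (rule assms(2))
qed

text \<open>The factor tends to 1 with \<epsilon>: on large circles the angle map hardly distorts
  lengths, which is what makes the attachment probabilities converge.\<close>

lemma angle_dist:
  assumes \<epsilon>: "\<epsilon> \<in> {0..eps0}"
  shows "\<bar>angle s \<epsilon> - angle t \<epsilon>\<bar> \<le> exp (bound * \<epsilon>) * \<bar>s - t\<bar>"
    and "\<bar>s - t\<bar> \<le> exp (bound * \<epsilon>) * \<bar>angle s \<epsilon> - angle t \<epsilon>\<bar>"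
proof -
  have d: "(angle w has_vector_derivative rate r (angle w r)) (at r within {0..\<epsilon>})" if "r \<in> {0..\<epsilon>}" for w r
    by (rule angle_deriv) (use that \<epsilon> in auto)
  have l: "norm (rate r y - rate r z) \<le> bound * norm (y - z)" if "r \<in> {0..\<epsilon>}" for r y z
    using rate_lipschitz[of r y z] that \<epsilon> by simp
  have "0 \<le> \<epsilon>" using \<epsilon> by simp
  note b = ode_dist_bounds[OF this d d l]
  show "\<bar>angle s \<epsilon> - angle t \<epsilon>\<bar> \<le> exp (bound * \<epsilon>) * \<bar>s - t\<bar>" using b(1)[of s t] by simp
  show "\<bar>s - t\<bar> \<le> exp (bound * \<epsilon>) * \<bar>angle s \<epsilon> - angle t \<epsilon>\<bar>" using b(2)[of s t] by simp
qed

lemma rate_periodic: "rate \<epsilon> (\<theta> + 2 * pi) = rate \<epsilon> \<theta>"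
  unfolding rate_defs by simp

lemma angle_equivariant:
  assumes \<epsilon>: "\<epsilon> \<in> {0..eps0}"
  shows "angle (\<theta> + 2 * pi) \<epsilon> = angle \<theta> \<epsilon> + 2 * pi"
proof -
  have "norm (angle (\<theta> + 2 * pi) \<epsilon> - (angle \<theta> \<epsilon> + 2 * pi))
      \<le> exp (bound * (\<epsilon> - 0)) * norm (angle (\<theta> + 2 * pi) 0 - (angle \<theta> 0 + 2 * pi))"
  proof (rule ode_dist_bounds(1)[where f=rate])
    fix r assume r: "r \<in> {0..\<epsilon>}"
    show "(angle (\<theta> + 2 * pi) has_vector_derivative rate r (angle (\<theta> + 2 * pi) r)) (at r within {0..\<epsilon>})"
      by (rule angle_deriv) (use r \<epsilon> in auto)
    have "(angle \<theta> has_vector_derivative rate r (angle \<theta> r)) (at r within {0..\<epsilon>})"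
      by (rule angle_deriv) (use r \<epsilon> in auto)
    then have "((\<lambda>r. angle \<theta> r + 2 * pi) has_vector_derivative rate r (angle \<theta> r) + 0) (at r within {0..\<epsilon>})"
      by (intro has_vector_derivative_add has_vector_derivative_const)
    then show "((\<lambda>r. angle \<theta> r + 2 * pi) has_vector_derivative rate r (angle \<theta> r + 2 * pi)) (at r within {0..\<epsilon>})"
      by (simp add: rate_periodic)
    show "norm (rate r y - rate r z) \<le> bound * norm (y - z)" for y z
      using rate_lipschitz[of r y z] r \<epsilon> by simp
  qed (use \<epsilon> in auto)
  then show ?thesis by simp
qed

definition orbit :: "real \<Rightarrow> real \<Rightarrow> real^2" where
  "orbit \<theta> \<epsilon> = (1 / \<epsilon>) *\<^sub>R dir (angle \<theta> \<epsilon>)"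

text \<open>Each difference to a particle is resolved along \<open>dir \<theta>\<close> and
  \<open>dir' \<theta>\<close>. The power of \<epsilon> is
  \<open>(1 / \<epsilon>) powr (- \<alpha> - 2)\<close> times the factor 1/\<epsilon> of the vector
  itself.\<close>

lemma field_far:
  assumes \<epsilon>: "0 < \<epsilon>" "\<epsilon> \<le> eps0"
  shows "field ((1 / \<epsilon>) *\<^sub>R dir \<theta>) =
    - (strength * \<epsilon> powr (\<alpha> + 1)) *\<^sub>R (rad_sum \<epsilon> \<theta> *\<^sub>R dir \<theta> - (\<epsilon> * tang_sum \<epsilon> \<theta>) *\<^sub>R dir' \<theta>)"
proof -
  let ?y = "(1 / \<epsilon>) *\<^sub>R dir \<theta>"
  have summand: "cut_force \<alpha> (?y - x j) = \<epsilon> powr (\<alpha> + 1) *\<^sub>R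
      (((1 - \<epsilon> * radial j \<theta>) * weight j \<epsilon> \<theta>) *\<^sub>R dir \<theta> - (\<epsilon> * (tangential j \<theta> * weight j \<epsilon> \<theta>)) *\<^sub>R dir' \<theta>)"
    if j: "j \<in> {1..n}" for j
  proof -
    define d where "d = dir \<theta> - \<epsilon> *\<^sub>R x j"
    have y: "?y - x j = (1 / \<epsilon>) *\<^sub>R d" using \<epsilon> by (simp add: d_def algebra_simps)
    have "extent + 2 \<le> 1 / \<epsilon>" using \<epsilon> extent_nonneg by (simp add: eps0_def field_simps)
    then have "1/2 \<le> norm (?y - x j)"
      using norm_triangle_ineq2[of ?y "x j"] norm_particle_le[OF j] \<epsilon> by simp
    then have mx: "max (1/2) (norm (?y - x j)) = (1 / \<epsilon>) * norm d" using \<epsilon> unfolding y by simp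
    have d: "d = (1 - \<epsilon> * radial j \<theta>) *\<^sub>R dir \<theta> - (\<epsilon> * tangential j \<theta>) *\<^sub>R dir' \<theta>"
    proof -
      have sq: "(cos \<theta>)\<^sup>2 + (sin \<theta>)\<^sup>2 = 1" by simp
      have "cos \<theta> - \<epsilon> * x j $ 1 = (1 - \<epsilon> * radial j \<theta>) * cos \<theta> - \<epsilon> * tangential j \<theta> * (- sin \<theta>)"
        unfolding radial_def tangential_def using sq by algebra
      moreover have "sin \<theta> - \<epsilon> * x j $ 2 = (1 - \<epsilon> * radial j \<theta>) * sin \<theta> - \<epsilon> * tangential j \<theta> * cos \<theta>"
        unfolding radial_def tangential_def using sq by algebra
      ultimately show ?thesis
        unfolding d_def vec2_eq_iff dir'_def by (simp add: axis_def)
    qed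
    have "cut_force \<alpha> (?y - x j) = ((1 / \<epsilon>) * norm d) powr (- \<alpha> - 2) *\<^sub>R ((1 / \<epsilon>) *\<^sub>R d)"
      unfolding cut_force_def mx unfolding y ..
    also have "((1 / \<epsilon>) * norm d) powr (- \<alpha> - 2) = (1 / \<epsilon>) powr (- \<alpha> - 2) * weight j \<epsilon> \<theta>"
      unfolding weight_eq d_def by (rule powr_mult)
    also have "(1 / \<epsilon>) powr (- \<alpha> - 2) = \<epsilon> powr (\<alpha> + 2)"
      using \<epsilon> by (simp add: powr_divide powr_minus_divide[symmetric] add.commute)
    also have "\<epsilon> powr (\<alpha> + 2) = \<epsilon> powr (\<alpha> + 1) * \<epsilon>"
      using \<epsilon> powr_add[of \<epsilon> "\<alpha> + 1" 1] by (simp add: add.assoc)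
    finally have "cut_force \<alpha> (?y - x j) = \<epsilon> powr (\<alpha> + 1) *\<^sub>R (weight j \<epsilon> \<theta> *\<^sub>R d)"
      using \<epsilon> by simp
    also have "weight j \<epsilon> \<theta> *\<^sub>R d = ((1 - \<epsilon> * radial j \<theta>) * weight j \<epsilon> \<theta>) *\<^sub>R dir \<theta>
        - (\<epsilon> * (tangential j \<theta> * weight j \<epsilon> \<theta>)) *\<^sub>R dir' \<theta>"
      unfolding d by (simp add: scaleR_diff_right mult_ac)
    finally show ?thesis .
  qed
  have "(\<Sum>j=1..n. cut_force \<alpha> (?y - x j)) = (\<Sum>j=1..n. \<epsilon> powr (\<alpha> + 1) *\<^sub>R
      (((1 - \<epsilon> * radial j \<theta>) * weight j \<epsilon> \<theta>) *\<^sub>R dir \<theta> - (\<epsilon> * (tangential j \<theta> * weight j \<epsilon> \<theta>)) *\<^sub>R dir' \<theta>))"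
    by (rule sum.cong[OF refl summand])
  also have "\<dots> = \<epsilon> powr (\<alpha> + 1) *\<^sub>R (rad_sum \<epsilon> \<theta> *\<^sub>R dir \<theta> - (\<epsilon> * tang_sum \<epsilon> \<theta>) *\<^sub>R dir' \<theta>)"
    by (simp only: rad_sum_def tang_sum_def scaleR_sum_right[symmetric] sum_subtractf scaleR_sum_left[symmetric] sum_distrib_left[symmetric])
  finally show ?thesis by (simp add: field_def)
qed

text \<open>The derivative of time with respect to \<epsilon> along an orbit: the radius changes by
  \<open>- 1 / \<epsilon>\<^sup>2\<close> per unit of \<epsilon> and by \<open>- strength *
  \<epsilon> powr (\<alpha> + 1) * rad_sum \<epsilon> (angle \<theta> \<epsilon>)\<close> per unit
  of time.\<close>

definition time_factor :: "real \<Rightarrow> real \<Rightarrow> real" where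
  "time_factor \<theta> \<epsilon> = 1 / (strength * \<epsilon> powr (\<alpha> + 3) * rad_sum \<epsilon> (angle \<theta> \<epsilon>))"

lemma orbit_deriv:
  assumes \<epsilon>: "0 < \<epsilon>" "\<epsilon> \<le> eps0" and S: "S \<subseteq> {0..}"
  shows "(orbit \<theta> has_vector_derivative time_factor \<theta> \<epsilon> *\<^sub>R field (orbit \<theta> \<epsilon>)) (at \<epsilon> within S)"
proof -
  let ?\<phi> = "angle \<theta> \<epsilon>"
  have "(angle \<theta> has_vector_derivative rate \<epsilon> ?\<phi>) (at \<epsilon> within S)"
    by (rule angle_deriv) (use \<epsilon> S in auto)
  then have "((dir \<circ> angle \<theta>) has_vector_derivative rate \<epsilon> ?\<phi> *\<^sub>R dir' ?\<phi>) (at \<epsilon> within S)"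
    by (rule vector_diff_chain_within) (rule dir_has_derivative)
  moreover have "((\<lambda>\<epsilon>. 1 / \<epsilon>) has_real_derivative - (1 / \<epsilon>\<^sup>2)) (at \<epsilon> within S)"
    using \<epsilon> by (auto intro!: derivative_eq_intros simp: power2_eq_square)
  ultimately have "(orbit \<theta> has_vector_derivative
      (1 / \<epsilon>) *\<^sub>R (rate \<epsilon> ?\<phi> *\<^sub>R dir' ?\<phi>) + (- (1 / \<epsilon>\<^sup>2)) *\<^sub>R dir ?\<phi>) (at \<epsilon> within S)"
    unfolding orbit_def[abs_def] o_def by (intro has_vector_derivative_scaleR)
  moreover have "(1 / \<epsilon>) *\<^sub>R (rate \<epsilon> ?\<phi> *\<^sub>R dir' ?\<phi>) + (- (1 / \<epsilon>\<^sup>2)) *\<^sub>R dir ?\<phi> = time_factor \<theta> \<epsilon> *\<^sub>R field (orbit \<theta> \<epsilon>)"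
  proof -
    have "\<epsilon> powr (\<alpha> + 3) = \<epsilon> powr (\<alpha> + 1 + 2)" by (simp add: add.assoc)
    also have "\<dots> = \<epsilon> powr (\<alpha> + 1) * \<epsilon> powr 2" by (rule powr_add)
    finally have p: "\<epsilon> powr (\<alpha> + 3) = \<epsilon> powr (\<alpha> + 1) * \<epsilon>\<^sup>2" using \<epsilon> by simp
    have D: "rad_sum \<epsilon> ?\<phi> > 0" by (rule rad_sum_pos) (use \<epsilon> in auto)
    have k: "time_factor \<theta> \<epsilon> * (strength * \<epsilon> powr (\<alpha> + 1)) = 1 / (\<epsilon>\<^sup>2 * rad_sum \<epsilon> ?\<phi>)"
      unfolding time_factor_def p using \<epsilon> strength_pos D by (simp add: field_simps)
    have "time_factor \<theta> \<epsilon> *\<^sub>R field (orbit \<theta> \<epsilon>)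
        = - (1 / (\<epsilon>\<^sup>2 * rad_sum \<epsilon> ?\<phi>)) *\<^sub>R (rad_sum \<epsilon> ?\<phi> *\<^sub>R dir ?\<phi> - (\<epsilon> * tang_sum \<epsilon> ?\<phi>) *\<^sub>R dir' ?\<phi>)"
      unfolding orbit_def field_far[OF \<epsilon>] scaleR_scaleR mult_minus_right k by simp
    also have "\<dots> = (1 / \<epsilon>) *\<^sub>R (rate \<epsilon> ?\<phi> *\<^sub>R dir' ?\<phi>) + (- (1 / \<epsilon>\<^sup>2)) *\<^sub>R dir ?\<phi>"
      using \<epsilon> D by (simp add: rate_def scaleR_diff_right power2_eq_square field_simps)
    finally show ?thesis by simp
  qed
  ultimately show ?thesis by simp
qed

lemma norm_orbit: "0 < \<epsilon> \<Longrightarrow> norm (orbit \<theta> \<epsilon>) = 1 / \<epsilon>"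
  by (simp add: orbit_def)

text \<open>Integrating \<open>time_factor\<close> from \<open>a\<close> converts \<epsilon> into
  time; the integral diverges at \<epsilon> = 0, hence \<open>0 < a\<close>. The orbit and the
  reparametrised flow solve the same equation in \<epsilon> and agree at \<open>a\<close>.\<close>

lemma orbit_is_flow:
  assumes ab: "0 < a" "a \<le> b" "b \<le> eps0"
  obtains T where "0 \<le> T" "orbit \<theta> b = flow (orbit \<theta> a) T"
    and "\<And>t. t \<in> {0..T} \<Longrightarrow> outside (flow (orbit \<theta> a) t)"
proof -
  define k where "k = time_factor \<theta>"
  have ac: "continuous_on {a..b} (angle \<theta>)"
    by (rule continuous_on_vector_derivative[OF angle_deriv]) (use ab in auto)
  have "continuous_on {a..b} (\<lambda>\<epsilon>. rad_sum \<epsilon> (angle \<theta> \<epsilon>))"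
  proof -
    have "continuous_on {a..b} (\<lambda>\<epsilon>. sqdist j \<epsilon> (angle \<theta> \<epsilon>))" for j
      unfolding sqdist_def radial_def by (intro continuous_intros ac)
    moreover have "\<forall>\<epsilon>\<in>{a..b}. sqdist j \<epsilon> (angle \<theta> \<epsilon>) \<noteq> 0" if "j \<in> {1..n}" for j
    proof
      fix \<epsilon> assume "\<epsilon> \<in> {a..b}"
      then show "sqdist j \<epsilon> (angle \<theta> \<epsilon>) \<noteq> 0"
        using sqdist_pos[of \<epsilon> j "angle \<theta> \<epsilon>"] ab that by simp
    qed
    ultimately have "continuous_on {a..b} (\<lambda>\<epsilon>. weight j \<epsilon> (angle \<theta> \<epsilon>))" if "j \<in> {1..n}" for j
      unfolding weight_def using that by (intro continuous_intros) auto
    then show ?thesis unfolding rad_sum_def radial_def by (intro continuous_intros ac) auto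
  qed
  moreover have D: "rad_sum \<epsilon> (angle \<theta> \<epsilon>) > 0" if "\<epsilon> \<in> {a..b}" for \<epsilon>
    by (rule rad_sum_pos) (use that ab in auto)
  ultimately have kc: "continuous_on {a..b} k"
    unfolding k_def time_factor_def[abs_def] using ab strength_pos
    by (intro continuous_intros) (auto simp: less_imp_neq[symmetric] dest: D)
  have k0: "0 \<le> k \<epsilon>" if "\<epsilon> \<in> {a..b}" for \<epsilon>
    using D[OF that] strength_pos by (simp add: k_def time_factor_def)
  obtain M where "\<forall>y\<in>k ` {a..b}. norm y \<le> M"
    using compact_imp_bounded[OF compact_continuous_image[OF kc compact_Icc]] unfolding bounded_iff by blast
  then have M: "\<bar>k \<epsilon>\<bar> \<le> M" if "\<epsilon> \<in> {a..b}" for \<epsilon>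
    using that by simp
  define \<tau> where "\<tau> \<epsilon> = integral {a..\<epsilon>} k" for \<epsilon>
  have \<tau>0: "\<tau> a = 0" by (simp add: \<tau>_def)
  have \<tau>nn: "0 \<le> \<tau> \<epsilon>" if "\<epsilon> \<in> {a..b}" for \<epsilon>
    unfolding \<tau>_def
    by (rule integral_nonneg) (use that k0 in \<open>auto intro!: integrable_continuous_real continuous_on_subset[OF kc]\<close>)
  have \<tau>d: "(\<tau> has_vector_derivative k \<epsilon>) (at \<epsilon> within {a..b})" if "\<epsilon> \<in> {a..b}" for \<epsilon>
    unfolding \<tau>_def by (rule integral_has_vector_derivative[OF kc that])
  define z where "z = orbit \<theta> a"
  have eq: "orbit \<theta> \<epsilon> = flow z (\<tau> \<epsilon>)" if \<epsilon>: "\<epsilon> \<in> {a..b}" for \<epsilon>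
  proof -
    have "norm (orbit \<theta> \<epsilon> - (flow z \<circ> \<tau>) \<epsilon>) \<le> exp (M * lip * (\<epsilon> - a)) * norm (orbit \<theta> a - (flow z \<circ> \<tau>) a)"
    proof (rule ode_dist_bounds(1)[where f="\<lambda>r y. k r *\<^sub>R field y"])
      fix r assume r: "r \<in> {a..\<epsilon>}"
      then have r': "r \<in> {a..b}" "{a..\<epsilon>} \<subseteq> {a..b}" using \<epsilon> by auto
      show "(orbit \<theta> has_vector_derivative k r *\<^sub>R field (orbit \<theta> r)) (at r within {a..\<epsilon>})"
        unfolding k_def by (rule orbit_deriv) (use r' ab in auto)
      show "((flow z \<circ> \<tau>) has_vector_derivative k r *\<^sub>R field ((flow z \<circ> \<tau>) r)) (at r within {a..\<epsilon>})"
      proof (rule vector_diff_chain_within)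
        show "(\<tau> has_vector_derivative k r) (at r within {a..\<epsilon>})"
          by (rule has_vector_derivative_within_subset[OF \<tau>d[OF r'(1)] r'(2)])
        show "(flow z has_vector_derivative field ((flow z \<circ> \<tau>) r)) (at (\<tau> r) within \<tau> ` {a..\<epsilon>})"
          unfolding o_def by (rule flow_deriv) (use r' \<tau>nn in auto)
      qed
      fix y w
      have "norm (k r *\<^sub>R field y - k r *\<^sub>R field w) = \<bar>k r\<bar> * norm (field y - field w)"
        by (simp flip: scaleR_diff_right)
      also have "\<dots> \<le> M * (lip * norm (y - w))"
        using M[OF r'(1)] by (intro mult_mono field_lipschitz) auto
      finally show "norm (k r *\<^sub>R field y - k r *\<^sub>R field w) \<le> M * lip * norm (y - w)"
        by (simp add: mult.assoc)
    qed (use \<epsilon> in auto)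
    then show ?thesis by (simp add: \<tau>0 z_def)
  qed
  show ?thesis
  proof (rule that[of "\<tau> b"])
    show "0 \<le> \<tau> b" using \<tau>nn ab by simp
    show "orbit \<theta> b = flow (orbit \<theta> a) (\<tau> b)" using eq[of b] ab by (simp add: z_def)
    fix t assume t: "t \<in> {0..\<tau> b}"
    \<comment> \<open>Every time in between corresponds to some \<epsilon>, where the norm
      1/\<epsilon> shows that the orbit is outside the disks.\<close>
    have "continuous_on {a..b} \<tau>"
      by (rule continuous_on_vector_derivative[OF \<tau>d])
    then obtain \<epsilon> where \<epsilon>: "\<epsilon> \<in> {a..b}" "\<tau> \<epsilon> = t"
      using IVT'[of \<tau> a t b] t ab \<tau>0 by auto
    have "extent + 2 \<le> 1 / \<epsilon>" using \<epsilon> ab extent_nonneg by (simp add: eps0_def field_simps) (smt (verit) mult_right_mono)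
    then have "outside (orbit \<theta> \<epsilon>)"
      by (intro outside_if_norm_gt) (use \<epsilon> ab in \<open>simp add: norm_orbit\<close>)
    then show "outside (flow (orbit \<theta> a) t)" using eq[OF \<epsilon>(1)] \<epsilon>(2) by (simp add: z_def)
  qed
qed

text \<open>Which particle is reached depends on the orbit, not on the circle where it is started:
  as a set of directions at infinity, the attachment set is the same for all large radii.\<close>

lemma angle_mem_attach_angles:
  assumes \<epsilon>: "0 < \<epsilon>" "\<epsilon> \<le> eps0" and i: "i \<in> {1..n}"
  shows "angle \<theta> \<epsilon> \<in> attach_angles (1 / \<epsilon>) i \<longleftrightarrow> angle \<theta> eps0 \<in> attach_angles (1 / eps0) i"
proof -
  obtain T where T: "0 \<le> T" "orbit \<theta> eps0 = flow (orbit \<theta> \<epsilon>) T"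
      "\<And>t. t \<in> {0..T} \<Longrightarrow> outside (flow (orbit \<theta> \<epsilon>) t)"
    using orbit_is_flow[OF \<epsilon> order_refl, of \<theta>] by metis
  have "attaches \<alpha> n x (orbit \<theta> eps0) i \<longleftrightarrow> attaches \<alpha> n x (orbit \<theta> \<epsilon>) i"
    unfolding T(2) by (rule attaches_flow_iff[OF T(1,3) i])
  then show ?thesis by (simp add: attach_angles_def orbit_def)
qed

section \<open>Limits of the attachment probabilities and their sum\<close>

definition limit_measure :: "nat \<Rightarrow> real" where
  "limit_measure i = measure lebesgue ((\<lambda>\<theta>. angle \<theta> eps0) -` attach_angles (1 / eps0) i \<inter> {0..<2*pi})"

text \<open>By \<open>angle_mem_attach_angles\<close> the angle map at 1/r pulls the attachment set
  back to the set measured by \<open>limit_measure\<close>, so both bounds come from its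
  bi-Lipschitz constant.\<close>

lemma measure_attach_angles_bounds:
  assumes r: "1 / eps0 \<le> r" and i: "i \<in> {1..n}"
  shows "measure lebesgue (attach_angles r i \<inter> {0..<2*pi}) \<le> exp (bound / r) * limit_measure i"
    and "limit_measure i \<le> exp (bound / r) * measure lebesgue (attach_angles r i \<inter> {0..<2*pi})"
proof -
  have r0: "0 < r" using r eps0_pos by (smt (verit) divide_pos_pos)
  define \<epsilon> where "\<epsilon> = 1 / r"
  have \<epsilon>: "0 < \<epsilon>" "\<epsilon> \<le> eps0" "r = 1 / \<epsilon>" using r0 r eps0_pos by (auto simp: \<epsilon>_def field_simps)
  have \<epsilon>': "\<epsilon> \<in> {0..eps0}" using \<epsilon> by simp
  have vim: "(\<lambda>\<theta>. angle \<theta> \<epsilon>) -` attach_angles r i = (\<lambda>\<theta>. angle \<theta> eps0) -` attach_angles (1 / eps0) i"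
    using angle_mem_attach_angles[OF \<epsilon>(1,2) i] by (auto simp: \<epsilon>(3))
  have p: "0 < 2 * pi" by simp
  note b = measure_bilipschitz_equivariant[where f="\<lambda>\<theta>. angle \<theta> \<epsilon>", OF angle_dist[OF \<epsilon>'] angle_equivariant[OF \<epsilon>']
      p exp_ge_zero attach_angles_borel[OF i, of r] attach_angles_periodic, unfolded vim, folded limit_measure_def]
  show "measure lebesgue (attach_angles r i \<inter> {0..<2*pi}) \<le> exp (bound / r) * limit_measure i"
    using b(1) by (simp add: \<epsilon>_def)
  show "limit_measure i \<le> exp (bound / r) * measure lebesgue (attach_angles r i \<inter> {0..<2*pi})"
    using b(2) by (simp add: \<epsilon>_def)
qed

lemma tendsto_measure_attach_angles:
  assumes i: "i \<in> {1..n}"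
  shows "((\<lambda>r. measure lebesgue (attach_angles r i \<inter> {0..<2*pi})) \<longlongrightarrow> limit_measure i) at_top"
proof (rule tendsto_sandwich)
  have lim: "((\<lambda>r. exp (bound / r)) \<longlongrightarrow> exp 0) at_top"
    by (intro tendsto_exp tendsto_divide_0[OF tendsto_const] filterlim_at_top_imp_at_infinity filterlim_ident)
  have "((\<lambda>r. limit_measure i / exp (bound / r)) \<longlongrightarrow> limit_measure i / exp 0) at_top"
    by (intro tendsto_divide tendsto_const lim) simp
  then show "((\<lambda>r. limit_measure i / exp (bound / r)) \<longlongrightarrow> limit_measure i) at_top" by simp
  have "((\<lambda>r. exp (bound / r) * limit_measure i) \<longlongrightarrow> exp 0 * limit_measure i) at_top"
    by (intro tendsto_mult tendsto_const lim)
  then show "((\<lambda>r. exp (bound / r) * limit_measure i) \<longlongrightarrow> limit_measure i) at_top" by simp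
  show "\<forall>\<^sub>F r in at_top. limit_measure i / exp (bound / r) \<le> measure lebesgue (attach_angles r i \<inter> {0..<2*pi})"
    using eventually_ge_at_top[of "1 / eps0"]
    by eventually_elim (use measure_attach_angles_bounds(2)[OF _ i] in \<open>simp add: divide_le_eq mult.commute\<close>)
  show "\<forall>\<^sub>F r in at_top. measure lebesgue (attach_angles r i \<inter> {0..<2*pi}) \<le> exp (bound / r) * limit_measure i"
    using eventually_ge_at_top[of "1 / eps0"]
    by eventually_elim (rule measure_attach_angles_bounds(1)[OF _ i])
qed

text \<open>A sum of limits different from 2 pi would keep the total away from 2 pi at all large
  radii, whereas it equals 2 pi at almost every one of them.\<close>

lemma sum_limit_measure:
  assumes P: "property_P \<alpha> n x"
  shows "(\<Sum>i=1..n. limit_measure i) = 2 * pi"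
proof (rule ccontr)
  assume ne: "(\<Sum>i=1..n. limit_measure i) \<noteq> 2 * pi"
  have "((\<lambda>r. \<Sum>i=1..n. measure lebesgue (attach_angles r i \<inter> {0..<2*pi})) \<longlongrightarrow> (\<Sum>i=1..n. limit_measure i)) at_top"
    by (intro tendsto_sum tendsto_measure_attach_angles)
  from tendsto_imp_eventually_ne[OF this ne]
  obtain r0 where r0: "\<And>r. r0 \<le> r \<Longrightarrow> (\<Sum>i=1..n. measure lebesgue (attach_angles r i \<inter> {0..<2*pi})) \<noteq> 2 * pi"
    unfolding eventually_at_top_linorder by blast
  define c where "c = max r0 (extent + 1)"
  have "AE r in lborel. r \<notin> {c<..<c+1}"
    using AE_sum_measure_attach_angles[OF P] by eventually_elim (use r0 in \<open>auto simp: c_def\<close>)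
  then have "emeasure lborel {c<..<c+1} = 0"
    by (subst (asm) AE_iff_measurable[where N="{c<..<c+1}"]) auto
  then show False by simp
qed

text \<open>\<open>space angle_measure\<close> is the whole line; the restriction to one period sits
  in the measure.\<close>

lemma attach_event_eq: "attach_event \<alpha> n x r i = attach_angles r i"
  by (simp add: attach_event_def attach_angles_def dir_def angle_measure_def)

lemma attach_prob_eq:
  assumes i: "i \<in> {1..n}"
  shows "attach_prob \<alpha> n x r i = measure lebesgue (attach_angles r i \<inter> {0..<2*pi}) / (2 * pi)"
proof -
  have A: "attach_angles r i \<in> sets lborel" using attach_angles_borel[OF i] by simp
  then have "measure lebesgue (attach_angles r i \<inter> {0..<2*pi}) = measure lborel ({0..<2*pi} \<inter> attach_angles r i)"
    by (simp add: Int_commute)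
  then show ?thesis
    unfolding attach_prob_def attach_event_eq angle_measure_def
    by (subst measure_uniform_measure[OF _ _ A]) auto
qed

end

theorem theorem1:
  fixes \<alpha> :: real and n :: nat and x :: "nat \<Rightarrow> real^2"
  assumes "0 \<le> \<alpha>"
    and "is_cluster n x"
    and "property_P \<alpha> n x"
  shows "(\<forall>i\<in>{1..n}. \<forall>\<^sub>F r in at_top. attach_event \<alpha> n x r i \<in> sets angle_measure) \<and>
    (\<exists>p :: nat \<Rightarrow> real.
       (\<forall>i\<in>{1..n}. ((\<lambda>r. attach_prob \<alpha> n x r i) \<longlongrightarrow> p i) at_top) \<and>
       (\<Sum>i=1..n. p i) = 1)"
proof -
  interpret cluster \<alpha> n x by unfold_locales (rule assms)+
  have "attach_event \<alpha> n x r i \<in> sets angle_measure" if "i \<in> {1..n}" for r i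
    using attach_angles_borel[OF that] by (simp add: attach_event_eq angle_measure_def)
  moreover have "((\<lambda>r. attach_prob \<alpha> n x r i) \<longlongrightarrow> limit_measure i / (2 * pi)) at_top" if "i \<in> {1..n}" for i
    unfolding attach_prob_eq[OF that]
    by (intro tendsto_divide tendsto_const tendsto_measure_attach_angles[OF that]) simp
  moreover have "(\<Sum>i=1..n. limit_measure i / (2 * pi)) = 1"
    unfolding sum_divide_distrib[symmetric] sum_limit_measure[OF assms(3)] by simp
  ultimately show ?thesis by (intro conjI exI[of _ "\<lambda>i. limit_measure i / (2 * pi)"]) auto
qed

end
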